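(* Let $1\le q<p<+\infty$ and let $\varphi:\mathbb D\to\mathbb D$ be holomorphic with $\sigma(E_\varphi)>0$, where $E_\varphi=\{\xi\in\mathbb T:\ |\varphi^*(\xi)|=1\}$. Set $s=p/(p-q)$. Let $C_\varphi:H^p(\mathbb D)\to H^q(\mathbb D)$, $f\mapsto f\circ\varphi$, be the composition operator. Then $$\|F_\varphi\|_{L^s(\sigma)}^{1/q}\le \|C_\varphi\|_{e,p\to q}\le 2\|F_\varphi\|_{L^s(\sigma)}^{1/q}.$$ Moreover, when $q=2$, $\|C_\varphi\|_{e,p\to 2}=\|F_\varphi\|_{L^s(\sigma)}^{1/2}$.
   Context: $\mathbb D$ is the open unit disc of $\mathbb C$, $\mathbb T$ the unit circle, $\sigma$ the normalized Lebesgue measure on $\mathbb T$, and $H^p(\mathbb D)$ the usual Hardy spaces. For a holomorphic self-map $\varphi$ of $\mathbb D$, $\varphi^*$ denotes its radial limit function, defined $\sigma$-a.e. on $\mathbb T$. For a bounded operator $T:X\to Y$ between Banach spaces, the essential norm is $\inf\{\|T-K\|:\ K:X\to Y\text{ compact}\}$; $\|C_\varphi\|_{e,p\to q}$ denotes the essential norm of $C_\varphi:H^p(\mathbb D)\to H^q(\mathbb D)$. Write $E=E_\varphi$. The map $\varphi^*_{|E}:E\to\varphi^*(E)$ is nonsingular (it does not map a set of positive $\sigma$-measure into a set of $\sigma$-measure $0$), and $F_\varphi$ denotes the Radon-Nikodym derivative of the push-forward of $\sigma_{|E}$ under $\varphi^*$ with respect to $\sigma_{|\varphi^*(E)}$,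 extended by $0$ on $\mathbb T\setminus\varphi^*(E)$. In other words, $\sigma(\{\xi\in E:\varphi^*(\xi)\in A\})=\int_A F_\varphi\,d\sigma$ for every Borel set $A\subset\mathbb T$. *)

theory Defs
  imports "HOL-Probability.Probability" "HOL-Complex_Analysis.Complex_Analysis"
begin

text \<open>Normalized Lebesgue measure on the unit circle, as a Borel probability measure on the
  whole plane that is carried by the circle.\<close>

definition circle_measure :: "complex measure" where
  "circle_measure = distr (uniform_measure lborel {0..2 * pi}) borel cis"

definition radial_mean :: "real \<Rightarrow> (complex \<Rightarrow> complex) \<Rightarrow> real \<Rightarrow> real" where
  "radial_mean p f r = (LINT \<zeta>|circle_measure. norm (f (of_real r * \<zeta>)) powr p)"

text \<open>A function on the open unit disc is represented by its extension by \<open>0\<close> to the plane, so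
  that equality in the Hardy space is equality of HOL functions. The vector space operations are
  pointwise.\<close>

definition hardy_space :: "real \<Rightarrow> (complex \<Rightarrow> complex) set" where
  "hardy_space p = {f. f holomorphic_on ball 0 1 \<and> (\<forall>z. z \<notin> ball 0 1 \<longrightarrow> f z = 0) \<and>
     bdd_above (radial_mean p f ` {0..<1})}"

definition hardy_norm :: "real \<Rightarrow> (complex \<Rightarrow> complex) \<Rightarrow> real" where
  "hardy_norm p f = (SUP r\<in>{0..<1}. radial_mean p f r) powr (1 / p)"

text \<open>Operators between Hardy spaces are HOL functions whose values off \<^term>\<open>hardy_space p\<close>
  are irrelevant.\<close>

definition linear_operator ::
    "real \<Rightarrow> real \<Rightarrow> ((complex \<Rightarrow> complex) \<Rightarrow> complex \<Rightarrow> complex) \<Rightarrow> bool" where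
  "linear_operator p q T \<longleftrightarrow>
     (\<forall>f\<in>hardy_space p. T f \<in> hardy_space q) \<and>
     (\<forall>f\<in>hardy_space p. \<forall>g\<in>hardy_space p. T (\<lambda>z. f z + g z) = (\<lambda>z. T f z + T g z)) \<and>
     (\<forall>c. \<forall>f\<in>hardy_space p. T (\<lambda>z. c * f z) = (\<lambda>z. c * T f z))"

definition bounded_operator ::
    "real \<Rightarrow> real \<Rightarrow> ((complex \<Rightarrow> complex) \<Rightarrow> complex \<Rightarrow> complex) \<Rightarrow> bool" where
  "bounded_operator p q T \<longleftrightarrow> linear_operator p q T \<and>
     (\<exists>C. \<forall>f\<in>hardy_space p. hardy_norm q (T f) \<le> C * hardy_norm p f)"

definition compact_operator ::
    "real \<Rightarrow> real \<Rightarrow> ((complex \<Rightarrow> complex) \<Rightarrow> complex \<Rightarrow> complex) \<Rightarrow> bool" where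
  "compact_operator p q K \<longleftrightarrow> linear_operator p q K \<and>
     (\<forall>f :: nat \<Rightarrow> complex \<Rightarrow> complex.
        (\<forall>n. f n \<in> hardy_space p) \<and> bdd_above (range (\<lambda>n. hardy_norm p (f n))) \<longrightarrow>
        (\<exists>u g. strict_mono u \<and> g \<in> hardy_space q \<and>
           (\<lambda>n. hardy_norm q (\<lambda>z. K (f (u n)) z - g z)) \<longlonglongrightarrow> 0))"

text \<open>The suprema and infima below are meaningful for bounded operators only: for those, the
  sets involved are nonempty and bounded.\<close>

definition operator_norm ::
    "real \<Rightarrow> real \<Rightarrow> ((complex \<Rightarrow> complex) \<Rightarrow> complex \<Rightarrow> complex) \<Rightarrow> real" where
  "operator_norm p q T = (SUP f\<in>{f \<in> hardy_space p. hardy_norm p f \<le> 1}. hardy_norm q (T f))"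

definition essential_norm ::
    "real \<Rightarrow> real \<Rightarrow> ((complex \<Rightarrow> complex) \<Rightarrow> complex \<Rightarrow> complex) \<Rightarrow> real" where
  "essential_norm p q T =
     (INF K\<in>{K. compact_operator p q K}. operator_norm p q (\<lambda>f z. T f z - K f z))"

definition composition_operator ::
    "(complex \<Rightarrow> complex) \<Rightarrow> (complex \<Rightarrow> complex) \<Rightarrow> complex \<Rightarrow> complex" where
  "composition_operator \<phi> f = (\<lambda>z. if z \<in> ball 0 1 then f (\<phi> z) else 0)"

definition radial_limit :: "(complex \<Rightarrow> complex) \<Rightarrow> complex \<Rightarrow> complex" where
  "radial_limit \<phi> \<xi> = Lim (at_left 1) (\<lambda>r::real. \<phi> (of_real r * \<xi>))"

text \<open>The existence of the limit is required explicitly, because \<^const>\<open>Lim\<close> is unspecified where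
  the limit does not exist.\<close>

definition contact_set :: "(complex \<Rightarrow> complex) \<Rightarrow> complex set" where
  "contact_set \<phi> = {\<xi> \<in> sphere 0 1.
     (\<exists>l. ((\<lambda>r::real. \<phi> (of_real r * \<xi>)) \<longlongrightarrow> l) (at_left 1)) \<and> norm (radial_limit \<phi> \<xi>) = 1}"

definition contact_pushforward :: "(complex \<Rightarrow> complex) \<Rightarrow> complex measure" where
  "contact_pushforward \<phi> =
     distr (restrict_space circle_measure (contact_set \<phi>)) borel (radial_limit \<phi>)"

text \<open>The density \<open>F\<close> of the push-forward, determined almost everywhere by
  \<open>\<sigma> {\<xi> \<in> E. \<phi>\<^sup>* \<xi> \<in> A} = \<integral>\<^sub>A F d\<sigma>\<close> for all Borel sets \<open>A\<close>. The push-forward is carried by the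
  image \<open>\<phi>\<^sup>* E\<close>, so differentiating with respect to \<open>\<sigma>\<close> on the whole circle is the same as
  differentiating with respect to \<open>\<sigma>\<close> on that image and extending by \<open>0\<close>; the image itself need
  not be a Borel set.\<close>

definition contact_density :: "(complex \<Rightarrow> complex) \<Rightarrow> complex \<Rightarrow> real" where
  "contact_density \<phi> \<zeta> = enn2real (RN_deriv circle_measure (contact_pushforward \<phi>) \<zeta>)"

definition circle_Lp :: "real \<Rightarrow> (complex \<Rightarrow> real) set" where
  "circle_Lp s = {F \<in> borel_measurable circle_measure.
     integrable circle_measure (\<lambda>\<zeta>. \<bar>F \<zeta>\<bar> powr s)}"

definition circle_Lp_norm :: "real \<Rightarrow> (complex \<Rightarrow> real) \<Rightarrow> real" where
  "circle_Lp_norm s F = (LINT \<zeta>|circle_measure. \<bar>F \<zeta>\<bar> powr s) powr (1 / s)"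

end

theory Submission
  imports Defs
begin

text \<open>Write \<open>\<sigma>\<close> for the normalized arc length. Subordination, that is
  \<open>\<integral>|f \<circ> \<phi>|\<^sup>p d\<sigma> \<le> C \<integral>|f|\<^sup>p d\<sigma>\<close>, follows from the Poisson formula and Jensen's inequality. Since moduli of
  polynomials are dense in the nonnegative continuous functions on the circle, its case \<open>p = 1\<close> bounds
  the push-forward by \<open>C\<sigma>\<close>, so that \<open>F\<close> is even bounded.

  Lower bound: the functions \<open>z\<^sup>n Q\<close> are weakly null in \<open>H\<^sup>p\<close>, while
  \<open>\<parallel>C\<^sub>\<phi> (z\<^sup>n Q)\<parallel>\<^sup>q \<ge> \<integral>|Q|\<^sup>q F d\<sigma>\<close> for all \<open>n\<close>; take polynomials \<open>Q\<close> with \<open>|Q|\<close> close to a multiple of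
  \<open>F\<^bsup>1/(p-q)\<^esup>\<close>.

  Upper bound: the operators \<open>f \<mapsto> f(\<rho> \<phi>)\<close> are compact. Put \<open>g = f - f(\<rho> \<cdot>)\<close> with \<open>\<rho>\<close> close to \<open>1\<close>. Off the
  contact set \<open>g \<circ> \<phi>\<^sup>*\<close> is small in \<open>L\<^sup>q\<close>, uniformly in \<open>f\<close>, because \<open>q < p\<close>; on the contact set
  \<open>\<integral>|g|\<^sup>q F d\<sigma>\<close> is bounded by Hoelder's inequality and \<open>\<parallel>g\<parallel>\<^sub>p \<le> 2\<close>.
  For \<open>q = 2\<close>, convolution with the Poisson kernel almost commutes with the multiplication by \<open>\<surd>F\<close>, and
  its difference from the identity is a contraction of \<open>L\<^sup>2\<close>.

  Working with dilates of \<open>H\<^sup>p\<close> functions throughout, only the boundary values of \<open>\<phi>\<close> itself are needed.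
  They exist by a weak-type inequality for the radial maximal function, which comes from the maximal
  ergodic inequality for the Poisson semigroup and Harnack's inequality.\<close>

section \<open>The circle measure and the Poisson kernel\<close>

text \<open>Hardy spaces enter only through integral means over circles inside the disc, so no
  boundary function of a general H^p element is at hand. Estimates are proved for functions
  holomorphic beyond the closed disc, with bounds that depend only on a norm on the circle, and are
  transferred to H^p by dilation.

  The factor 2 of the general upper bound is the price of the triangle inequality: the difference of
  \<open>f\<close> and its dilate is bounded in L^p first and weighted by \<open>F\<close>
  afterwards. For exponent 2 the weight is a square, so \<open>\<surd>F\<close> can be multiplied
  into the function before the difference is taken. Hoelder's inequality then meets
  \<open>f\<close>, of norm at most 1, instead of the difference, and subtracting the Poisson mean
  costs nothing: a positive self-adjoint contraction subtracted from the identity of L^2 leaves a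
  contraction. Outside L^2 this need not hold.

  Operator norm and essential norm are suprema and infima of real sets, so the boundedness of these
  sets has to be established before they can be compared with anything.\<close>

abbreviation circle_mean :: "(complex \<Rightarrow> 'a) \<Rightarrow> 'a::{banach, second_countable_topology}" (binder "AVG " 60) where
  "circle_mean f \<equiv> integral\<^sup>L circle_measure f"

lemma sets_circle_measure [measurable_cong, simp]: "sets circle_measure = sets borel"
  by (simp add: circle_measure_def)

lemma space_circle_measure [simp]: "space circle_measure = UNIV"
  by (simp add: circle_measure_def)

lemma borel_measurable_cis [measurable, simp]: "cis \<in> borel_measurable borel"
  by (intro borel_measurable_continuous_onI continuous_intros)

lemma prob_space_circle_measure: "prob_space circle_measure"
proof -
  have "prob_space (uniform_measure lborel {0..2 * pi})"
    by (rule prob_space_uniform_measure) auto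
  then show ?thesis unfolding circle_measure_def
    by (rule prob_space.prob_space_distr) simp
qed

interpretation circle: prob_space circle_measure
  by (rule prob_space_circle_measure)

lemma borel_measurable_cnj [measurable]: "cnj \<in> borel_measurable borel"
  by (intro borel_measurable_continuous_onI continuous_intros)

lemma AE_circle_measure: "AE z in circle_measure. norm z = 1"
  unfolding circle_measure_def by (subst AE_distr_iff) auto

lemma integral_circle_measure:
  fixes f :: "complex \<Rightarrow> 'b::{banach, second_countable_topology}"
  assumes [measurable]: "f \<in> borel_measurable borel"
  shows "(AVG z. f z) =
    (1 / (2 * pi)) *\<^sub>R (LINT t:{0..2 * pi}|lborel. f (cis t))"
proof -
  have u: "uniform_measure lborel {0..2 * pi} = 
      density lborel (\<lambda>t. ennreal (indicator {0..2 * pi} t / (2 * pi)))"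
    unfolding uniform_measure_def
    by (rule density_cong)
       (auto simp: divide_ennreal[symmetric] ennreal_indicator split: split_indicator)
  have "(AVG z. f z) = (LINT t|uniform_measure lborel {0..2 * pi}. f (cis t))"
    unfolding circle_measure_def by (rule integral_distr) simp_all
  also have "\<dots> = (LINT t|lborel. (indicator {0..2 * pi} t / (2 * pi)) *\<^sub>R f (cis t))"
    unfolding u by (rule integral_density) auto
  also have "\<dots> = (LINT t|lborel. (1 / (2 * pi)) *\<^sub>R (indicator {0..2 * pi} t *\<^sub>R f (cis t)))"
    by (intro Bochner_Integration.integral_cong) auto
  finally show ?thesis
    by (simp only: integral_scaleR_right set_lebesgue_integral_def)
qed

text \<open>Measurability is required on the whole plane, but the bound only on the circle, which
  carries the measure. Most integrability claims below reduce to this.\<close>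

lemma integrable_circle_bounded:
  fixes f :: "complex \<Rightarrow> 'b::{banach, second_countable_topology}"
  assumes "f \<in> borel_measurable borel" and "\<And>z. norm z = 1 \<Longrightarrow> norm (f z) \<le> B"
  shows "integrable circle_measure f"
  by (rule circle.integrable_const_bound[where B = B])
     (use assms AE_circle_measure in \<open>auto\<close>)

lemma continuous_on_sphere_bounded:
  fixes f :: "complex \<Rightarrow> 'b::real_normed_vector"
  assumes "continuous_on (sphere 0 1) f"
  obtains B where "\<And>z. norm z = 1 \<Longrightarrow> norm (f z) \<le> B"
proof -
  have "compact (f ` sphere 0 1)"
    using assms by (intro compact_continuous_image) auto
  then have "bounded (f ` sphere 0 1)" by (rule compact_imp_bounded)
  then show ?thesis using that unfolding bounded_iff by fastforce
qed

lemma integrable_circle_continuous: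
  fixes f :: "complex \<Rightarrow> 'b::{banach, second_countable_topology}"
  assumes "f \<in> borel_measurable borel" and "continuous_on (sphere 0 1) f"
  shows "integrable circle_measure f"
  using continuous_on_sphere_bounded[OF assms(2)] integrable_circle_bounded[OF assms(1)] by metis

lemma circle_integral_cong:
  fixes f g :: "complex \<Rightarrow> 'b::{banach, second_countable_topology}"
  assumes "f \<in> borel_measurable borel" "g \<in> borel_measurable borel"
    and "\<And>z. norm z = 1 \<Longrightarrow> f z = g z"
  shows "(AVG z. f z) = (AVG z. g z)"
  using assms AE_circle_measure by (intro integral_cong_AE) auto

section \<open>The formulas of Cauchy and Poisson on the circle\<close>

lemma holomorphic_continuous_on_sphere:
  assumes "f holomorphic_on ball 0 R" "1 < R"
  shows "continuous_on (sphere (0::complex) 1) f"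
  using assms by (intro holomorphic_on_imp_continuous_on holomorphic_on_subset[OF assms(1)]) auto

lemma one_minus_cnj_nonzero:
  assumes "norm w < 1" "norm z = 1" shows "1 - w * cnj z \<noteq> 0"
proof
  assume "1 - w * cnj z = 0"
  then have "norm (w * cnj z) = 1" by (metis eq_iff_diff_eq_0 norm_one)
  with assms show False by (simp add: norm_mult)
qed

text \<open>On the unit circle \<open>dz / (z - w)\<close> becomes
  \<open>\<i> dt / (1 - w * cnj z)\<close>, since
  \<open>cis t - w = cis t * (1 - w * cnj (cis t))\<close>. The conjugate form is the one that
  occurs as a factor of the Poisson kernel.\<close>

lemma Cauchy_formula_circle:
  assumes [measurable]: "f \<in> borel_measurable borel"
    and hol: "f holomorphic_on ball 0 R" and R: "1 < R" and w: "norm w < 1"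
  shows "integrable circle_measure (\<lambda>z. f z / (1 - w * cnj z))"
    and "(AVG z. f z / (1 - w * cnj z)) = f w"
proof -
  have cont: "continuous_on (sphere 0 1) f"
    by (rule holomorphic_continuous_on_sphere[OF hol R])
  have cont': "continuous_on (sphere 0 1) (\<lambda>z. f z / (1 - w * cnj z))"
    using one_minus_cnj_nonzero[OF w] by (intro continuous_intros cont) auto
  show "integrable circle_measure (\<lambda>z. f z / (1 - w * cnj z))"
    by (rule integrable_circle_continuous[OF _ cont']) measurable
  have contc: "continuous_on {0..2*pi} (\<lambda>t. f (cis t) / (1 - w * cnj (cis t)))"
    by (rule continuous_on_compose2[OF cont', of _ cis]) (auto intro!: continuous_intros)
  have "((\<lambda>u. f u / (u - w)) has_contour_integral (2 * of_real pi * \<i> * f w)) (circlepath 0 1)"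
    using w R by (intro Cauchy_integral_circlepath_simple holomorphic_on_subset[OF hol]) auto
  then have "((\<lambda>t. f (cis t) / (cis t - w) * \<i> * cis t) has_integral (2 * of_real pi * \<i> * f w)) {0..2*pi}"
    unfolding circlepath_def by (subst (asm) has_contour_integral_part_circlepath_iff) auto
  then have "((\<lambda>t. \<i> * (f (cis t) / (1 - w * cnj (cis t)))) has_integral (2 * of_real pi * \<i> * f w)) {0..2*pi}"
  proof (rule has_integral_eq[rotated])
    fix t
    have "cis t - w = cis t * (1 - w * cnj (cis t))"
      by (simp add: algebra_simps cis_cnj cis_mult)
    then show "f (cis t) / (cis t - w) * \<i> * cis t = \<i> * (f (cis t) / (1 - w * cnj (cis t)))"
      using one_minus_cnj_nonzero[OF w, of "cis t"] by (simp add: divide_simps)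
  qed
  then have "((\<lambda>t. (-\<i>) * (\<i> * (f (cis t) / (1 - w * cnj (cis t))))) has_integral (-\<i>) * (2 * of_real pi * \<i> * f w)) {0..2*pi}"
    by (rule has_integral_mult_right)
  then have I: "integral {0..2*pi} (\<lambda>t. f (cis t) / (1 - w * cnj (cis t))) = 2 * of_real pi * f w"
    by (intro integral_unique) (simp add: field_simps)
  have "(LINT t:{0..2*pi}|lborel. f (cis t) / (1 - w * cnj (cis t))) = integral {0..2*pi} (\<lambda>t. f (cis t) / (1 - w * cnj (cis t)))"
    by (intro set_borel_integral_eq_integral(2) borel_integrable_atLeastAtMost' contc)
  with I show "(AVG z. f z / (1 - w * cnj z)) = f w"
    by (subst integral_circle_measure) (auto simp: scaleR_conv_of_real)
qed

definition poisson_kernel :: "complex \<Rightarrow> complex \<Rightarrow> real" where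
  "poisson_kernel w z = (1 - (norm w)\<^sup>2) / (norm (z - w))\<^sup>2"

lemma borel_measurable_poisson_kernel [measurable (raw)]:
  assumes "f \<in> borel_measurable M" "g \<in> borel_measurable M"
  shows "(\<lambda>x. poisson_kernel (f x) (g x)) \<in> borel_measurable M"
  using assms unfolding poisson_kernel_def by measurable

lemma poisson_kernel_nonneg: "norm w < 1 \<Longrightarrow> 0 \<le> poisson_kernel w z"
  unfolding poisson_kernel_def by (intro divide_nonneg_nonneg) (auto simp: abs_square_le_1)

lemma poisson_kernel_le:
  assumes "norm w < 1" "norm z = 1"
  shows "poisson_kernel w z \<le> (1 + norm w) / (1 - norm w)"
proof -
  have "norm z \<le> norm (z - w) + norm w" by (metis add.commute norm_triangle_sub)
  then have "(1 - norm w)\<^sup>2 \<le> (norm (z - w))\<^sup>2" 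
    using assms by (intro power_mono) auto
  then have "poisson_kernel w z \<le> (1 - (norm w)\<^sup>2) / (1 - norm w)\<^sup>2"
    unfolding poisson_kernel_def using assms
    by (intro divide_left_mono mult_pos_pos) (auto simp: abs_square_le_1)
  also have "1 - (norm w)\<^sup>2 = (1 + norm w) * (1 - norm w)" by (simp add: power2_eq_square algebra_simps)
  also have "\<dots> / (1 - norm w)\<^sup>2 = (1 + norm w) / (1 - norm w)"
    using assms by (simp add: power2_eq_square)
  finally show ?thesis .
qed

lemma poisson_kernel_Re:
  assumes "norm z = 1"
  shows "poisson_kernel w z = Re ((z + w) / (z - w))"
proof (cases "z = w")
  case True then show ?thesis using assms by (simp add: poisson_kernel_def)
next
  case False
  have "Re ((z + w) / (z - w)) = Re ((z + w) * cnj (z - w)) / (norm (z - w))\<^sup>2"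
    by (subst complex_div_cnj) (simp only: Re_divide_of_real of_real_power[symmetric])
  also have "Re ((z + w) * cnj (z - w)) = (norm z)\<^sup>2 - (norm w)\<^sup>2"
    unfolding cmod_power2 by (simp add: power2_eq_square algebra_simps)
  finally show ?thesis using assms by (simp add: poisson_kernel_def)
qed

lemma poisson_kernel_commute:
  assumes "norm z = 1" "norm u = 1"
  shows "poisson_kernel (of_real r * u) z = poisson_kernel (of_real r * z) u"
proof -
  have "(norm (z - of_real r * u))\<^sup>2 = (norm z)\<^sup>2 + r\<^sup>2 * (norm u)\<^sup>2 - 2 * r * (Re z * Re u + Im z * Im u)"
    unfolding cmod_power2 by (simp add: power2_eq_square algebra_simps)
  moreover have "(norm (u - of_real r * z))\<^sup>2 = (norm u)\<^sup>2 + r\<^sup>2 * (norm z)\<^sup>2 - 2 * r * (Re z * Re u + Im z * Im u)"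
    unfolding cmod_power2 by (simp add: power2_eq_square algebra_simps)
  ultimately show ?thesis
    using assms by (simp add: poisson_kernel_def norm_mult)
qed

lemma poisson_kernel_eq_cauchy:
  assumes w: "norm w < 1" and z: "norm z = 1"
  shows "of_real (poisson_kernel w z) = of_real (1 - (norm w)\<^sup>2) / (1 - cnj w * z) / (1 - w * cnj z)"
proof -
  have z1: "z * cnj z = 1" using z by (simp add: complex_norm_square[symmetric])
  have "(1 - cnj w * z) * (1 - w * cnj z) = 1 - w * cnj z - cnj w * z + w * cnj w * (z * cnj z)"
    by (simp add: algebra_simps)
  also have "\<dots> = z * cnj z - w * cnj z - cnj w * z + w * cnj w"
    by (simp only: z1 mult_1_right)
  also have "\<dots> = (z - w) * cnj (z - w)" by (simp add: algebra_simps)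
  also have "\<dots> = of_real ((norm (z - w))\<^sup>2)"
    by (simp only: complex_norm_square)
  finally show ?thesis by (simp add: poisson_kernel_def)
qed

text \<open>The kernel is the product of the Cauchy kernel and
  \<open>(1 - |w|^2) / (1 - cnj w * z)\<close>, which is holomorphic in \<open>z\<close> beyond the
  closed disc. Absorbed into \<open>f\<close>, the second factor turns the claim into Cauchy's
  formula for \<open>G\<close>, and it equals 1 at \<open>z = w\<close>.\<close>

lemma poisson_formula:
  assumes f [measurable]: "f \<in> borel_measurable borel"
    and hol: "f holomorphic_on ball 0 R" and R: "1 < R" and w: "norm w < 1"
  shows "integrable circle_measure (\<lambda>z. poisson_kernel w z *\<^sub>R f z)"
    and "(AVG z. poisson_kernel w z *\<^sub>R f z) = f w"
proof -
  define G where "G = (\<lambda>z. of_real (1 - (norm w)\<^sup>2) * f z / (1 - cnj w * z))"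
  \<comment> \<open>The pole of \<open>G\<close> has modulus \<open>1 / |w|\<close>, which is at
    least \<open>2 / (1 + |w|)\<close>. Unlike the former, the latter number is also right for
    \<open>w = 0\<close>, where division by zero would give radius 0.\<close>
  define R' where "R' = min R (2 / (1 + norm w))"
  have R': "1 < R'" using R w by (simp add: R'_def less_divide_eq add_pos_nonneg)
  have nz: "1 - cnj w * z \<noteq> 0" if "z \<in> ball 0 R'" for z
  proof
    assume "1 - cnj w * z = 0"
    then have "norm (cnj w * z) = 1" by (metis eq_iff_diff_eq_0 norm_one)
    then have 1: "norm w * norm z = 1" by (simp add: norm_mult)
    have "norm z < 2 / (1 + norm w)" using that by (simp add: R'_def)
    moreover have "0 < 1 + norm w" by (simp add: add_pos_nonneg)
    ultimately have "norm z * (1 + norm w) < 2" by (simp add: pos_less_divide_eq)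
    then have "norm z < 1" using 1 by (simp add: algebra_simps)
    then have "norm w * norm z \<le> norm w * 1" by (intro mult_left_mono) auto
    with 1 w show False by simp
  qed
  have G [measurable]: "G \<in> borel_measurable borel" unfolding G_def by measurable
  have holG: "G holomorphic_on ball 0 R'" unfolding G_def
    using nz by (intro holomorphic_intros holomorphic_on_subset[OF hol]) (auto simp: R'_def)
  have eq: "poisson_kernel w z *\<^sub>R f z = G z / (1 - w * cnj z)" if "norm z = 1" for z
    unfolding scaleR_conv_of_real poisson_kernel_eq_cauchy[OF w that] G_def by simp
  have GI: "integrable circle_measure (\<lambda>z. G z / (1 - w * cnj z))"
    by (rule Cauchy_formula_circle(1)[OF G holG R' w])
  show "integrable circle_measure (\<lambda>z. poisson_kernel w z *\<^sub>R f z)"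
    by (rule integrable_cong_AE_imp[OF GI]) (use AE_circle_measure eq in auto)
  have "(AVG z. poisson_kernel w z *\<^sub>R f z) = (AVG z. G z / (1 - w * cnj z))"
    by (rule circle_integral_cong) (use eq in auto)
  also have "\<dots> = G w"
    by (rule Cauchy_formula_circle(2)[OF G holG R' w])
  also have "\<dots> = f w"
  proof -
    have "1 - cnj w * w = of_real (1 - (norm w)\<^sup>2)"
      by (simp add: complex_norm_square[symmetric] mult.commute[of "cnj w"])
    moreover have "1 - (norm w)\<^sup>2 \<noteq> 0" using w by (smt (verit) norm_ge_zero power2_eq_1_iff)
    ultimately show ?thesis unfolding G_def by (simp only: nonzero_mult_div_cancel_left of_real_eq_0_iff not_False_eq_True)
  qed
  finally show "(AVG z. poisson_kernel w z *\<^sub>R f z) = f w" .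
qed

text \<open>For \<open>z\<close> on the circle the kernel at the point
  \<open>\<phi> (r * \<xi>)\<close> is the real part of a function holomorphic in
  \<open>\<xi>\<close> beyond the closed disc, so the Poisson formula reproduces it. For the
  identity map this is the semigroup law of the kernels; for \<open>w = 0\<close> it computes the
  mean that subordination needs.\<close>

lemma poisson_kernel_subordination:
  assumes \<phi> [measurable]: "\<phi> \<in> borel_measurable borel"
    and hol: "\<phi> holomorphic_on ball 0 1" and self: "\<phi> ` ball 0 1 \<subseteq> ball 0 1"
    and r: "0 \<le> r" "r < 1" and w: "norm w < 1" and z: "norm z = 1"
  shows "integrable circle_measure (\<lambda>\<xi>. poisson_kernel w \<xi> * poisson_kernel (\<phi> (of_real r * \<xi>)) z)"
    and "(AVG \<xi>. poisson_kernel w \<xi> * poisson_kernel (\<phi> (of_real r * \<xi>)) z) =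
      poisson_kernel (\<phi> (of_real r * w)) z"
proof -
  define H where "H = (\<lambda>\<xi>. (z + \<phi> (of_real r * \<xi>)) / (z - \<phi> (of_real r * \<xi>)))"
  \<comment> \<open>A number above 1 with \<open>r * R < 1\<close>, also for
    \<open>r = 0\<close>.\<close>
  define R where "R = 2 / (1 + r)"
  have R: "1 < R" using r by (simp add: R_def)
  have b: "of_real r * \<xi> \<in> ball 0 1" if "norm \<xi> < R" for \<xi> :: complex
  proof -
    have "r * norm \<xi> \<le> r * R" using that r by (intro mult_left_mono) auto
    also have "\<dots> < 1" using r by (simp add: R_def field_simps)
    finally show ?thesis using r by (simp add: norm_mult)
  qed
  have H [measurable]: "H \<in> borel_measurable borel" unfolding H_def by measurable
  have holH: "H holomorphic_on ball 0 R"
  proof -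
    have "(\<lambda>\<xi>. \<phi> (of_real r * \<xi>)) holomorphic_on ball 0 R"
      by (rule holomorphic_on_compose_gen[OF _ hol, unfolded o_def]) (use b in \<open>auto intro!: holomorphic_intros\<close>)
    moreover have "z - \<phi> (of_real r * \<xi>) \<noteq> 0" if "\<xi> \<in> ball 0 R" for \<xi>
    proof -
      have "norm (\<phi> (of_real r * \<xi>)) < 1" using b[of \<xi>] that self by (auto simp: image_subset_iff)
      then show ?thesis using z by auto
    qed
    ultimately show ?thesis unfolding H_def by (intro holomorphic_intros) auto
  qed
  have eq: "poisson_kernel w \<xi> * poisson_kernel (\<phi> (of_real r * \<xi>)) z = Re (poisson_kernel w \<xi> *\<^sub>R H \<xi>)" for \<xi>
    unfolding H_def poisson_kernel_Re[OF z] by simp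
  note P = poisson_formula[OF H holH R w]
  show "integrable circle_measure (\<lambda>\<xi>. poisson_kernel w \<xi> * poisson_kernel (\<phi> (of_real r * \<xi>)) z)"
    unfolding eq by (rule integrable_Re[OF P(1)])
  have "(AVG \<xi>. poisson_kernel w \<xi> * poisson_kernel (\<phi> (of_real r * \<xi>)) z) = Re (H w)"
    unfolding eq integral_Re[OF P(1)] P(2) ..
  then show "(AVG \<xi>. poisson_kernel w \<xi> * poisson_kernel (\<phi> (of_real r * \<xi>)) z) =
      poisson_kernel (\<phi> (of_real r * w)) z"
    unfolding H_def poisson_kernel_Re[OF z] .
qed

lemma poisson_kernel_0: "norm z = 1 \<Longrightarrow> poisson_kernel 0 z = 1"
  by (simp add: poisson_kernel_def)

lemma integral_poisson_kernel:
  assumes "norm w < 1"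
  shows "integrable circle_measure (poisson_kernel w)" "(AVG z. poisson_kernel w z) = 1"
proof -
  have "integrable circle_measure (\<lambda>z. Re (poisson_kernel w z *\<^sub>R 1))"
    and "(AVG z. Re (poisson_kernel w z *\<^sub>R 1)) = 1"
    using poisson_formula[of "\<lambda>_. 1" 2 w, OF _ _ _ assms]
    by (auto simp only: integrable_Re integral_Re one_complex.sel borel_measurable_const holomorphic_on_const)
  then show "integrable circle_measure (poisson_kernel w)" "(AVG z. poisson_kernel w z) = 1"
    by auto
qed

section \<open>Inequalities in \<open>L\<^sup>p\<close> and the Poisson operator\<close>

text \<open>The supporting line of \<open>x powr p\<close> at \<open>m\<close>. Young's inequality
  for the product of \<open>x\<close> and \<open>m powr (p - 1)\<close> gives it without
  derivatives; the cases \<open>p = 1\<close>, with no conjugate exponent, and \<open>m = 0\<close>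
  are immediate.\<close>

lemma powr_ge_tangent:
  fixes p x m :: real
  assumes "1 \<le> p" "0 \<le> x" "0 \<le> m"
  shows "m powr p + p * m powr (p - 1) * (x - m) \<le> x powr p"
proof (cases "p = 1 \<or> m = 0")
  case True
  then show ?thesis using assms by auto
next
  case False
  then have p: "1 < p" and m: "0 < m" using assms by auto
  have "x * m powr (p - 1) \<le> x powr p / p + (m powr (p - 1)) powr (p / (p - 1)) / (p / (p - 1))"
    using p assms by (intro Youngs_inequality) (auto simp: field_simps)
  also have "(m powr (p - 1)) powr (p / (p - 1)) = m powr p"
    using p by (simp add: powr_powr)
  finally have "p * (x * m powr (p - 1)) \<le> p * (x powr p / p + m powr p / (p / (p - 1)))"
    using p by (intro mult_left_mono) auto
  also have "\<dots> = x powr p + (p - 1) * m powr p"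
    using p by (simp add: field_simps)
  finally have "p * (x * m powr (p - 1)) \<le> x powr p + (p - 1) * m powr p" .
  moreover have "m powr (p - 1) * m = m powr p"
    using m powr_mult_base[of m "p - 1"] by (simp add: mult.commute)
  ultimately show ?thesis by (simp add: algebra_simps)
qed

lemma powr_convex_combination:
  fixes p x y s t :: real
  assumes "1 \<le> p" "0 \<le> x" "0 \<le> y" "0 \<le> s" "0 \<le> t" "s + t = 1"
  shows "(s * x + t * y) powr p \<le> s * x powr p + t * y powr p"
proof -
  define m where "m = s * x + t * y"
  have m: "0 \<le> m" using assms by (simp add: m_def)
  have "s * (m powr p + p * m powr (p - 1) * (x - m)) + t * (m powr p + p * m powr (p - 1) * (y - m))
      \<le> s * x powr p + t * y powr p"
    using powr_ge_tangent[OF assms(1,2) m] powr_ge_tangent[OF assms(1,3) m] assms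
    by (intro add_mono mult_left_mono) auto
  moreover have "s * (m powr p + p * m powr (p - 1) * (x - m)) + t * (m powr p + p * m powr (p - 1) * (y - m))
      = (s + t) * m powr p + p * m powr (p - 1) * (s * x + t * y - (s + t) * m)"
    by (simp add: algebra_simps)
  ultimately show ?thesis using assms by (simp add: m_def)
qed

text \<open>Convexity with the weights \<open>a / (a + b)\<close> and \<open>b / (a + b)\<close>,
  applied to \<open>|f| / a\<close> and \<open>|g| / b\<close>. Positive bounds in place of the
  norms themselves avoid the division by a vanishing norm.\<close>

lemma Minkowski_powr_bound:
  fixes f g :: "'a \<Rightarrow> 'b::{banach, second_countable_topology}"
  assumes p: "1 \<le> p" and a: "0 < a" and b: "0 < b"
    and [measurable]: "f \<in> borel_measurable M" "g \<in> borel_measurable M"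
    and f: "integrable M (\<lambda>x. norm (f x) powr p)" "(LINT x|M. norm (f x) powr p) \<le> a powr p"
    and g: "integrable M (\<lambda>x. norm (g x) powr p)" "(LINT x|M. norm (g x) powr p) \<le> b powr p"
  shows "integrable M (\<lambda>x. norm (f x + g x) powr p)"
    and "(LINT x|M. norm (f x + g x) powr p) \<le> (a + b) powr p"
proof -
  let ?h = "\<lambda>x. (a + b) powr p * (a / (a + b) * (norm (f x) powr p / a powr p) + b / (a + b) * (norm (g x) powr p / b powr p))"
  have le: "norm (f x + g x) powr p \<le> ?h x" for x
  proof -
    have "norm (f x + g x) powr p \<le> (norm (f x) + norm (g x)) powr p"
      using p by (intro powr_mono2 norm_triangle_ineq) auto
    also have "norm (f x) + norm (g x) = (a + b) * (a / (a + b) * (norm (f x) / a) + b / (a + b) * (norm (g x) / b))"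
    proof -
      have "(a + b) * (a / (a + b) * (norm (f x) / a)) = norm (f x)" "(a + b) * (b / (a + b) * (norm (g x) / b)) = norm (g x)"
        using a b by auto
      then show ?thesis by (simp only: distrib_left)
    qed
    also have "\<dots> powr p = (a + b) powr p * (a / (a + b) * (norm (f x) / a) + b / (a + b) * (norm (g x) / b)) powr p"
      using a b by (intro powr_mult)
    also have "\<dots> \<le> (a + b) powr p * (a / (a + b) * (norm (f x) / a) powr p + b / (a + b) * (norm (g x) / b) powr p)"
    proof (intro mult_left_mono powr_convex_combination)
      show "a / (a + b) + b / (a + b) = 1" using a b by (simp flip: add_divide_distrib)
    qed (use a b p in auto)
    finally show ?thesis using a b by (simp add: powr_divide)
  qed
  have I: "integrable M ?h" using f(1) g(1) by (intro integrable_mult_right Bochner_Integration.integrable_add integrable_divide) auto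
  show int: "integrable M (\<lambda>x. norm (f x + g x) powr p)"
    by (rule Bochner_Integration.integrable_bound[OF I]) (use le in \<open>auto intro!: AE_I2 order_trans[OF le abs_ge_self] simp del: times_divide_eq_right times_divide_eq_left divide_divide_eq_left\<close>)
  have "(LINT x|M. norm (f x + g x) powr p) \<le> (LINT x|M. ?h x)"
    by (intro integral_mono int I le)
  also have "\<dots> = (a + b) powr p * (a / (a + b) * ((LINT x|M. norm (f x) powr p) / a powr p) + b / (a + b) * ((LINT x|M. norm (g x) powr p) / b powr p))"
    using f(1) g(1) by simp
  also have "\<dots> \<le> (a + b) powr p * (a / (a + b) * 1 + b / (a + b) * 1)"
    using f(2) g(2) a b by (intro mult_left_mono add_mono) auto
  also have "\<dots> = (a + b) powr p" using a b by (simp add: add_divide_distrib[symmetric])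
  finally show "(LINT x|M. norm (f x + g x) powr p) \<le> (a + b) powr p" .
qed

lemma Hoelder_inequality:
  fixes u v :: "'a \<Rightarrow> real"
  assumes p: "1 < p" "1 < q" "1 / p + 1 / q = 1"
    and [measurable]: "u \<in> borel_measurable M" "v \<in> borel_measurable M"
    and nonneg: "\<And>x. 0 \<le> u x" "\<And>x. 0 \<le> v x"
    and I: "integrable M (\<lambda>x. u x powr p)" "integrable M (\<lambda>x. v x powr q)"
  shows "integrable M (\<lambda>x. u x * v x)"
    and "(LINT x|M. u x * v x) \<le> (LINT x|M. u x powr p) powr (1 / p) * (LINT x|M. v x powr q) powr (1 / q)"
proof -
  have Y: "u x * v x \<le> u x powr p / p + v x powr q / q" for x
    by (rule Youngs_inequality[OF p]) (use nonneg in auto)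
  have IY: "integrable M (\<lambda>x. u x powr p / p + v x powr q / q)" using I by auto
  show int: "integrable M (\<lambda>x. u x * v x)"
    by (rule Bochner_Integration.integrable_bound[OF IY])
       (use Y nonneg in \<open>auto simp: abs_mult intro!: order_trans[OF Y abs_ge_self]\<close>)
  define A where "A = (LINT x|M. u x powr p)"
  define B where "B = (LINT x|M. v x powr q)"
  have A0: "0 \<le> A" and B0: "0 \<le> B" unfolding A_def B_def by auto
  show "(LINT x|M. u x * v x) \<le> (LINT x|M. u x powr p) powr (1 / p) * (LINT x|M. v x powr q) powr (1 / q)"
  proof (cases "A = 0 \<or> B = 0")
    case True
    have "AE x in M. u x * v x = 0"
    proof (cases "A = 0")
      case True
      then have "AE x in M. u x powr p = 0"
        using integral_nonneg_eq_0_iff_AE[OF I(1)] unfolding A_def by auto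
      then show ?thesis by eventually_elim auto
    next
      case False
      then have "AE x in M. v x powr q = 0"
        using integral_nonneg_eq_0_iff_AE[OF I(2)] \<open>A = 0 \<or> B = 0\<close> unfolding B_def by auto
      then show ?thesis by eventually_elim auto
    qed
    then have "(LINT x|M. u x * v x) = 0" by (rule integral_eq_zero_AE)
    then show ?thesis by simp
  next
    case False
    then have A: "0 < A" and B: "0 < B" using A0 B0 by auto
    define c where "c = A powr (1 / p) * B powr (1 / q)"
    have c: "0 < c" using A B by (simp add: c_def)
    have Y': "u x * v x \<le> c * (u x powr p / A / p + v x powr q / B / q)" for x
    proof -
      have "(u x / A powr (1 / p)) * (v x / B powr (1 / q)) \<le>
          (u x / A powr (1 / p)) powr p / p + (v x / B powr (1 / q)) powr q / q"
        by (rule Youngs_inequality[OF p]) (use nonneg in auto)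
      also have "(u x / A powr (1 / p)) powr p = u x powr p / A"
        using p A nonneg by (simp add: powr_divide powr_powr)
      also have "(v x / B powr (1 / q)) powr q = v x powr q / B"
        using p B nonneg by (simp add: powr_divide powr_powr)
      finally have "c * ((u x / A powr (1 / p)) * (v x / B powr (1 / q))) \<le> c * (u x powr p / A / p + v x powr q / B / q)"
        using c by (intro mult_left_mono) auto
      moreover have "c * ((u x / A powr (1 / p)) * (v x / B powr (1 / q))) = u x * v x"
        using A B by (simp add: c_def)
      ultimately show ?thesis by simp
    qed
    have "integrable M (\<lambda>x. u x powr p / A / p + v x powr q / B / q)"
      by (intro Bochner_Integration.integrable_add integrable_divide I)
    then have "(LINT x|M. u x * v x) \<le> (LINT x|M. c * (u x powr p / A / p + v x powr q / B / q))"
      using int Y' by (intro integral_mono integrable_mult_right)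
    also have "\<dots> = c * (A / A / p + B / B / q)"
      using I by (simp add: A_def B_def)
    also have "\<dots> = c" using A B p by simp
    finally show ?thesis by (simp add: c_def A_def B_def)
  qed
qed

text \<open>The supporting line at the weighted mean \<open>m\<close> of \<open>|u|\<close> is
  integrated. The probability is given as a density \<open>k\<close>, so that the Poisson kernel can
  be inserted directly; the constant density 1 yields the comparison of L^p norms.\<close>

lemma Jensen_powr_kernel:
  fixes u :: "'a \<Rightarrow> 'b::{banach, second_countable_topology}"
  assumes p: "1 \<le> p" and [measurable]: "u \<in> borel_measurable M"
    and k: "integrable M k" "(LINT x|M. k x) = 1" "AE x in M. 0 \<le> k x"
    and I: "integrable M (\<lambda>x. k x * norm (u x) powr p)"
  shows "integrable M (\<lambda>x. k x *\<^sub>R u x)"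
    and "norm (LINT x|M. k x *\<^sub>R u x) powr p \<le> (LINT x|M. k x * norm (u x) powr p)"
proof -
  have [measurable]: "k \<in> borel_measurable M" using k by auto
  \<comment> \<open>Turns integrability of \<open>k * |u|^p\<close> into integrability of
    \<open>k * |u|\<close>, because \<open>k\<close> itself is integrable.\<close>
  have b: "t \<le> 1 + t powr p" if "0 \<le> t" for t :: real
  proof (cases "t \<le> 1")
    case False
    then have "t powr 1 \<le> t powr p" using p by (intro powr_mono) auto
    with that False show ?thesis by simp
  qed (auto intro: add_increasing2)
  have I1: "integrable M (\<lambda>x. k x + k x * norm (u x) powr p)" using k I by auto
  show I2: "integrable M (\<lambda>x. k x *\<^sub>R u x)"
  proof (rule Bochner_Integration.integrable_bound[OF I1])
    show "AE x in M. norm (k x *\<^sub>R u x) \<le> norm (k x + k x * norm (u x) powr p)"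
      using k(3)
    proof eventually_elim
      case (elim x)
      then have "norm (k x *\<^sub>R u x) \<le> k x * (1 + norm (u x) powr p)"
        using b[of "norm (u x)"] by (auto intro!: mult_left_mono)
      also have "\<dots> \<le> norm (k x * (1 + norm (u x) powr p))" by simp
      finally show ?case by (simp add: distrib_left)
    qed
  qed measurable
  have I3: "integrable M (\<lambda>x. k x * norm (u x))"
    using integrable_norm[OF I2] by (rule integrable_cong_AE_imp) (use k(3) in auto)
  define m where "m = (LINT x|M. k x * norm (u x))"
  have m: "0 \<le> m" unfolding m_def using k(3) by (intro integral_nonneg_AE) (auto elim!: eventually_mono)
  have "norm (LINT x|M. k x *\<^sub>R u x) \<le> (LINT x|M. norm (k x *\<^sub>R u x))"
    by (rule integral_norm_bound)
  also have "\<dots> = m" unfolding m_def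
    by (intro integral_cong_AE) (use k(3) in auto)
  finally have "norm (LINT x|M. k x *\<^sub>R u x) powr p \<le> m powr p"
    using p by (intro powr_mono2) auto
  \<comment> \<open>The integral of the supporting line against \<open>k\<close>: \<open>k\<close>
    has integral 1 and \<open>k * |u|\<close> has integral \<open>m\<close>, so the linear part
    cancels.\<close>
  also have "m powr p = (LINT x|M. (m powr p - p * m powr (p - 1) * m) * k x + p * m powr (p - 1) * (k x * norm (u x)))"
    using k I3 by (simp add: m_def[symmetric])
  also have "\<dots> \<le> (LINT x|M. k x * norm (u x) powr p)"
  proof (rule integral_mono_AE)
    show "AE x in M. (m powr p - p * m powr (p - 1) * m) * k x + p * m powr (p - 1) * (k x * norm (u x)) \<le> k x * norm (u x) powr p"
      using k(3)
    proof eventually_elim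
      case (elim x)
      have "k x * (m powr p + p * m powr (p - 1) * (norm (u x) - m)) \<le> k x * norm (u x) powr p"
        using elim powr_ge_tangent[OF p norm_ge_zero m] by (intro mult_left_mono) auto
      then show ?case by (simp add: algebra_simps)
    qed
  qed (use k I I3 in auto)
  finally show "norm (LINT x|M. k x *\<^sub>R u x) powr p \<le> (LINT x|M. k x * norm (u x) powr p)" .
qed

section \<open>Poisson operators on the circle\<close>

interpretation circle2: pair_sigma_finite circle_measure circle_measure ..

text \<open>Convolution with the Poisson kernel. On functions holomorphic beyond the closed disc it
  is the dilation \<open>f (r * \<xi>)\<close>, see \<open>poisson_operator_holomorphic\<close>; in
  this way a dilation becomes a self-adjoint contraction acting on all integrable functions.\<close>

definition poisson_operator :: "real \<Rightarrow> (complex \<Rightarrow> 'b) \<Rightarrow> complex \<Rightarrow> 'b::{banach, second_countable_topology}" where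
  "poisson_operator r u \<xi> = (AVG z. poisson_kernel (of_real r * \<xi>) z *\<^sub>R u z)"

lemma borel_measurable_circle_integrable:
  "integrable circle_measure u \<Longrightarrow> u \<in> borel_measurable borel"
  using borel_measurable_integrable measurable_cong_sets[OF sets_circle_measure refl] by blast

lemma borel_measurable_poisson_operator:
  assumes "integrable circle_measure u"
  shows "poisson_operator r u \<in> borel_measurable borel"
proof -
  have [measurable]: "u \<in> borel_measurable borel" by (rule borel_measurable_circle_integrable[OF assms])
  show ?thesis unfolding poisson_operator_def by measurable
qed

lemma poisson_kernel_bounds:
  assumes "0 \<le> r" "r < 1" "norm \<xi> = 1" "norm z = 1"
  shows "0 \<le> poisson_kernel (of_real r * \<xi>) z"
    and "poisson_kernel (of_real r * \<xi>) z \<le> (1 + r) / (1 - r)"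
  using poisson_kernel_nonneg[of "of_real r * \<xi>" z] poisson_kernel_le[of "of_real r * \<xi>" z] assms
  by (auto simp: norm_mult)

lemma integrable_poisson_mult:
  fixes u :: "complex \<Rightarrow> 'b::{banach, second_countable_topology}"
  assumes u: "integrable circle_measure u" and r: "norm w < 1"
  shows "integrable circle_measure (\<lambda>z. poisson_kernel w z *\<^sub>R u z)"
proof -
  have [measurable]: "u \<in> borel_measurable borel" by (rule borel_measurable_circle_integrable[OF u])
  have I: "integrable circle_measure (\<lambda>z. ((1 + norm w) / (1 - norm w)) * norm (u z))" using u by auto
  have "norm (poisson_kernel w z *\<^sub>R u z) \<le> norm ((1 + norm w) / (1 - norm w) * norm (u z))"
    if "norm z = 1" for z
  proof -
    have "poisson_kernel w z * norm (u z) \<le> (1 + norm w) / (1 - norm w) * norm (u z)"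
      by (intro mult_right_mono poisson_kernel_le[OF r that]) auto
    also have "\<dots> \<le> \<bar>(1 + norm w) / (1 - norm w) * norm (u z)\<bar>" by (rule abs_ge_self)
    finally show ?thesis using poisson_kernel_nonneg[OF r, of z] by simp
  qed
  then show ?thesis
    by (intro Bochner_Integration.integrable_bound[OF I]) (use AE_circle_measure in \<open>auto elim!: eventually_mono\<close>)
qed

lemma poisson_operator_norm_le:
  assumes u: "integrable circle_measure u" and r: "0 \<le> r" "r < 1" "norm \<xi> = 1"
  shows "norm (poisson_operator r u \<xi>) \<le> (1 + r) / (1 - r) * (AVG z. norm (u z))"
proof -
  have n: "norm (of_real r * \<xi>) < 1" using r by (simp add: norm_mult)
  have I: "integrable circle_measure (\<lambda>z. poisson_kernel (of_real r * \<xi>) z *\<^sub>R u z)"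
    by (rule integrable_poisson_mult[OF u n])
  have "norm (poisson_operator r u \<xi>) \<le> (AVG z. norm (poisson_kernel (of_real r * \<xi>) z *\<^sub>R u z))"
    unfolding poisson_operator_def by (rule integral_norm_bound)
  also have "\<dots> \<le> (AVG z. (1 + r) / (1 - r) * norm (u z))"
  proof (rule integral_mono_AE)
    show "AE z in circle_measure. norm (poisson_kernel (of_real r * \<xi>) z *\<^sub>R u z) \<le> (1 + r) / (1 - r) * norm (u z)"
      using AE_circle_measure
    proof eventually_elim
      case (elim z)
      have "poisson_kernel (of_real r * \<xi>) z * norm (u z) \<le> (1 + r) / (1 - r) * norm (u z)"
        by (intro mult_right_mono poisson_kernel_bounds[OF r elim]) auto
      then show ?case using poisson_kernel_bounds(1)[OF r elim] by simp
    qed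
  qed (use I u in \<open>auto simp del: norm_scaleR\<close>)
  finally show ?thesis by simp
qed

lemma integrable_poisson_operator:
  assumes u: "integrable circle_measure u" and r: "0 \<le> r" "r < 1"
  shows "integrable circle_measure (poisson_operator r u)"
  using integrable_circle_bounded[OF borel_measurable_poisson_operator[OF u] poisson_operator_norm_le[OF u r]] .

lemma AE_circle_pair: "AE x in circle_measure \<Otimes>\<^sub>M circle_measure. norm (fst x) = 1 \<and> norm (snd x) = 1"
proof (rule circle2.AE_pair_measure)
  show "{x \<in> space (circle_measure \<Otimes>\<^sub>M circle_measure). norm (fst x) = 1 \<and> norm (snd x) = 1} \<in> sets (circle_measure \<Otimes>\<^sub>M circle_measure)"
    by measurable
  show "AE x in circle_measure. AE y in circle_measure. norm (fst (x, y)) = 1 \<and> norm (snd (x, y)) = 1"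
    using AE_circle_measure by (auto elim!: eventually_mono)
qed

lemma integrable_circle_pair_bounded:
  fixes u v :: "complex \<Rightarrow> 'b::{banach, second_countable_topology, real_normed_algebra}"
  assumes u: "integrable circle_measure u" and v: "integrable circle_measure v"
    and [measurable]: "case_prod k \<in> borel_measurable (circle_measure \<Otimes>\<^sub>M circle_measure)"
    and k: "\<And>x y. norm x = 1 \<Longrightarrow> norm y = 1 \<Longrightarrow> \<bar>k x y\<bar> \<le> (B::real)"
  shows "integrable (circle_measure \<Otimes>\<^sub>M circle_measure) (\<lambda>(x, y). k x y *\<^sub>R (u x * v y))"
proof -
  have [measurable]: "u \<in> borel_measurable borel" "v \<in> borel_measurable borel"
    using u v by (auto intro: borel_measurable_circle_integrable)
  have "integrable (circle_measure \<Otimes>\<^sub>M circle_measure) (\<lambda>x. norm (u (fst x)) * norm (v (snd x)))"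
  proof (rule circle2.Fubini_integrable)
    show "integrable circle_measure (\<lambda>x. AVG y. norm (norm (u (fst (x, y))) * norm (v (snd (x, y)))))"
      using u by (simp add: abs_mult)
  qed (use v in auto)
  then have I: "integrable (circle_measure \<Otimes>\<^sub>M circle_measure) (\<lambda>x. B * (norm (u (fst x)) * norm (v (snd x))))"
    by (intro integrable_mult_right)
  show ?thesis
  proof (rule Bochner_Integration.integrable_bound[OF I])
    show "AE x in circle_measure \<Otimes>\<^sub>M circle_measure. norm (case x of (x, y) \<Rightarrow> k x y *\<^sub>R (u x * v y))
            \<le> norm (B * (norm (u (fst x)) * norm (v (snd x))))"
      using AE_circle_pair
    proof eventually_elim
      case (elim x)
      have "\<bar>k (fst x) (snd x)\<bar> * norm (u (fst x) * v (snd x)) \<le> \<bar>B\<bar> * (norm (u (fst x)) * norm (v (snd x)))"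
        using k[of "fst x" "snd x"] elim by (intro mult_mono norm_mult_ineq) auto
      then show ?case by (simp add: case_prod_beta abs_mult)
    qed
  qed (simp add: case_prod_beta')
qed

lemma integrable_poisson_pair:
  fixes u v :: "complex \<Rightarrow> 'b::{banach, second_countable_topology, real_normed_algebra}"
  assumes u: "integrable circle_measure u" and v: "integrable circle_measure v" and r: "0 \<le> r" "r < 1"
  shows "integrable (circle_measure \<Otimes>\<^sub>M circle_measure) (\<lambda>(x, y). poisson_kernel (of_real r * x) y *\<^sub>R (u x * v y))"
  by (rule integrable_circle_pair_bounded[OF u v, where B = "(1 + r) / (1 - r)"])
     (use poisson_kernel_bounds[OF r] in auto)

text \<open>Fubini's theorem and the symmetry \<open>poisson_kernel_commute\<close>. The pairing is
  bilinear, without conjugation, so that one statement serves real and complex functions.\<close>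

lemma poisson_operator_selfadjoint:
  fixes u v :: "complex \<Rightarrow> 'b::{banach, second_countable_topology, real_normed_algebra}"
  assumes u: "integrable circle_measure u" and v: "integrable circle_measure v" and r: "0 \<le> r" "r < 1"
  shows "(AVG x. u x * poisson_operator r v x) = (AVG y. poisson_operator r u y * v y)"
proof -
  have [measurable]: "u \<in> borel_measurable borel" "v \<in> borel_measurable borel"
      "poisson_operator r u \<in> borel_measurable borel" "poisson_operator r v \<in> borel_measurable borel"
    using u v by (auto intro: borel_measurable_circle_integrable borel_measurable_poisson_operator)
  have n: "norm (of_real r * x) < 1" if "norm x = 1" for x :: complex using r that by (simp add: norm_mult)
  have "(AVG x. u x * poisson_operator r v x) =
      (AVG x. AVG y. poisson_kernel (of_real r * x) y *\<^sub>R (u x * v y))"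
  proof (rule circle_integral_cong)
    fix x :: complex assume x: "norm x = 1"
    show "u x * poisson_operator r v x = (AVG y. poisson_kernel (of_real r * x) y *\<^sub>R (u x * v y))"
      unfolding poisson_operator_def mult_scaleR_right[symmetric]
      by (intro Bochner_Integration.integral_mult_right[symmetric] integrable_poisson_mult[OF v] n x)
  qed measurable
  also have "\<dots> = (AVG y. AVG x. poisson_kernel (of_real r * x) y *\<^sub>R (u x * v y))"
    using integrable_poisson_pair[OF u v r] by (intro circle2.Fubini_integral[symmetric]) (simp add: case_prod_beta')
  also have "\<dots> = (AVG y. poisson_operator r u y * v y)"
  proof (rule circle_integral_cong)
    fix y :: complex assume y: "norm y = 1"
    have "(AVG x. poisson_kernel (of_real r * x) y *\<^sub>R (u x * v y)) =
       (AVG x. poisson_kernel (of_real r * y) x *\<^sub>R u x * v y)"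
      by (rule circle_integral_cong) (use poisson_kernel_commute y in auto)
    also have "\<dots> = poisson_operator r u y * v y"
      unfolding poisson_operator_def
      by (intro Bochner_Integration.integral_mult_left integrable_poisson_mult[OF u] n y)
    finally show "(AVG x. poisson_kernel (of_real r * x) y *\<^sub>R (u x * v y)) = poisson_operator r u y * v y" .
  qed measurable
  finally show ?thesis .
qed

lemma poisson_operator_one:
  "0 \<le> r \<Longrightarrow> r < 1 \<Longrightarrow> norm \<xi> = 1 \<Longrightarrow> poisson_operator r (\<lambda>_. 1::real) \<xi> = 1"
  unfolding poisson_operator_def using integral_poisson_kernel[of "of_real r * \<xi>"] by (simp add: norm_mult)

lemma integral_poisson_operator:
  fixes u :: "complex \<Rightarrow> real"
  assumes u: "integrable circle_measure u" and r: "0 \<le> r" "r < 1"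
  shows "(AVG x. poisson_operator r u x) = (AVG x. u x)"
proof -
  have [measurable]: "u \<in> borel_measurable borel" "poisson_operator r (\<lambda>_. 1::real) \<in> borel_measurable borel"
    using u by (auto intro: borel_measurable_circle_integrable borel_measurable_poisson_operator)
  have "(AVG x. u x * poisson_operator r (\<lambda>_. 1) x) = (AVG y. poisson_operator r u y * 1)"
    by (rule poisson_operator_selfadjoint) (use u r in auto)
  moreover have "(AVG x. u x * poisson_operator r (\<lambda>_. 1) x) = (AVG x. u x)"
    by (rule circle_integral_cong) (use poisson_operator_one r in auto)
  ultimately show ?thesis by simp
qed

text \<open>Fubini's theorem brings the two kernels together, and
  \<open>poisson_kernel_subordination\<close> for the identity map composes them.\<close>

lemma poisson_operator_semigroup:
  fixes u :: "complex \<Rightarrow> 'b::{banach, second_countable_topology}"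
  assumes u: "integrable circle_measure u" and r: "0 \<le> r" "r < 1" and s: "0 \<le> s" "s < 1" and \<xi>: "norm \<xi> = 1"
  shows "poisson_operator r (poisson_operator s u) \<xi> = poisson_operator (r * s) u \<xi>"
proof -
  have [measurable]: "u \<in> borel_measurable borel" "poisson_operator s u \<in> borel_measurable borel"
    using u by (auto intro: borel_measurable_circle_integrable borel_measurable_poisson_operator)
  have n: "norm (of_real r * \<xi>) < 1" using r \<xi> by (simp add: norm_mult)
  have ns: "norm (of_real s * x) < 1" if "norm x = 1" for x :: complex using s that by (simp add: norm_mult)
  let ?C = "(1 + r) / (1 - r) * ((1 + s) / (1 - s))"
  have I: "integrable (circle_measure \<Otimes>\<^sub>M circle_measure)
     (\<lambda>p. (poisson_kernel (of_real r * \<xi>) (fst p) * poisson_kernel (of_real s * fst p) (snd p)) *\<^sub>R u (snd p))"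
  proof (rule Bochner_Integration.integrable_bound)
    have "integrable (circle_measure \<Otimes>\<^sub>M circle_measure) (\<lambda>(x, y). ?C *\<^sub>R ((1::real) * norm (u y)))"
      by (rule integrable_circle_pair_bounded[where B = "\<bar>?C\<bar>"]) (use u in auto)
    then show "integrable (circle_measure \<Otimes>\<^sub>M circle_measure) (\<lambda>p. ?C * norm (u (snd p)))"
      by (simp add: case_prod_beta')
    show "AE p in circle_measure \<Otimes>\<^sub>M circle_measure.
      norm ((poisson_kernel (of_real r * \<xi>) (fst p) * poisson_kernel (of_real s * fst p) (snd p)) *\<^sub>R u (snd p))
       \<le> norm (?C * norm (u (snd p)))"
      using AE_circle_pair
    proof eventually_elim
      case (elim p)
      have "poisson_kernel (of_real r * \<xi>) (fst p) * poisson_kernel (of_real s * fst p) (snd p) \<le> ?C"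
        using poisson_kernel_bounds[OF r \<xi>] poisson_kernel_bounds[OF s] elim r by (intro mult_mono) auto
      moreover have "0 \<le> poisson_kernel (of_real r * \<xi>) (fst p) * poisson_kernel (of_real s * fst p) (snd p)"
        using poisson_kernel_bounds[OF r \<xi>] poisson_kernel_bounds[OF s] elim by (intro mult_nonneg_nonneg) auto
      ultimately have "\<bar>poisson_kernel (of_real r * \<xi>) (fst p) * poisson_kernel (of_real s * fst p) (snd p)\<bar> \<le> \<bar>?C\<bar>"
        by linarith
      then show ?case
        unfolding norm_scaleR real_norm_def abs_mult[of ?C] abs_norm_cancel by (rule mult_right_mono) simp
    qed
  qed measurable
  have "poisson_operator r (poisson_operator s u) \<xi> =
      (AVG x. AVG y. (poisson_kernel (of_real r * \<xi>) x * poisson_kernel (of_real s * x) y) *\<^sub>R u y)"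
    unfolding poisson_operator_def[of r]
  proof (rule circle_integral_cong)
    fix x :: complex assume x: "norm x = 1"
    show "poisson_kernel (of_real r * \<xi>) x *\<^sub>R poisson_operator s u x =
       (AVG y. (poisson_kernel (of_real r * \<xi>) x * poisson_kernel (of_real s * x) y) *\<^sub>R u y)"
      unfolding poisson_operator_def by (simp flip: integral_scaleR_right)
  qed measurable
  also have "\<dots> = (AVG y. AVG x. (poisson_kernel (of_real r * \<xi>) x * poisson_kernel (of_real s * x) y) *\<^sub>R u y)"
    using I by (intro circle2.Fubini_integral[symmetric]) (simp add: case_prod_beta')
  also have "\<dots> = (AVG y. poisson_kernel (of_real (r * s) * \<xi>) y *\<^sub>R u y)"
  proof (rule circle_integral_cong)
    fix y :: complex assume y: "norm y = 1"
    note S = poisson_kernel_subordination[of "\<lambda>z. z", OF _ _ _ s n y]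
    have "(AVG x. (poisson_kernel (of_real r * \<xi>) x * poisson_kernel (of_real s * x) y) *\<^sub>R u y) =
      (AVG x. poisson_kernel (of_real r * \<xi>) x * poisson_kernel (of_real s * x) y) *\<^sub>R u y"
      using S(1) by (intro integral_scaleR_left) auto
    also have "(AVG x. poisson_kernel (of_real r * \<xi>) x * poisson_kernel (of_real s * x) y) = poisson_kernel (of_real (r * s) * \<xi>) y"
      using S(2) by (simp add: mult_ac)
    finally show "(AVG x. (poisson_kernel (of_real r * \<xi>) x * poisson_kernel (of_real s * x) y) *\<^sub>R u y) =
       poisson_kernel (of_real (r * s) * \<xi>) y *\<^sub>R u y" .
  qed measurable
  finally show ?thesis unfolding poisson_operator_def .
qed

lemma poisson_operator_powr_le:
  fixes u :: "complex \<Rightarrow> 'b::{banach, second_countable_topology}"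
  assumes p: "1 \<le> p" and u [measurable]: "u \<in> borel_measurable borel" and I: "integrable circle_measure (\<lambda>z. norm (u z) powr p)"
    and r: "0 \<le> r" "r < 1" and \<xi>: "norm \<xi> = 1"
  shows "norm (poisson_operator r u \<xi>) powr p \<le> poisson_operator r (\<lambda>z. norm (u z) powr p) \<xi>"
proof -
  have n: "norm (of_real r * \<xi>) < 1" using r \<xi> by (simp add: norm_mult)
  show ?thesis unfolding poisson_operator_def real_scaleR_def
    using integral_poisson_kernel[OF n] poisson_kernel_nonneg[OF n] integrable_poisson_mult[OF I n]
    by (intro Jensen_powr_kernel(2)[OF p]) auto
qed

lemma integrable_powr_imp_integrable:
  fixes u :: "complex \<Rightarrow> 'b::{banach, second_countable_topology}"
  assumes "1 \<le> p" "u \<in> borel_measurable borel" "integrable circle_measure (\<lambda>z. norm (u z) powr p)"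
  shows "integrable circle_measure u"
  using Jensen_powr_kernel(1)[of p u circle_measure "\<lambda>_. 1"] assms circle.prob_space by simp

lemma poisson_operator_contraction:
  fixes u :: "complex \<Rightarrow> 'b::{banach, second_countable_topology}"
  assumes p: "1 \<le> p" and u [measurable]: "u \<in> borel_measurable borel" and I: "integrable circle_measure (\<lambda>z. norm (u z) powr p)"
    and r: "0 \<le> r" "r < 1"
  shows "integrable circle_measure (\<lambda>z. norm (poisson_operator r u z) powr p)"
    and "(AVG z. norm (poisson_operator r u z) powr p) \<le> (AVG z. norm (u z) powr p)"
proof -
  have iu: "integrable circle_measure u" by (rule integrable_powr_imp_integrable[OF p u I])
  have [measurable]: "poisson_operator r u \<in> borel_measurable borel"
    by (rule borel_measurable_poisson_operator[OF iu])
  have I2: "integrable circle_measure (poisson_operator r (\<lambda>z. norm (u z) powr p))"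
    by (rule integrable_poisson_operator[OF I r])
  note le = poisson_operator_powr_le[OF p u I r]
  show I3: "integrable circle_measure (\<lambda>z. norm (poisson_operator r u z) powr p)"
    by (rule Bochner_Integration.integrable_bound[OF I2])
       (use AE_circle_measure le in \<open>auto elim!: eventually_mono intro: order_trans[OF le abs_ge_self]\<close>)
  have "(AVG z. norm (poisson_operator r u z) powr p) \<le> (AVG z. poisson_operator r (\<lambda>z. norm (u z) powr p) z)"
    by (rule integral_mono_AE[OF I3 I2]) (use AE_circle_measure le in \<open>auto elim!: eventually_mono\<close>)
  also have "\<dots> = (AVG z. norm (u z) powr p)"
    by (rule integral_poisson_operator[OF I r])
  finally show "(AVG z. norm (poisson_operator r u z) powr p) \<le> (AVG z. norm (u z) powr p)" .
qed

lemma poisson_operator_holomorphic: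
  assumes "f \<in> borel_measurable borel" "f holomorphic_on ball 0 R" "1 < R" "0 \<le> r" "r < 1" "norm \<xi> = 1"
  shows "poisson_operator r f \<xi> = f (of_real r * \<xi>)"
  unfolding poisson_operator_def using assms by (intro poisson_formula(2)[of f R]) (auto simp: norm_mult)

section \<open>Maximal inequality and radial limits\<close>

lemma poisson_operator_mono:
  fixes u v :: "complex \<Rightarrow> real"
  assumes u: "integrable circle_measure u" and v: "integrable circle_measure v"
    and r: "0 \<le> r" "r < 1" "norm \<xi> = 1" and le: "\<And>z. norm z = 1 \<Longrightarrow> u z \<le> v z"
  shows "poisson_operator r u \<xi> \<le> poisson_operator r v \<xi>"
proof -
  have n: "norm (of_real r * \<xi>) < 1" using r by (simp add: norm_mult)
  have "AE z in circle_measure. poisson_kernel (of_real r * \<xi>) z * u z \<le> poisson_kernel (of_real r * \<xi>) z * v z"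
    using AE_circle_measure by eventually_elim (intro mult_left_mono le poisson_kernel_bounds(1)[OF r]; simp)
  then show ?thesis unfolding poisson_operator_def
    using integrable_poisson_mult[OF u n] integrable_poisson_mult[OF v n]
    by (intro integral_mono_AE) auto
qed

lemma poisson_operator_add:
  fixes u v :: "complex \<Rightarrow> 'b::{banach, second_countable_topology}"
  assumes u: "integrable circle_measure u" and v: "integrable circle_measure v"
    and r: "0 \<le> r" "r < 1" "norm \<xi> = 1"
  shows "poisson_operator r (\<lambda>z. u z + v z) \<xi> = poisson_operator r u \<xi> + poisson_operator r v \<xi>"
proof -
  have n: "norm (of_real r * \<xi>) < 1" using r by (simp add: norm_mult)
  show ?thesis unfolding poisson_operator_def
    using integrable_poisson_mult[OF u n] integrable_poisson_mult[OF v n] by (simp add: scaleR_add_right)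
qed

lemma poisson_operator_sum:
  fixes u :: "'i \<Rightarrow> complex \<Rightarrow> 'b::{banach, second_countable_topology}"
  assumes u: "\<And>i. i \<in> I \<Longrightarrow> integrable circle_measure (u i)"
    and r: "0 \<le> r" "r < 1" "norm \<xi> = 1"
  shows "poisson_operator r (\<lambda>z. \<Sum>i\<in>I. u i z) \<xi> = (\<Sum>i\<in>I. poisson_operator r (u i) \<xi>)"
proof -
  have n: "norm (of_real r * \<xi>) < 1" using r by (simp add: norm_mult)
  show ?thesis unfolding poisson_operator_def scaleR_sum_right
    using integrable_poisson_mult[OF u n] by (intro Bochner_Integration.integral_sum) auto
qed

text \<open>Garsia's argument: the maximal function \<open>M\<close> of the partial sums satisfies \<open>M \<le> f + P\<^bsub>r\<^esub> M\<close> where it is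
  positive, and \<open>P\<^bsub>r\<^esub>\<close> preserves integrals.\<close>

lemma maximal_ergodic_inequality:
  fixes u :: "complex \<Rightarrow> real"
  assumes u: "integrable circle_measure u" "\<And>z. 0 \<le> u z" and r: "0 \<le> r" "r < 1" and lam: "0 < \<alpha>"
  defines "U \<equiv> \<lambda>j. if j = 0 then u else poisson_operator (r ^ j) u"
  shows "\<alpha> * measure circle_measure {\<xi>. norm \<xi> = 1 \<and> (\<exists>n\<in>{1..N}. \<alpha> * real n < (\<Sum>j<n. U j \<xi>))} \<le> (AVG z. u z)"
proof -
  \<comment> \<open>In \<open>U\<close> the index 0 is separate because
    \<open>poisson_operator (r ^ 0)\<close> is 0 on the circle instead of the identity: the
    numerator \<open>1 - |w|^2\<close> of the kernel vanishes there.\<close>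
  define S where "S = (\<lambda>n \<xi>. \<Sum>j<n. (U j \<xi> - \<alpha>))"
  define f where "f = (\<lambda>\<xi>. u \<xi> - \<alpha>)"
  \<comment> \<open>The maximum includes the empty sum \<open>n = 0\<close>, hence \<open>M\<close>
    is nonnegative, and where it is positive it is attained at some
    \<open>n = Suc m\<close>.\<close>
  define M where "M = (\<lambda>\<xi>. Max ((\<lambda>n. S n \<xi>) ` {..N}))"
  define A where "A = {\<xi>. norm \<xi> = 1 \<and> (\<exists>n\<in>{1..N}. \<alpha> * real n < (\<Sum>j<n. U j \<xi>))}"
  have rj: "0 \<le> r ^ j" "0 < j \<Longrightarrow> r ^ j < 1" for j using r by (auto simp: power_less_one_iff)
  have U: "integrable circle_measure (U j)" for j
    unfolding U_def using integrable_poisson_operator[OF u(1) rj, of j] u by auto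
  have Um: "(\<lambda>\<xi>. U j \<xi>) \<in> borel_measurable borel" for j
    using borel_measurable_circle_integrable[OF U, of j] by simp
  note [measurable] = Um
  have S: "integrable circle_measure (S n)" for n unfolding S_def using U by auto
  have Sm [measurable]: "(\<lambda>\<xi>. S n \<xi>) \<in> borel_measurable borel" for n
    unfolding S_def by measurable
  have f: "integrable circle_measure f" unfolding f_def using u by auto
  have Mm [measurable]: "M \<in> borel_measurable borel" unfolding M_def by measurable
  have SM: "S n \<xi> \<le> M \<xi>" if "n \<le> N" for n \<xi>
    unfolding M_def using that by (intro Max_ge) auto
  have M0: "0 \<le> M \<xi>" for \<xi> using SM[of 0] by (simp add: S_def)
  have Mcases: "\<exists>n\<le>N. M \<xi> = S n \<xi>" for \<xi>
  proof -
    have "M \<xi> \<in> (\<lambda>n. S n \<xi>) ` {..N}" unfolding M_def by (intro Max_in) auto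
    then show ?thesis by auto
  qed
  have MI: "integrable circle_measure M"
  proof (rule Bochner_Integration.integrable_bound)
    show "integrable circle_measure (\<lambda>\<xi>. \<Sum>n\<le>N. \<bar>S n \<xi>\<bar>)" using S by auto
    have "norm (M \<xi>) \<le> norm (\<Sum>n\<le>N. \<bar>S n \<xi>\<bar>)" for \<xi>
    proof -
      obtain n where n: "n \<le> N" "M \<xi> = S n \<xi>" using Mcases by blast
      have "\<bar>S n \<xi>\<bar> \<le> (\<Sum>n\<le>N. \<bar>S n \<xi>\<bar>)" by (rule member_le_sum) (use n in auto)
      then show ?thesis using n by simp
    qed
    then show "AE \<xi> in circle_measure. norm (M \<xi>) \<le> norm (\<Sum>n\<le>N. \<bar>S n \<xi>\<bar>)" by simp
  qed simp
  have TM: "integrable circle_measure (poisson_operator r M)" by (rule integrable_poisson_operator[OF MI r])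
  have TM0: "0 \<le> poisson_operator r M \<xi>" if "norm \<xi> = 1" for \<xi>
    using poisson_operator_mono[of "\<lambda>_. 0" M r \<xi>] MI M0 r that by (simp add: poisson_operator_def)
  have TU: "poisson_operator r (U j) \<xi> = U (Suc j) \<xi>" if "norm \<xi> = 1" for j \<xi>
    unfolding U_def using poisson_operator_semigroup[OF u(1) r rj, of j \<xi>] that by auto
  have TS: "S (Suc n) \<xi> = f \<xi> + poisson_operator r (S n) \<xi>" if \<xi>: "norm \<xi> = 1" for n \<xi>
  proof -
    have "poisson_operator r (S n) \<xi> = (\<Sum>j<n. poisson_operator r (\<lambda>z. U j z - \<alpha>) \<xi>)"
      unfolding S_def by (rule poisson_operator_sum) (use U r \<xi> in auto)
    also have "\<dots> = (\<Sum>j<n. U (Suc j) \<xi> - \<alpha>)"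
    proof (rule sum.cong[OF refl])
      fix j
      have "poisson_operator r (\<lambda>z. U j z + - \<alpha>) \<xi> = poisson_operator r (U j) \<xi> + poisson_operator r (\<lambda>_. - \<alpha>) \<xi>"
        by (rule poisson_operator_add) (use U r \<xi> in auto)
      also have "poisson_operator r (\<lambda>_. - \<alpha>) \<xi> = - \<alpha>"
        using poisson_operator_one[OF r \<xi>] by (simp add: poisson_operator_def)
      finally show "poisson_operator r (\<lambda>z. U j z - \<alpha>) \<xi> = U (Suc j) \<xi> - \<alpha>" using TU[OF \<xi>] by simp
    qed
    finally show ?thesis unfolding S_def sum.lessThan_Suc_shift by (simp add: f_def U_def)
  qed
  have key: "M \<xi> \<le> f \<xi> + poisson_operator r M \<xi>" if \<xi>: "norm \<xi> = 1" and pos: "0 < M \<xi>" for \<xi>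
  proof -
    obtain n where n: "n \<le> N" "M \<xi> = S n \<xi>" using Mcases by blast
    with pos obtain m where m: "n = Suc m" by (cases n) (auto simp: S_def)
    have "poisson_operator r (S m) \<xi> \<le> poisson_operator r M \<xi>"
      by (rule poisson_operator_mono[OF S MI r \<xi>]) (use SM n m in auto)
    then show ?thesis using TS[OF \<xi>, of m] n m by simp
  qed
  have A_iff: "\<xi> \<in> A \<longleftrightarrow> norm \<xi> = 1 \<and> 0 < M \<xi>" for \<xi>
  proof -
    have "0 < S n \<xi> \<longleftrightarrow> \<alpha> * real n < (\<Sum>j<n. U j \<xi>)" for n
      unfolding S_def by (simp add: sum_subtractf mult.commute)
    moreover have "0 < M \<xi> \<longleftrightarrow> (\<exists>n\<in>{1..N}. 0 < S n \<xi>)"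
    proof
      assume pos: "0 < M \<xi>"
      obtain n where n: "n \<le> N" "M \<xi> = S n \<xi>" using Mcases by blast
      have "n \<noteq> 0"
      proof
        assume "n = 0"
        then show False using n pos by (simp add: S_def)
      qed
      with n pos show "\<exists>n\<in>{1..N}. 0 < S n \<xi>" by auto
    qed (use SM in \<open>fastforce intro: less_le_trans\<close>)
    ultimately show ?thesis unfolding A_def by auto
  qed
  have Aset [measurable]: "A \<in> sets borel"
  proof -
    have "A = {\<xi>. norm \<xi> = 1 \<and> 0 < M \<xi>}" using A_iff by auto
    then show ?thesis by simp
  qed
  have "0 = (AVG \<xi>. M \<xi>) - (AVG \<xi>. poisson_operator r M \<xi>)"
    using integral_poisson_operator[OF MI r] by simp
  also have "\<dots> = (AVG \<xi>. M \<xi> - poisson_operator r M \<xi>)"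
    using MI TM by simp
  \<comment> \<open>On \<open>A\<close> this is \<open>key\<close>. Off \<open>A\<close> the
    function \<open>M\<close> vanishes, while its Poisson mean is nonnegative, so the left side is
    at most 0.\<close>
  also have "\<dots> \<le> (AVG \<xi>. indicator A \<xi> * f \<xi>)"
  proof (rule integral_mono_AE)
    show "integrable circle_measure (\<lambda>\<xi>. indicator A \<xi> * f \<xi>)"
      using integrable_mult_indicator[of A circle_measure f] f by simp
    show "AE \<xi> in circle_measure. M \<xi> - poisson_operator r M \<xi> \<le> indicator A \<xi> * f \<xi>"
      using AE_circle_measure
    proof eventually_elim
      case (elim \<xi>)
      show ?case
      proof (cases "0 < M \<xi>")
        case True
        then show ?thesis using key[OF elim True] A_iff elim by simp
      next
        case False
        then show ?thesis using M0[of \<xi>] TM0[OF elim] A_iff by simp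
      qed
    qed
  qed (use MI TM in auto)
  also have "\<dots> = (AVG \<xi>. indicator A \<xi> * u \<xi> - \<alpha> * indicator A \<xi>)"
    by (intro Bochner_Integration.integral_cong) (auto simp: f_def algebra_simps)
  also have "\<dots> = (AVG \<xi>. indicator A \<xi> * u \<xi>) - \<alpha> * measure circle_measure A"
    using integrable_mult_indicator[of A circle_measure u] u
    by (subst Bochner_Integration.integral_diff) (auto simp: circle.emeasure_eq_measure)
  also have "(AVG \<xi>. indicator A \<xi> * u \<xi>) \<le> (AVG \<xi>. u \<xi>)"
    using integrable_mult_indicator[of A circle_measure u] u
    by (intro integral_mono) (auto split: split_indicator)
  finally show ?thesis unfolding A_def by simp
qed

text \<open>The 8 is a factor 2 for the numerators times \<open>2^2\<close> for the squared
  distances. Indeed \<open>1 - \<rho>^2 \<le> 2 * (1 - \<rho>) \<le> 2 * (1 - r^2)\<close>, and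
  moving from \<open>\<rho> * \<xi>\<close> to \<open>r * \<xi>\<close> adds at most
  \<open>r - \<rho> \<le> 1 - \<rho>\<close> to the distance from \<open>z\<close>, which was at
  least \<open>1 - \<rho>\<close>.\<close>

lemma poisson_kernel_Harnack:
  assumes "norm \<xi> = 1" "norm z = 1" "0 \<le> \<rho>" "\<rho> \<le> r" "r\<^sup>2 \<le> \<rho>" "r < 1"
  shows "poisson_kernel (of_real \<rho> * \<xi>) z \<le> 8 * poisson_kernel (of_real r * \<xi>) z"
proof -
  have r0: "0 \<le> r" "\<rho> < 1" using assms by auto
  have "1 - \<rho> \<le> norm (z - of_real \<rho> * \<xi>)"
    using norm_triangle_ineq2[of z "of_real \<rho> * \<xi>"] assms by (simp add: norm_mult)
  moreover have "norm (z - of_real r * \<xi>) \<le> norm (z - of_real \<rho> * \<xi>) + (r - \<rho>)"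
  proof -
    have "z - of_real r * \<xi> = (z - of_real \<rho> * \<xi>) - of_real (r - \<rho>) * \<xi>" by (simp add: algebra_simps)
    then have "norm (z - of_real r * \<xi>) \<le> norm (z - of_real \<rho> * \<xi>) + norm (of_real (r - \<rho>) * \<xi>)"
      by (metis norm_triangle_ineq4)
    then show ?thesis using assms by (simp add: norm_mult del: of_real_diff)
  qed
  ultimately have d: "norm (z - of_real r * \<xi>) \<le> 2 * norm (z - of_real \<rho> * \<xi>)"
    using assms by linarith
  have "1 - r \<le> norm (z - of_real r * \<xi>)"
    using norm_triangle_ineq2[of z "of_real r * \<xi>"] assms r0 by (simp add: norm_mult)
  then have pos: "0 < norm (z - of_real r * \<xi>)" using assms by linarith
  then have pos2: "0 < norm (z - of_real \<rho> * \<xi>)" using d by linarith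
  have n: "1 - \<rho>\<^sup>2 \<le> 2 * (1 - r\<^sup>2)"
  proof -
    have "1 - \<rho>\<^sup>2 = (1 + \<rho>) * (1 - \<rho>)" by (simp add: power2_eq_square algebra_simps)
    also have "\<dots> \<le> 2 * (1 - r\<^sup>2)" using assms r0 by (intro mult_mono) auto
    finally show ?thesis .
  qed
  have "(norm (z - of_real r * \<xi>))\<^sup>2 \<le> (2 * norm (z - of_real \<rho> * \<xi>))\<^sup>2"
    using d by (intro power_mono) auto
  then have "(1 - \<rho>\<^sup>2) * (norm (z - of_real r * \<xi>))\<^sup>2 \<le> (2 * (1 - r\<^sup>2)) * (2 * norm (z - of_real \<rho> * \<xi>))\<^sup>2"
    using n assms r0 by (intro mult_mono) (auto simp: abs_square_le_1)
  then have "(1 - \<rho>\<^sup>2) * (norm (z - of_real r * \<xi>))\<^sup>2 \<le> 8 * (1 - r\<^sup>2) * (norm (z - of_real \<rho> * \<xi>))\<^sup>2"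
    by (simp add: power_mult_distrib algebra_simps)
  moreover have frac: "A / x \<le> 8 * (B / y)" if "0 < x" "0 < y" "A * y \<le> 8 * B * x" for A B x y :: real
    using that by (simp add: field_simps)
  ultimately have "(1 - \<rho>\<^sup>2) / (norm (z - of_real \<rho> * \<xi>))\<^sup>2 \<le> 8 * ((1 - r\<^sup>2) / (norm (z - of_real r * \<xi>))\<^sup>2)"
    using pos pos2 by (intro frac) auto
  then show ?thesis unfolding poisson_kernel_def using assms by (simp add: norm_mult)
qed

text \<open>By Harnack's inequality \<open>P\<^bsub>r^2K\<^esub> |h| \<le> 8 P\<^bsub>r^j\<^esub> |h|\<close> for \<open>K \<le> j < 2K\<close>, so the radial maximal function is
  bounded by ergodic averages.\<close>

lemma weak_type_discrete:
  fixes N :: nat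
  assumes h [measurable]: "h \<in> borel_measurable borel" and hol: "h holomorphic_on ball 0 R" "1 < R"
    and r: "0 \<le> r" "r < 1" and lam: "0 < \<alpha>"
  defines "C \<equiv> {\<xi>. norm \<xi> = 1 \<and> (\<exists>K\<in>{1..N}. \<alpha> < norm (h (of_real (r ^ (2 * K)) * \<xi>)))}"
  shows "C \<in> sets borel"
    and "measure circle_measure C \<le> 16 * (AVG z. norm (h z)) / \<alpha>"
proof -
  define u where "u = (\<lambda>z. norm (h z))"
  have hI: "integrable circle_measure h"
    by (rule integrable_circle_continuous[OF h holomorphic_continuous_on_sphere[OF hol]])
  have u: "integrable circle_measure u" "\<And>z. 0 \<le> u z" unfolding u_def using hI by auto
  have [measurable]: "u \<in> borel_measurable borel" by (simp add: u_def)
  define U where "U = (\<lambda>j. if j = 0 then u else poisson_operator (r ^ j) u)"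
  show Cm [measurable]: "C \<in> sets borel"
  proof -
    have "C = (\<Union>K\<in>{1..N}. {\<xi>. norm \<xi> = 1 \<and> \<alpha> < norm (h (of_real (r ^ (2 * K)) * \<xi>))})"
      unfolding C_def by auto
    then show ?thesis by simp
  qed
  \<comment> \<open>Adding \<open>\<alpha> < 8 * U j \<xi>\<close> over the \<open>K\<close> indices
    of the window gives \<open>K * \<alpha> < 8 * (\<Sum>j<2*K. U j \<xi>)\<close>; as an average
    over \<open>2 * K\<close> terms this exceeds \<open>\<alpha> / 16\<close>.\<close>
  let ?A = "{\<xi>. norm \<xi> = 1 \<and> (\<exists>n\<in>{1..2*N}. (\<alpha> / 16) * real n < (\<Sum>j<n. U j \<xi>))}"
  have Um [measurable]: "(\<lambda>\<xi>. U j \<xi>) \<in> borel_measurable borel" for j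
  proof (cases "j = 0")
    case False
    then show ?thesis using borel_measurable_poisson_operator[OF u(1), of "r ^ j"] by (simp add: U_def)
  qed (simp add: U_def)
  have Am: "?A \<in> sets borel"
  proof -
    have "?A = (\<Union>n\<in>{1..2*N}. {\<xi>. norm \<xi> = 1 \<and> (\<alpha> / 16) * real n < (\<Sum>j<n. U j \<xi>)})" by auto
    then show ?thesis by simp
  qed
  have "C \<subseteq> ?A"
  proof
    fix \<xi> assume "\<xi> \<in> C"
    then obtain K where K: "1 \<le> K" "K \<le> N" "\<alpha> < norm (h (of_real (r ^ (2 * K)) * \<xi>))" and \<xi>: "norm \<xi> = 1"
      unfolding C_def by auto
    have r2K: "0 \<le> r ^ (2 * K)" "r ^ (2 * K) < 1" using r K by (auto simp: power_less_one_iff)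
    have "norm (h (of_real (r ^ (2 * K)) * \<xi>)) = norm (poisson_operator (r ^ (2 * K)) h \<xi>)"
      using poisson_operator_holomorphic[OF h hol r2K \<xi>] by simp
    also have "\<dots> \<le> poisson_operator (r ^ (2 * K)) u \<xi>"
      using poisson_operator_powr_le[of 1 h, OF _ _ _ r2K \<xi>] hI unfolding u_def by simp
    finally have 1: "norm (h (of_real (r ^ (2 * K)) * \<xi>)) \<le> poisson_operator (r ^ (2 * K)) u \<xi>" .
    have 2: "poisson_operator (r ^ (2 * K)) u \<xi> \<le> 8 * U j \<xi>" if j: "j \<in> {K..<2*K}" for j
    proof -
      have j0: "0 < j" using j K by auto
      have rj: "0 \<le> r ^ j" "r ^ j < 1" using r j0 by (auto simp: power_less_one_iff)
      have n: "norm (of_real (r ^ j) * \<xi>) < 1" "norm (of_real (r ^ (2 * K)) * \<xi>) < 1"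
        using rj r2K \<xi> r by (auto simp: norm_mult norm_power)
      \<comment> \<open>With \<open>\<rho> = r ^ (2 * K)\<close> and \<open>r ^ j\<close> for the
        larger radius, the hypotheses of Harnack's inequality say \<open>j \<le> 2 * K\<close> and
        \<open>K \<le> j\<close>: this dictates the window.\<close>
      have le: "r ^ (2 * K) \<le> r ^ j" using j r by (intro power_decreasing) auto
      have le2: "(r ^ j)\<^sup>2 \<le> r ^ (2 * K)"
        unfolding power_mult[symmetric] using j r by (intro power_decreasing) auto
      have "poisson_operator (r ^ (2 * K)) u \<xi> \<le> (AVG z. 8 * (poisson_kernel (of_real (r ^ j) * \<xi>) z * u z))"
        unfolding poisson_operator_def real_scaleR_def
      proof (rule integral_mono_AE)
        show "AE z in circle_measure. poisson_kernel (of_real (r ^ (2 * K)) * \<xi>) z * u z \<le> 8 * (poisson_kernel (of_real (r ^ j) * \<xi>) z * u z)"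
          using AE_circle_measure
        proof eventually_elim
          case (elim z)
          have "poisson_kernel (of_real (r ^ (2 * K)) * \<xi>) z * u z \<le> (8 * poisson_kernel (of_real (r ^ j) * \<xi>) z) * u z"
            by (rule mult_right_mono[OF poisson_kernel_Harnack[OF \<xi> elim r2K(1) le le2 rj(2)] u(2)])
          then show ?case by simp
        qed
      qed (use integrable_poisson_mult[OF u(1) n(1)] integrable_poisson_mult[OF u(1) n(2)] in auto)
      then show ?thesis using j0 by (simp add: U_def poisson_operator_def)
    qed
    have U0: "0 \<le> U j \<xi>" for j
      using poisson_operator_mono[of "\<lambda>_. 0" u "r ^ j" \<xi>] u \<xi> r
      by (auto simp: U_def poisson_operator_def power_less_one_iff)
    have "real K * \<alpha> < real K * norm (h (of_real (r ^ (2 * K)) * \<xi>))" using K by simp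
    also have "\<dots> \<le> (\<Sum>j\<in>{K..<2*K}. 8 * U j \<xi>)"
      using sum_bounded_below[of "{K..<2*K}" "norm (h (of_real (r ^ (2 * K)) * \<xi>))" "\<lambda>j. 8 * U j \<xi>"] 1 2 by fastforce
    also have "\<dots> \<le> (\<Sum>j<2*K. 8 * U j \<xi>)" by (intro sum_mono2) (use U0 in auto)
    also have "\<dots> = 8 * (\<Sum>j<2*K. U j \<xi>)" by (simp only: sum_distrib_left)
    finally have "(\<alpha> / 16) * real (2 * K) < (\<Sum>j<2*K. U j \<xi>)" by (simp add: mult.commute)
    then show "\<xi> \<in> ?A" using K \<xi> by (intro CollectI conjI bexI[of _ "2 * K"]) auto
  qed
  then have "measure circle_measure C \<le> measure circle_measure ?A"
    using Am by (intro circle.finite_measure_mono) auto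
  then have "(\<alpha> / 16) * measure circle_measure C \<le> (\<alpha> / 16) * measure circle_measure ?A"
    using lam by (intro mult_left_mono) auto
  also have "\<dots> \<le> (AVG z. u z)"
    using maximal_ergodic_inequality[OF u r, of "\<alpha> / 16" "2 * N"] lam unfolding U_def by simp
  finally show "measure circle_measure C \<le> 16 * (AVG z. norm (h z)) / \<alpha>"
    using lam by (simp add: u_def field_simps)
qed

text \<open>A measurable superset replaces a proof that the exceptional set itself is measurable. A
  set whose points lie in \<open>C m\<close> for all large \<open>m\<close> is contained in the
  increasing union of the tail intersections, each of measure at most \<open>c\<close>.\<close>

lemma measure_eventually_subset:
  fixes C :: "nat \<Rightarrow> complex set"
  assumes C [measurable]: "\<And>m. C m \<in> sets borel" and le: "\<And>m. measure circle_measure (C m) \<le> c"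
    and B: "\<And>x. x \<in> B \<Longrightarrow> eventually (\<lambda>m. x \<in> C m) sequentially"
  shows "\<exists>B'\<in>sets borel. B \<subseteq> B' \<and> measure circle_measure B' \<le> c"
proof -
  define D where "D = (\<lambda>n. \<Inter>m\<in>{n..}. C m)"
  have D [measurable]: "D n \<in> sets borel" for n unfolding D_def by measurable
  have "(\<lambda>n. measure circle_measure (D n)) \<longlonglongrightarrow> measure circle_measure (\<Union>n. D n)"
    by (rule circle.finite_Lim_measure_incseq) (auto simp: D_def incseq_def)
  moreover have "measure circle_measure (D n) \<le> c" for n
  proof -
    have "measure circle_measure (D n) \<le> measure circle_measure (C n)"
      by (rule circle.finite_measure_mono) (auto simp: D_def)
    then show ?thesis using le[of n] by linarith
  qed
  ultimately have "measure circle_measure (\<Union>n. D n) \<le> c"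
    by (intro LIMSEQ_le_const2) auto
  moreover have "B \<subseteq> (\<Union>n. D n)"
    using B unfolding D_def eventually_sequentially by fastforce
  ultimately show ?thesis by (intro bexI[of _ "\<Union>n. D n"]) auto
qed

text \<open>The bound in \<open>weak_type_discrete\<close> depends neither on the ratio
  \<open>r\<close> of the grid of radii nor on its length \<open>N\<close>. Refining the grid
  therefore reaches every radius: each \<open>t\<close> is a limit of grid radii, and
  \<open>h\<close> is continuous there.\<close>

lemma weak_type:
  assumes h [measurable]: "h \<in> borel_measurable borel" and hol: "h holomorphic_on ball 0 R" "1 < R"
    and lam: "0 < \<alpha>"
  shows "\<exists>B\<in>sets borel. {\<xi>. norm \<xi> = 1 \<and> (\<exists>t. 0 < t \<and> t < 1 \<and> \<alpha> < norm (h (of_real t * \<xi>)))} \<subseteq> B \<and>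
     measure circle_measure B \<le> 16 * (AVG z. norm (h z)) / \<alpha>"
proof -
  \<comment> \<open>With this ratio \<open>r m ^ (2 * K) = exp (- 2 * K / (m + 1))\<close>, so the
    grid has mesh \<open>2 / (m + 1)\<close> on the scale of \<open>- ln t\<close>.\<close>
  define r where "r = (\<lambda>m::nat. exp (- 1 / real (Suc m)))"
  have r: "0 \<le> r m" "r m < 1" for m by (auto simp: r_def)
  \<comment> \<open>To approximate \<open>t = exp (- s)\<close> one needs \<open>K\<close> up to
    \<open>s * (m + 1) / 2\<close>, which is at most \<open>m^2\<close> once
    \<open>m \<ge> s\<close> and \<open>m \<ge> 1\<close>. The grid length thus depends on
    \<open>m\<close> alone and not on the point.\<close>
  define C where "C = (\<lambda>m. {\<xi>. norm \<xi> = 1 \<and> (\<exists>K\<in>{1..m\<^sup>2}. \<alpha> < norm (h (of_real (r m ^ (2 * K)) * \<xi>)))})"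
  show ?thesis
  proof (rule measure_eventually_subset[of C])
    fix m
    show "C m \<in> sets borel" "measure circle_measure (C m) \<le> 16 * (AVG z. norm (h z)) / \<alpha>"
      unfolding C_def by (rule weak_type_discrete[OF h hol r lam])+
  next
    fix \<xi> assume "\<xi> \<in> {\<xi>. norm \<xi> = 1 \<and> (\<exists>t. 0 < t \<and> t < 1 \<and> \<alpha> < norm (h (of_real t * \<xi>)))}"
    then obtain t where t: "0 < t" "t < 1" "\<alpha> < norm (h (of_real t * \<xi>))" and \<xi>: "norm \<xi> = 1" by auto
    define s where "s = - ln t"
    have s: "0 < s" "t = exp (- s)" using t by (auto simp: s_def)
    define K where "K = (\<lambda>m. nat \<lfloor>s * real (Suc m) / 2\<rfloor>)"
    define \<sigma> where "\<sigma> = (\<lambda>m. 2 * real (K m) / real (Suc m))"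
    have K1: "real (K m) \<le> s * real (Suc m) / 2" "s * real (Suc m) / 2 < real (K m) + 1" for m
    proof -
      have "0 \<le> s * real (Suc m) / 2" using s by auto
      then show "real (K m) \<le> s * real (Suc m) / 2" "s * real (Suc m) / 2 < real (K m) + 1"
        unfolding K_def by (simp_all add: of_nat_nat del: of_nat_Suc) linarith+
    qed
    have "(\<lambda>m. s - 2 / real (Suc m)) \<longlonglongrightarrow> s - 0"
      by (intro tendsto_intros LIMSEQ_Suc[OF lim_const_over_n])
    moreover have "s - 2 / real (Suc m) \<le> \<sigma> m" "\<sigma> m \<le> s" for m
    proof -
      have c: "0 < real (Suc m)" by simp
      have "(s * real (Suc m) - 2) / real (Suc m) \<le> 2 * real (K m) / real (Suc m)"
        by (rule divide_right_mono) (use K1[of m] c in linarith)+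
      then show "s - 2 / real (Suc m) \<le> \<sigma> m"
        unfolding \<sigma>_def using c by (simp add: diff_divide_distrib)
      have "2 * real (K m) / real (Suc m) \<le> s * real (Suc m) / real (Suc m)"
        by (rule divide_right_mono) (use K1[of m] c in linarith)+
      then show "\<sigma> m \<le> s" unfolding \<sigma>_def using c by simp
    qed
    ultimately have \<sigma>: "\<sigma> \<longlonglongrightarrow> s"
      by (intro tendsto_sandwich[of "\<lambda>m. s - 2 / real (Suc m)" \<sigma> sequentially "\<lambda>_. s"]) auto
    have contR: "isCont h (of_real t * \<xi>)"
    proof -
      have "of_real t * \<xi> \<in> ball 0 R" using t \<xi> hol by (simp add: norm_mult)
      then show ?thesis using holomorphic_on_imp_continuous_on[OF hol(1)] by (simp add: continuous_on_eq_continuous_at)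
    qed
    have "(\<lambda>m. of_real (exp (- \<sigma> m)) * \<xi>) \<longlonglongrightarrow> of_real (exp (- s)) * \<xi>"
      by (intro tendsto_intros \<sigma>)
    then have "(\<lambda>m. norm (h (of_real (exp (- \<sigma> m)) * \<xi>))) \<longlonglongrightarrow> norm (h (of_real t * \<xi>))"
      unfolding s(2)[symmetric] by (intro tendsto_norm isCont_tendsto_compose[OF contR])
    then have "eventually (\<lambda>m. \<alpha> < norm (h (of_real (exp (- \<sigma> m)) * \<xi>))) sequentially"
      using t(3) by (rule order_tendstoD(1))
    moreover have "eventually (\<lambda>m. 0 < \<sigma> m) sequentially" using \<sigma> s(1) by (rule order_tendstoD(1))
    moreover obtain m0 :: nat where m0: "s \<le> real m0" using real_arch_simple by blast
    then have "eventually (\<lambda>m. m0 + 1 \<le> m) sequentially" by (intro eventually_ge_at_top)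
    ultimately show "eventually (\<lambda>m. \<xi> \<in> C m) sequentially"
    proof eventually_elim
      case (elim m)
      have "0 < real (K m)" using elim(2) unfolding \<sigma>_def by (simp add: zero_less_divide_iff)
      then have Kpos: "1 \<le> K m" by simp
      have "real (K m) \<le> s * real (Suc m) / 2" by (rule K1)
      also have "\<dots> \<le> real m * (2 * real m) / 2" using m0 elim(3) s by (intro divide_right_mono mult_mono) auto
      also have "\<dots> = real (m\<^sup>2)" by (simp add: power2_eq_square)
      finally have "K m \<le> m\<^sup>2" by (simp only: of_nat_le_iff)
      moreover have "r m ^ (2 * K m) = exp (- \<sigma> m)"
        unfolding r_def \<sigma>_def exp_of_nat_mult[symmetric] by simp
      moreover have "\<alpha> < norm (h (of_real (r m ^ (2 * K m)) * \<xi>))"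
        unfolding calculation(2) by (rule elim(1))
      ultimately show ?case unfolding C_def using \<xi> Kpos by (intro CollectI conjI bexI[of _ "K m"]) auto
    qed
  qed
qed

section \<open>Mean-square estimates and Fatou's theorem\<close>

lemma poisson_operator_cnj: "poisson_operator r (\<lambda>z. cnj (u z)) \<xi> = cnj (poisson_operator r u \<xi>)"
  unfolding poisson_operator_def complex_cnj_scaleR[symmetric] by (rule Bochner_Integration.integral_cnj)

lemma integrable_mult_cnj:
  fixes u v :: "'a \<Rightarrow> complex"
  assumes [measurable]: "u \<in> borel_measurable M" "v \<in> borel_measurable M"
    and u: "integrable M (\<lambda>z. (norm (u z))\<^sup>2)" and v: "integrable M (\<lambda>z. (norm (v z))\<^sup>2)"
  shows "integrable M (\<lambda>z. u z * cnj (v z))"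
proof (rule Bochner_Integration.integrable_bound)
  show "integrable M (\<lambda>z. (norm (u z))\<^sup>2 + (norm (v z))\<^sup>2)" using u v by auto
  show "(\<lambda>z. u z * cnj (v z)) \<in> borel_measurable M" by measurable
  have "norm (u z) * norm (v z) \<le> (norm (u z))\<^sup>2 + (norm (v z))\<^sup>2" for z
    using sum_squares_bound[of "norm (u z)" "norm (v z)"] mult_nonneg_nonneg[OF norm_ge_zero norm_ge_zero, of "u z" "v z"]
    unfolding mult.assoc by linarith
  then show "AE z in M. norm (u z * cnj (v z)) \<le> norm ((norm (u z))\<^sup>2 + (norm (v z))\<^sup>2)"
    by (auto simp: norm_mult)
qed

text \<open>The square root \<open>P\<^bsub>\<surd>r\<^esub>\<close> of the self-adjoint contraction \<open>P\<^bsub>r\<^esub>\<close> gives \<open>\<langle>P\<^bsub>r\<^esub> u, u\<rangle> \<ge> \<parallel>P\<^bsub>r\<^esub> u\<parallel>\<^sup>2\<close>.\<close>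

lemma poisson_operator_L2_gap:
  fixes u :: "complex \<Rightarrow> complex"
  assumes u [measurable]: "u \<in> borel_measurable borel" and I: "integrable circle_measure (\<lambda>z. (norm (u z))\<^sup>2)"
    and r: "0 \<le> r" "r < 1"
  shows "integrable circle_measure (\<lambda>z. (norm (u z - poisson_operator r u z))\<^sup>2)"
    and "integrable circle_measure (\<lambda>z. (norm (poisson_operator r u z))\<^sup>2)"
    and "(AVG z. (norm (u z - poisson_operator r u z))\<^sup>2) \<le>
       (AVG z. (norm (u z))\<^sup>2) - (AVG z. (norm (poisson_operator r u z))\<^sup>2)"
proof -
  define s where "s = sqrt r"
  have s: "0 \<le> s" "s < 1" "s * s = r" using r by (auto simp: s_def)
  define v where "v = poisson_operator s u"
  define w where "w = poisson_operator r u"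
  have I': "integrable circle_measure (\<lambda>z. norm (u z) powr 2)" using I by simp
  have iu: "integrable circle_measure u" by (rule integrable_powr_imp_integrable[OF _ u I']) simp
  have [measurable]: "v \<in> borel_measurable borel" "w \<in> borel_measurable borel"
    unfolding v_def w_def using iu by (auto intro: borel_measurable_poisson_operator)
  have Iv: "integrable circle_measure (\<lambda>z. (norm (v z))\<^sup>2)"
    using poisson_operator_contraction(1)[OF _ u I' s(1,2)] by (simp add: v_def)
  show Iw: "integrable circle_measure (\<lambda>z. (norm (poisson_operator r u z))\<^sup>2)"
    using poisson_operator_contraction(1)[OF _ u I' r] by simp
  then have Iw': "integrable circle_measure (\<lambda>z. (norm (w z))\<^sup>2)" by (simp add: w_def)
  have iv: "integrable circle_measure v" unfolding v_def by (rule integrable_poisson_operator[OF iu s(1,2)])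
  have w: "w z = poisson_operator s v z" if "norm z = 1" for z
    unfolding v_def w_def using poisson_operator_semigroup[OF iu s(1,2) s(1,2) that] s by simp
  have le: "(AVG z. (norm (w z))\<^sup>2) \<le> (AVG z. (norm (v z))\<^sup>2)"
  proof -
    have "(AVG z. (norm (w z))\<^sup>2) = (AVG z. norm (poisson_operator s v z) powr 2)"
    proof (rule circle_integral_cong)
      have "poisson_operator s v \<in> borel_measurable borel" by (rule borel_measurable_poisson_operator[OF iv])
      then show "(\<lambda>z. norm (poisson_operator s v z) powr 2) \<in> borel_measurable borel" by measurable
    qed (use w in auto)
    also have "\<dots> \<le> (AVG z. norm (v z) powr 2)"
      by (rule poisson_operator_contraction(2)) (use Iv s in auto)
    finally show ?thesis by simp
  qed
  have inner: "(AVG z. w z * cnj (u z)) = of_real (AVG z. (norm (v z))\<^sup>2)"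
  proof -
    have "(AVG z. w z * cnj (u z)) = (AVG z. poisson_operator s v z * cnj (u z))"
    proof (rule circle_integral_cong)
      have "poisson_operator s v \<in> borel_measurable borel" by (rule borel_measurable_poisson_operator[OF iv])
      then show "(\<lambda>z. poisson_operator s v z * cnj (u z)) \<in> borel_measurable borel" by measurable
    qed (use w in auto)
    also have "\<dots> = (AVG z. v z * poisson_operator s (\<lambda>z. cnj (u z)) z)"
      by (rule poisson_operator_selfadjoint[symmetric]) (use iv iu s in auto)
    also have "\<dots> = (AVG z. of_real ((norm (v z))\<^sup>2))"
      unfolding poisson_operator_cnj v_def complex_norm_square ..
    also have "\<dots> = of_real (AVG z. (norm (v z))\<^sup>2)" by (rule integral_complex_of_real)
    finally show ?thesis .
  qed
  have expand: "(norm (u z - w z))\<^sup>2 = (norm (u z))\<^sup>2 + (norm (w z))\<^sup>2 - 2 * Re (w z * cnj (u z))" for z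
    unfolding cmod_power2 by (simp add: power2_eq_square algebra_simps)
  have ic: "integrable circle_measure (\<lambda>z. w z * cnj (u z))"
    by (rule integrable_mult_cnj) (use I Iw' in auto)
  show "integrable circle_measure (\<lambda>z. (norm (u z - poisson_operator r u z))\<^sup>2)"
    unfolding w_def[symmetric] expand
    by (intro Bochner_Integration.integrable_diff Bochner_Integration.integrable_add integrable_mult_right integrable_Re ic I Iw')
  have "(AVG z. (norm (u z - w z))\<^sup>2) = (AVG z. (norm (u z))\<^sup>2)
      + (AVG z. (norm (w z))\<^sup>2) - 2 * (AVG z. (norm (v z))\<^sup>2)"
  proof -
    have re: "integrable circle_measure (\<lambda>z. Re (w z * cnj (u z)))" by (rule integrable_Re[OF ic])
    have "(AVG z. Re (w z * cnj (u z))) = (AVG z. (norm (v z))\<^sup>2)"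
      unfolding integral_Re[OF ic] inner by simp
    then show ?thesis unfolding expand using I Iw' re
      by (simp only: Bochner_Integration.integral_diff Bochner_Integration.integral_add
        Bochner_Integration.integrable_add integrable_mult_right Bochner_Integration.integral_mult_right)
  qed
  with le show "(AVG z. (norm (u z - poisson_operator r u z))\<^sup>2) \<le>
       (AVG z. (norm (u z))\<^sup>2) - (AVG z. (norm (poisson_operator r u z))\<^sup>2)"
    unfolding w_def[symmetric] by linarith
qed

lemma holomorphic_dilation:
  assumes f: "f holomorphic_on ball 0 1" and R: "0 < R" "R < 1"
  shows "(\<lambda>z. f (of_real R * z)) holomorphic_on ball 0 (1 / R)" "1 < 1 / R"
proof -
  show "(\<lambda>z. f (of_real R * z)) holomorphic_on ball 0 (1 / R)"
    by (rule holomorphic_on_compose_gen[OF _ f, unfolded o_def])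
       (use R in \<open>auto intro!: holomorphic_intros simp: norm_mult field_simps\<close>)
  show "1 < 1 / R" using R by simp
qed

lemma power2_integral_norm_le:
  fixes u :: "complex \<Rightarrow> complex"
  assumes "u \<in> borel_measurable borel" "integrable circle_measure (\<lambda>z. (norm (u z))\<^sup>2)"
  shows "(AVG z. norm (u z))\<^sup>2 \<le> (AVG z. (norm (u z))\<^sup>2)"
  using Jensen_powr_kernel(2)[of 2 "\<lambda>z. norm (u z)" circle_measure "\<lambda>_. 1"] assms circle.prob_space
  by (simp add: abs_of_nonneg)

text \<open>The smaller dilation is the Poisson operator of parameter \<open>R / S\<close> applied
  to the larger one. Hence square means increase with the radius, and their increments control the
  L^2 distances: bounded square means make the dilations a Cauchy family.\<close>

lemma dilation_L2_gap:
  assumes [measurable]: "\<phi> \<in> borel_measurable borel" and hol: "\<phi> holomorphic_on ball 0 1"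
    and R: "0 < R" "R < S" "S < 1"
  shows "(AVG z. (norm (\<phi> (of_real S * z) - \<phi> (of_real R * z)))\<^sup>2) \<le>
       (AVG z. (norm (\<phi> (of_real S * z)))\<^sup>2) - (AVG z. (norm (\<phi> (of_real R * z)))\<^sup>2)"
proof -
  define u where "u = (\<lambda>z. \<phi> (of_real S * z))"
  have S: "0 < S" using R by simp
  note hS = holomorphic_dilation[OF hol S R(3), folded u_def]
  have [measurable]: "u \<in> borel_measurable borel" unfolding u_def by measurable
  have I: "integrable circle_measure (\<lambda>z. (norm (u z))\<^sup>2)"
    using holomorphic_continuous_on_sphere[OF hS]
    by (intro integrable_circle_continuous continuous_intros) auto
  have q: "0 \<le> R / S" "R / S < 1" using R S by auto
  have iu: "integrable circle_measure u" 
    using holomorphic_continuous_on_sphere[OF hS] by (intro integrable_circle_continuous) auto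
  have [measurable]: "poisson_operator (R / S) u \<in> borel_measurable borel"
    by (rule borel_measurable_poisson_operator[OF iu])
  have eq: "poisson_operator (R / S) u z = \<phi> (of_real R * z)" if "norm z = 1" for z
    using poisson_operator_holomorphic[OF _ hS q that] R by (simp add: u_def)
  have "(AVG z. (norm (u z - poisson_operator (R / S) u z))\<^sup>2) = (AVG z. (norm (u z - \<phi> (of_real R * z)))\<^sup>2)"
    by (rule circle_integral_cong) (use eq in auto)
  moreover have "(AVG z. (norm (poisson_operator (R / S) u z))\<^sup>2) = (AVG z. (norm (\<phi> (of_real R * z)))\<^sup>2)"
    by (rule circle_integral_cong) (use eq in auto)
  ultimately show ?thesis using poisson_operator_L2_gap(3)[OF \<open>u \<in> borel_measurable borel\<close> I q] unfolding u_def by linarith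
qed

lemma convergent_at_left_if_Cauchy:
  fixes g :: "real \<Rightarrow> 'a::banach"
  assumes "\<And>e. 0 < e \<Longrightarrow> \<exists>R<1. \<forall>x y. R < x \<and> x < 1 \<and> R < y \<and> y < 1 \<longrightarrow> norm (g x - g y) < e"
  shows "\<exists>l. (g \<longlongrightarrow> l) (at_left 1)"
proof -
  have "cauchy_filter (filtermap g (at_left 1))"
    unfolding cauchy_filter_metric_filtermap
  proof (intro allI impI)
    fix e :: real assume "0 < e"
    then obtain R where R: "R < 1" "\<And>x y. R < x \<Longrightarrow> x < 1 \<Longrightarrow> R < y \<Longrightarrow> y < 1 \<Longrightarrow> norm (g x - g y) < e"
      using assms by meson
    have "eventually (\<lambda>x. R < x \<and> x < 1) (at_left 1)"
      using eventually_at_left_real[OF R(1)] by simp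
    with R(2) show "\<exists>P. eventually P (at_left 1) \<and> (\<forall>x y. P x \<and> P y \<longrightarrow> dist (g x) (g y) < e)"
      by (intro exI[of _ "\<lambda>x. R < x \<and> x < 1"]) (auto simp: dist_norm)
  qed
  then have "\<exists>c. filtermap g (at_left 1) \<le> nhds c"
    by (rule cauchy_filter_complete_converges[OF _ complete_UNIV]) (auto simp: filtermap_bot_iff)
  then show ?thesis by (simp add: filterlim_def)
qed

text \<open>The dilations of \<open>\<phi>\<close> are Cauchy in L^2, hence in L^1. The weak-type
  inequality turns this into smallness of the radial maximal function of the difference between
  \<open>\<phi>\<close> and a dilation, outside a set of small measure. Since the dilation is
  continuous up to the circle, \<open>\<phi>\<close> can oscillate only little along the remaining
  radii.\<close>

theorem Fatou_radial_limits:
  assumes [measurable]: "\<phi> \<in> borel_measurable borel" and hol: "\<phi> holomorphic_on ball 0 1"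
    and bd: "\<And>z. norm z < 1 \<Longrightarrow> norm (\<phi> z) \<le> 1"
  shows "AE \<xi> in circle_measure. \<exists>l. ((\<lambda>r. \<phi> (of_real r * \<xi>)) \<longlongrightarrow> l) (at_left 1)"
proof -
  define Rn where "Rn = (\<lambda>n::nat. 1 - 1 / real (n + 2))"
  have Rn: "0 < Rn n" "Rn n < 1" "Rn n < Rn (Suc n)" for n by (auto simp: Rn_def field_simps)
  have Rn_mono: "strict_mono Rn" by (rule strict_mono_Suc_iff[THEN iffD2]) (use Rn in auto)
  have Rn_lim: "Rn \<longlonglongrightarrow> 1"
  proof -
    have "(\<lambda>n. 1 - 1 / real (n + 2)) \<longlonglongrightarrow> 1 - 0"
      by (intro tendsto_intros LIMSEQ_ignore_initial_segment[OF lim_const_over_n])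
    then show ?thesis by (simp add: Rn_def)
  qed
  have Rnb: "norm (\<phi> (of_real (Rn n) * z)) \<le> 1" if "norm z = 1" for n z
    using that Rn(1,2)[of n] by (intro bd) (simp add: norm_mult)
  define m where "m = (\<lambda>n. AVG z. (norm (\<phi> (of_real (Rn n) * z)))\<^sup>2)"
  have gap: "(AVG z. (norm (\<phi> (of_real (Rn k) * z) - \<phi> (of_real (Rn n) * z)))\<^sup>2) \<le> m k - m n" if "n < k" for n k
    unfolding m_def by (rule dilation_L2_gap[OF _ hol]) (use Rn strict_monoD[OF Rn_mono that] in auto)
  have m_mono: "m n \<le> m k" if "n < k" for n k
  proof -
    have "0 \<le> (AVG z. (norm (\<phi> (of_real (Rn k) * z) - \<phi> (of_real (Rn n) * z)))\<^sup>2)" by simp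
    with gap[OF that] show ?thesis by linarith
  qed
  have m_le: "m n \<le> 1" for n
  proof -
    have "m n \<le> (AVG z. 1)" unfolding m_def
    proof (rule integral_mono_AE)
      show "integrable circle_measure (\<lambda>z. (norm (\<phi> (of_real (Rn n) * z)))\<^sup>2)"
        by (rule integrable_circle_bounded[where B = 1]) (use Rnb in \<open>auto simp: abs_square_le_1\<close>)
      show "AE z in circle_measure. (norm (\<phi> (of_real (Rn n) * z)))\<^sup>2 \<le> 1"
        using AE_circle_measure by eventually_elim (use Rnb in \<open>auto simp: abs_square_le_1\<close>)
    qed auto
    then show ?thesis using circle.prob_space by simp
  qed
  have "incseq m" using m_mono by (intro incseq_SucI) (simp add: less_imp_le)
  then obtain l where "m \<longlonglongrightarrow> l" using incseq_convergent[of m 1] m_le by blast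
  then have "Cauchy m" by (rule LIMSEQ_imp_Cauchy)
  have L1: "\<exists>n. \<forall>k>n. (AVG z. norm (\<phi> (of_real (Rn k) * z) - \<phi> (of_real (Rn n) * z))) \<le> e" if "0 < e" for e
  proof -
    have "0 < e\<^sup>2" using that by simp
    then obtain n where n: "\<And>k. k \<ge> n \<Longrightarrow> norm (m k - m n) < e\<^sup>2"
      using CauchyD[OF \<open>Cauchy m\<close>] by (metis order_refl)
    have "(AVG z. norm (\<phi> (of_real (Rn k) * z) - \<phi> (of_real (Rn n) * z))) \<le> e" if k: "n < k" for k
    proof -
      let ?u = "\<lambda>z. \<phi> (of_real (Rn k) * z) - \<phi> (of_real (Rn n) * z)"
      have "integrable circle_measure (\<lambda>z. (norm (?u z))\<^sup>2)"
      proof (rule integrable_circle_bounded[where B = 4])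
        fix z :: complex assume "norm z = 1"
        then have "norm (?u z) \<le> 1 + 1" by (intro order_trans[OF norm_triangle_ineq4] add_mono Rnb)
        then have "(norm (?u z))\<^sup>2 \<le> 2\<^sup>2" by (intro power_mono) auto
        then show "norm ((norm (?u z))\<^sup>2) \<le> 4" by simp
      qed measurable
      then have "(AVG z. norm (?u z))\<^sup>2 \<le> (AVG z. (norm (?u z))\<^sup>2)"
        by (intro power2_integral_norm_le) auto
      also have "\<dots> \<le> e\<^sup>2" using gap[OF k] n[of k] k m_mono[OF k] by simp
      finally show ?thesis by (rule power2_le_imp_le) (use \<open>0 < e\<close> in simp)
    qed
    then show ?thesis by blast
  qed
  \<comment> \<open>The 4 counts two points of the radius, each within \<open>2 * a\<close> of the
    limit of the dilation: one \<open>a\<close> from the maximal function and one from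
    continuity.\<close>
  define N where "N = (\<lambda>a. {\<xi>. norm \<xi> = 1 \<and> \<not> (\<exists>R<1. \<forall>x y. R < x \<and> x < 1 \<and> R < y \<and> y < 1 \<longrightarrow>
      norm (\<phi> (of_real x * \<xi>) - \<phi> (of_real y * \<xi>)) < 4 * a)})"
  have small: "\<exists>B\<in>sets borel. N a \<subseteq> B \<and> measure circle_measure B \<le> e" if a: "0 < a" and e: "0 < e" for a e
  proof -
    obtain n where n: "\<And>k. n < k \<Longrightarrow> (AVG z. norm (\<phi> (of_real (Rn k) * z) - \<phi> (of_real (Rn n) * z))) \<le> e * a / 16"
      using L1[of "e * a / 16"] a e by auto
    \<comment> \<open>The weak-type inequality needs functions holomorphic beyond the closed disc,
      so two dilations are compared instead of \<open>\<phi>\<close> with one; letting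
      \<open>k\<close> grow recovers \<open>\<phi>\<close> through
      \<open>measure_eventually_subset\<close>. The index \<open>n + 1 + k\<close> exceeds
      \<open>n\<close>, as the Cauchy estimate demands, and the 16 in \<open>e * a / 16\<close>
      cancels the weak-type constant.\<close>
    define h where "h = (\<lambda>k z. \<phi> (of_real (Rn (n + 1 + k)) * z) - \<phi> (of_real (Rn n) * z))"
    have "\<exists>B\<in>sets borel. {\<xi>. norm \<xi> = 1 \<and> (\<exists>t. 0 < t \<and> t < 1 \<and> a < norm (h k (of_real t * \<xi>)))} \<subseteq> B \<and>
       measure circle_measure B \<le> e" for k
    proof -
      have hm: "h k \<in> borel_measurable borel" unfolding h_def by measurable
      have sub: "ball (0::complex) (1 / Rn (n + 1 + k)) \<subseteq> ball 0 (1 / Rn n)"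
        using Rn(1)[of n] Rn(1)[of "n + 1 + k"] strict_monoD[OF Rn_mono, of n "n + 1 + k"]
        by (intro subset_ball divide_left_mono) auto
      have hh: "h k holomorphic_on ball 0 (1 / Rn (n + 1 + k))" unfolding h_def
        by (intro holomorphic_on_diff holomorphic_dilation(1)[OF hol] holomorphic_on_subset[OF holomorphic_dilation(1)[OF hol] sub] Rn)
      have "16 * (AVG z. norm (h k z)) / a \<le> 16 * (e * a / 16) / a"
        unfolding h_def using n[of "n + 1 + k"] a by (intro divide_right_mono mult_left_mono) auto
      also have "\<dots> = e" using a by simp
      finally show ?thesis
        using weak_type[OF hm hh holomorphic_dilation(2)[OF hol Rn(1,2)] a] by (meson order_trans)
    qed
    then have "\<forall>k. \<exists>B. B \<in> sets borel \<and> {\<xi>. norm \<xi> = 1 \<and> (\<exists>t. 0 < t \<and> t < 1 \<and> a < norm (h k (of_real t * \<xi>)))} \<subseteq> B \<and>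
       measure circle_measure B \<le> e" by blast
    from choice[OF this] obtain B where B: "\<And>k. B k \<in> sets borel" "\<And>k. measure circle_measure (B k) \<le> e"
      "\<And>k. {\<xi>. norm \<xi> = 1 \<and> (\<exists>t. 0 < t \<and> t < 1 \<and> a < norm (h k (of_real t * \<xi>)))} \<subseteq> B k" by blast
    show ?thesis
    proof (rule measure_eventually_subset[of B, OF B(1,2)])
      fix \<xi> assume \<xi>N: "\<xi> \<in> N a"
      then have \<xi>: "norm \<xi> = 1" by (simp add: N_def)
      have cont: "isCont \<phi> w" if "norm w < 1" for w
        using holomorphic_on_imp_continuous_on[OF hol] that by (simp add: continuous_on_eq_continuous_at)
      \<comment> \<open>Otherwise \<open>\<phi>\<close> stays within \<open>a\<close> of its
        dilation along the whole radius, and the continuity of the dilation at the end point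
        contradicts membership in \<open>N a\<close>.\<close>
      have "\<exists>t. 0 < t \<and> t < 1 \<and> a < norm (\<phi> (of_real t * \<xi>) - \<phi> (of_real (Rn n * t) * \<xi>))"
      proof (rule ccontr)
        assume "\<not> ?thesis"
        then have le: "norm (\<phi> (of_real t * \<xi>) - \<phi> (of_real (Rn n * t) * \<xi>)) \<le> a" if "0 < t" "t < 1" for t
          using that by (meson not_le)
        let ?l = "\<phi> (of_real (Rn n) * \<xi>)"
        have "((\<lambda>t. of_real (Rn n * t) * \<xi>) \<longlongrightarrow> of_real (Rn n * 1) * \<xi>) (at_left (1::real))"
          by (intro tendsto_intros)
        then have "((\<lambda>t. \<phi> (of_real (Rn n * t) * \<xi>)) \<longlongrightarrow> ?l) (at_left (1::real))"
          using Rn[of n] \<xi> by (intro isCont_tendsto_compose[OF cont]) (auto simp: norm_mult)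
        then have "eventually (\<lambda>t. dist (\<phi> (of_real (Rn n * t) * \<xi>)) ?l < a) (at_left (1::real))"
          using a by (rule tendstoD)
        then obtain b where b: "b < 1" "\<And>t. b < t \<Longrightarrow> t < 1 \<Longrightarrow> dist (\<phi> (of_real (Rn n * t) * \<xi>)) ?l < a"
          using eventually_at_left[of 0 "1::real"] by auto
        have "norm (\<phi> (of_real x * \<xi>) - \<phi> (of_real y * \<xi>)) < 4 * a"
          if "max 0 b < x" "x < 1" "max 0 b < y" "y < 1" for x y
        proof -
          have l: "norm (\<phi> (of_real t * \<xi>) - ?l) < 2 * a" if "max 0 b < t" "t < 1" for t
          proof -
            have "norm (\<phi> (of_real t * \<xi>) - ?l) \<le> norm (\<phi> (of_real t * \<xi>) - \<phi> (of_real (Rn n * t) * \<xi>)) + norm (\<phi> (of_real (Rn n * t) * \<xi>) - ?l)"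
              using dist_triangle[of "\<phi> (of_real t * \<xi>)" ?l "\<phi> (of_real (Rn n * t) * \<xi>)"] by (simp add: dist_norm)
            also have "\<dots> < a + a" using le[of t] b(2)[of t] that by (intro add_le_less_mono) (auto simp: dist_norm)
            finally show ?thesis by simp
          qed
          have "norm (\<phi> (of_real x * \<xi>) - \<phi> (of_real y * \<xi>)) \<le> norm (\<phi> (of_real x * \<xi>) - ?l) + norm (\<phi> (of_real y * \<xi>) - ?l)"
            using dist_triangle2[of "\<phi> (of_real x * \<xi>)" "\<phi> (of_real y * \<xi>)" ?l] by (simp add: dist_norm)
          with l[of x] l[of y] that show ?thesis by linarith
        qed
        then have "\<exists>R<1. \<forall>x y. R < x \<and> x < 1 \<and> R < y \<and> y < 1 \<longrightarrow> norm (\<phi> (of_real x * \<xi>) - \<phi> (of_real y * \<xi>)) < 4 * a"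
          using b(1) by (intro exI[of _ "max 0 b"]) auto
        then show False using \<xi>N unfolding N_def by blast
      qed
      then obtain t where t: "0 < t" "t < 1" "a < norm (\<phi> (of_real t * \<xi>) - \<phi> (of_real (Rn n * t) * \<xi>))" by blast
      have "(\<lambda>k. of_real (Rn (k + (n + 1)) * t) * \<xi>) \<longlonglongrightarrow> of_real (1 * t) * \<xi>"
        by (intro tendsto_intros LIMSEQ_ignore_initial_segment[OF Rn_lim])
      then have "(\<lambda>k. \<phi> (of_real (Rn (k + (n + 1)) * t) * \<xi>)) \<longlonglongrightarrow> \<phi> (of_real t * \<xi>)"
        using t \<xi> by (intro isCont_tendsto_compose[OF cont]) (auto simp: norm_mult)
      then have "(\<lambda>k. norm (\<phi> (of_real (Rn (k + (n + 1)) * t) * \<xi>) - \<phi> (of_real (Rn n * t) * \<xi>))) \<longlonglongrightarrow> norm (\<phi> (of_real t * \<xi>) - \<phi> (of_real (Rn n * t) * \<xi>))"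
        by (intro tendsto_intros)
      then have "eventually (\<lambda>k. a < norm (\<phi> (of_real (Rn (k + (n + 1)) * t) * \<xi>) - \<phi> (of_real (Rn n * t) * \<xi>))) sequentially"
        using t(3) by (rule order_tendstoD(1))
      then show "eventually (\<lambda>k. \<xi> \<in> B k) sequentially"
      proof eventually_elim
        case (elim k)
        then have "a < norm (h k (of_real t * \<xi>))" unfolding h_def by (simp add: mult_ac add_ac)
        then show ?case using B(3)[of k] t \<xi> by blast
      qed
    qed
  qed
  have N0: "AE \<xi> in circle_measure. \<xi> \<notin> N a" if a: "0 < a" for a
  proof -
    have "\<forall>k::nat. \<exists>B\<in>sets borel. N a \<subseteq> B \<and> measure circle_measure B \<le> 1 / real (Suc k)"
      using small[OF a] by simp
    then obtain B where B: "\<And>k. B k \<in> sets borel" "\<And>k. N a \<subseteq> B k" "\<And>k. measure circle_measure (B k) \<le> 1 / real (Suc k)"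
      by metis
    have [measurable]: "(\<Inter>k. B k) \<in> sets borel" using B(1) by measurable
    have "measure circle_measure (\<Inter>k. B k) \<le> 1 / real (Suc k)" for k
      using circle.finite_measure_mono[of "\<Inter>k. B k" "B k"] B(1,3)[of k] by force
    then have "measure circle_measure (\<Inter>k. B k) \<le> 0"
      using LIMSEQ_le_const[OF LIMSEQ_inverse_real_of_nat] by (auto simp: inverse_eq_divide)
    then have "measure circle_measure (\<Inter>k. B k) = 0" by (intro antisym measure_nonneg)
    then have "(\<Inter>k. B k) \<in> null_sets circle_measure"
      by (intro null_setsI) (auto simp: circle.emeasure_eq_measure)
    then show ?thesis by (rule AE_I') (use B(2) in auto)
  qed
  have "AE \<xi> in circle_measure. \<forall>k::nat. \<xi> \<notin> N (1 / real (Suc k))"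
    unfolding AE_all_countable using N0 by simp
  with AE_circle_measure show ?thesis
  proof eventually_elim
    case (elim \<xi>)
    show ?case
    proof (rule convergent_at_left_if_Cauchy)
      fix e :: real assume "0 < e"
      then obtain k :: nat where k: "1 / real (Suc k) < e / 4"
        using reals_Archimedean[of "e / 4"] by (auto simp: inverse_eq_divide)
      have "\<xi> \<notin> N (1 / real (Suc k))" using elim by blast
      then obtain R where "R < 1" "\<forall>x y. R < x \<and> x < 1 \<and> R < y \<and> y < 1 \<longrightarrow>
          norm (\<phi> (of_real x * \<xi>) - \<phi> (of_real y * \<xi>)) < 4 * (1 / real (Suc k))"
        using elim(1) unfolding N_def by blast
      moreover have "4 * (1 / real (Suc k)) < e" using k by simp
      ultimately show "\<exists>R<1. \<forall>x y. R < x \<and> x < 1 \<and> R < y \<and> y < 1 \<longrightarrow> norm (\<phi> (of_real x * \<xi>) - \<phi> (of_real y * \<xi>)) < e"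
        by (meson less_trans)
    qed
  qed
qed

section \<open>Subordination and Hardy spaces\<close>

lemma continuous_on_cball_if_holomorphic:
  assumes "f holomorphic_on ball 0 R" "1 < R"
  shows "continuous_on (cball (0::complex) 1) f"
  using assms by (intro holomorphic_on_imp_continuous_on holomorphic_on_subset[OF assms(1)]) auto

lemma self_map_circle:
  assumes hol: "\<phi> holomorphic_on ball 0 1" and self: "\<phi> ` ball 0 1 \<subseteq> ball 0 1" and r: "0 \<le> r" "r < 1"
  obtains \<rho> where "0 \<le> \<rho>" "\<rho> < 1" "\<And>\<xi>. norm \<xi> = 1 \<Longrightarrow> norm (\<phi> (of_real r * \<xi>)) \<le> \<rho>"
proof -
  have "compact (cball (0::complex) r)" by simp
  moreover have "continuous_on (cball 0 r) (\<lambda>z. norm (\<phi> z))"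
    using r by (intro continuous_intros holomorphic_on_imp_continuous_on holomorphic_on_subset[OF hol]) auto
  moreover have "cball (0::complex) r \<noteq> {}" using r by auto
  ultimately obtain z where z: "z \<in> cball 0 r" "\<And>y. y \<in> cball 0 r \<Longrightarrow> norm (\<phi> y) \<le> norm (\<phi> z)"
    using continuous_attains_sup by metis
  have "norm (\<phi> z) < 1" using z(1) self r by (auto simp: image_subset_iff)
  then show ?thesis
    using z(2) r by (intro that[of "norm (\<phi> z)"]) (auto simp: norm_mult)
qed

lemma continuous_on_self_map_circle:
  assumes hol: "\<phi> holomorphic_on ball 0 1" and r: "0 \<le> r" "r < 1"
  shows "continuous_on (sphere (0::complex) 1) (\<lambda>\<xi>. \<phi> (of_real r * \<xi>))"
  by (rule continuous_on_compose2[OF holomorphic_on_imp_continuous_on[OF hol]])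
     (use r in \<open>auto intro!: continuous_intros simp: norm_mult\<close>)

lemma continuous_on_norm_powr:
  fixes f :: "'a::topological_space \<Rightarrow> 'b::real_normed_vector" and p :: real
  assumes "continuous_on S f" "0 < p"
  shows "continuous_on S (\<lambda>x. norm (f x) powr p)"
  using assms by (intro continuous_on_powr' continuous_intros) auto

text \<open>After Jensen's inequality, Fubini's theorem leaves the mean over \<open>\<xi>\<close> of
  the kernel at \<open>\<phi> (r * \<xi>)\<close>. By \<open>poisson_kernel_subordination\<close> at
  the centre this is the kernel at \<open>\<phi> 0\<close>, whose maximum is the constant. For the
  identity map the constant is 1, and the statement becomes the monotonicity of the integral means
  in the radius.\<close>

lemma Littlewood_subordination:
  assumes f [measurable]: "f \<in> borel_measurable borel" and hf: "f holomorphic_on ball 0 R" "1 < R"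
    and \<phi> [measurable]: "\<phi> \<in> borel_measurable borel" and hol: "\<phi> holomorphic_on ball 0 1"
    and self: "\<phi> ` ball 0 1 \<subseteq> ball 0 1" and p: "1 \<le> p" and r: "0 \<le> r" "r < 1"
  shows "integrable circle_measure (\<lambda>\<xi>. norm (f (\<phi> (of_real r * \<xi>))) powr p)"
    and "(AVG \<xi>. norm (f (\<phi> (of_real r * \<xi>))) powr p) \<le>
      (1 + norm (\<phi> 0)) / (1 - norm (\<phi> 0)) * (AVG z. norm (f z) powr p)"
proof -
  define g where "g = (\<lambda>z. norm (f z) powr p)"
  obtain \<rho> where \<rho>: "0 \<le> \<rho>" "\<rho> < 1" "\<And>\<xi>. norm \<xi> = 1 \<Longrightarrow> norm (\<phi> (of_real r * \<xi>)) \<le> \<rho>"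
    using self_map_circle[OF hol self r] by blast
  have \<phi>1: "norm (\<phi> (of_real r * \<xi>)) < 1" if "norm \<xi> = 1" for \<xi> using \<rho>(3)[OF that] \<rho> by simp
  have \<phi>0: "norm (\<phi> 0) < 1" using self by (auto simp: image_subset_iff)
  have gI: "integrable circle_measure g" unfolding g_def using p
    by (intro integrable_circle_continuous continuous_on_norm_powr holomorphic_continuous_on_sphere[OF hf]) auto
  show int: "integrable circle_measure (\<lambda>\<xi>. norm (f (\<phi> (of_real r * \<xi>))) powr p)"
  proof (rule integrable_circle_continuous)
    have "continuous_on (sphere 0 1) (\<lambda>\<xi>. f (\<phi> (of_real r * \<xi>)))"
      by (rule continuous_on_compose2[OF continuous_on_cball_if_holomorphic[OF hf] continuous_on_self_map_circle[OF hol r]])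
         (use \<phi>1 in \<open>fastforce intro: less_imp_le\<close>)
    then show "continuous_on (sphere 0 1) (\<lambda>\<xi>. norm (f (\<phi> (of_real r * \<xi>))) powr p)"
      using p by (intro continuous_on_norm_powr) auto
  qed measurable
  have pair: "integrable (circle_measure \<Otimes>\<^sub>M circle_measure) (\<lambda>(\<xi>, z). poisson_kernel (\<phi> (of_real r * \<xi>)) z *\<^sub>R (1 * g z))"
  proof (rule integrable_circle_pair_bounded[where B = "(1 + \<rho>) / (1 - \<rho>)"])
    fix \<xi> z :: complex assume \<xi>: "norm \<xi> = 1" and z: "norm z = 1"
    have "poisson_kernel (\<phi> (of_real r * \<xi>)) z \<le> (1 + norm (\<phi> (of_real r * \<xi>))) / (1 - norm (\<phi> (of_real r * \<xi>)))"
      by (rule poisson_kernel_le[OF \<phi>1[OF \<xi>] z])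
    also have "\<dots> \<le> (1 + \<rho>) / (1 - \<rho>)" using \<rho>(1,2) \<rho>(3)[OF \<xi>] by (intro frac_le) auto
    finally show "\<bar>poisson_kernel (\<phi> (of_real r * \<xi>)) z\<bar> \<le> (1 + \<rho>) / (1 - \<rho>)"
      using poisson_kernel_nonneg[OF \<phi>1[OF \<xi>], of z] by simp
  qed (use gI in auto)
  then have pair': "integrable (circle_measure \<Otimes>\<^sub>M circle_measure) (\<lambda>(\<xi>, z). poisson_kernel (\<phi> (of_real r * \<xi>)) z * g z)"
    by simp
  have "(AVG \<xi>. norm (f (\<phi> (of_real r * \<xi>))) powr p) \<le>
      (AVG \<xi>. AVG z. poisson_kernel (\<phi> (of_real r * \<xi>)) z * g z)"
  proof (rule integral_mono_AE[OF int])
    show "integrable circle_measure (\<lambda>\<xi>. AVG z. poisson_kernel (\<phi> (of_real r * \<xi>)) z * g z)"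
      using circle2.integrable_fst'[OF pair'] by simp
    show "AE \<xi> in circle_measure. norm (f (\<phi> (of_real r * \<xi>))) powr p \<le> (AVG z. poisson_kernel (\<phi> (of_real r * \<xi>)) z * g z)"
      using AE_circle_measure
    proof eventually_elim
      case (elim \<xi>)
      note n = \<phi>1[OF elim]
      have "norm (AVG z. poisson_kernel (\<phi> (of_real r * \<xi>)) z *\<^sub>R f z) powr p
         \<le> (AVG z. poisson_kernel (\<phi> (of_real r * \<xi>)) z * norm (f z) powr p)"
        using integral_poisson_kernel[OF n] poisson_kernel_nonneg[OF n] integrable_poisson_mult[OF gI n]
        by (intro Jensen_powr_kernel(2)[OF p]) (auto simp: g_def)
      then show ?case unfolding poisson_formula(2)[OF f hf n] g_def .
    qed
  qed
  also have "\<dots> = (AVG z. AVG \<xi>. poisson_kernel (\<phi> (of_real r * \<xi>)) z * g z)"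
    by (rule circle2.Fubini_integral[symmetric, OF pair'])
  also have "\<dots> = (AVG z. poisson_kernel (\<phi> 0) z * g z)"
  proof (rule circle_integral_cong)
    have [measurable]: "g \<in> borel_measurable borel" by (simp add: g_def)
    show "(\<lambda>z. AVG \<xi>. poisson_kernel (\<phi> (of_real r * \<xi>)) z * g z) \<in> borel_measurable borel"
      and "(\<lambda>z. poisson_kernel (\<phi> 0) z * g z) \<in> borel_measurable borel" by measurable
    fix z :: complex assume z: "norm z = 1"
    have n0: "norm (0::complex) < 1" by simp
    note S = poisson_kernel_subordination[OF \<phi> hol self r n0 z]
    have "(AVG \<xi>. poisson_kernel (\<phi> (of_real r * \<xi>)) z) = (AVG \<xi>. poisson_kernel 0 \<xi> * poisson_kernel (\<phi> (of_real r * \<xi>)) z)"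
      by (rule circle_integral_cong) (use poisson_kernel_0 in auto)
    then show "(AVG \<xi>. poisson_kernel (\<phi> (of_real r * \<xi>)) z * g z) = poisson_kernel (\<phi> 0) z * g z"
      using S(2) by simp
  qed
  also have "\<dots> \<le> (AVG z. (1 + norm (\<phi> 0)) / (1 - norm (\<phi> 0)) * g z)"
  proof (rule integral_mono_AE)
    show "AE z in circle_measure. poisson_kernel (\<phi> 0) z * g z \<le> (1 + norm (\<phi> 0)) / (1 - norm (\<phi> 0)) * g z"
      using AE_circle_measure by eventually_elim (intro mult_right_mono poisson_kernel_le \<phi>0; simp add: g_def)
  qed (use integrable_poisson_mult[OF gI \<phi>0] gI in auto)
  finally show "(AVG \<xi>. norm (f (\<phi> (of_real r * \<xi>))) powr p) \<le>
      (1 + norm (\<phi> 0)) / (1 - norm (\<phi> 0)) * (AVG z. norm (f z) powr p)"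
    by (simp add: g_def)
qed

section \<open>Hardy norms and composition operators\<close>

lemma borel_measurable_if_holomorphic:
  assumes hol: "f holomorphic_on ball 0 1" and out: "\<And>z. z \<notin> ball 0 1 \<Longrightarrow> f z = 0"
  shows "f \<in> borel_measurable borel"
proof -
  have "(\<lambda>z. indicator (ball 0 1) z *\<^sub>R f z) \<in> borel_measurable borel"
    by (intro borel_measurable_continuous_on_indicator holomorphic_on_imp_continuous_on hol) simp
  also have "(\<lambda>z. indicator (ball 0 1) z *\<^sub>R f z) = f"
    using out by (auto simp: fun_eq_iff split: split_indicator)
  finally show ?thesis .
qed

lemma hardy_spaceD:
  assumes "f \<in> hardy_space p"
  shows "f holomorphic_on ball 0 1" "\<And>z. z \<notin> ball 0 1 \<Longrightarrow> f z = 0" "f \<in> borel_measurable borel"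
    "bdd_above (radial_mean p f ` {0..<1})"
  using assms borel_measurable_if_holomorphic[of f] unfolding hardy_space_def by auto

lemma radial_mean_nonneg: "0 \<le> radial_mean p f r"
  unfolding radial_mean_def by simp

lemma hardy_norm_nonneg: "0 \<le> hardy_norm p f"
  unfolding hardy_norm_def by simp

lemma radial_mean_le_hardy_norm:
  assumes f: "f \<in> hardy_space p" and p: "0 < p" and r: "0 \<le> r" "r < 1"
  shows "radial_mean p f r \<le> hardy_norm p f powr p"
proof -
  have le: "radial_mean p f r \<le> (SUP r\<in>{0..<1}. radial_mean p f r)"
    using r by (intro cSUP_upper hardy_spaceD(4)[OF f]) auto
  then have "0 \<le> (SUP r\<in>{0..<1}. radial_mean p f r)"
    using radial_mean_nonneg[of p f r] by linarith
  then show ?thesis using le p unfolding hardy_norm_def by (simp add: powr_powr)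
qed

lemma hardy_spaceI:
  assumes p: "0 < p" and c: "0 \<le> c" and hol: "f holomorphic_on ball 0 1"
    and out: "\<And>z. z \<notin> ball 0 1 \<Longrightarrow> f z = 0"
    and le: "\<And>r. 0 \<le> r \<Longrightarrow> r < 1 \<Longrightarrow> radial_mean p f r \<le> c powr p"
  shows "f \<in> hardy_space p" "hardy_norm p f \<le> c"
proof -
  show "f \<in> hardy_space p"
    unfolding hardy_space_def using hol out le by (auto intro!: bdd_aboveI2[of _ _ "c powr p"])
  have "(SUP r\<in>{0..<1}. radial_mean p f r) \<le> c powr p"
    using le by (intro cSUP_least) auto
  moreover have "0 \<le> (SUP r\<in>{0..<1}. radial_mean p f r)"
  proof -
    have "radial_mean p f 0 \<le> (SUP r\<in>{0..<1}. radial_mean p f r)"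
      using le by (intro cSUP_upper) (auto intro!: bdd_aboveI2[of _ _ "c powr p"])
    then show ?thesis using radial_mean_nonneg[of p f 0] by linarith
  qed
  ultimately have "hardy_norm p f \<le> (c powr p) powr (1 / p)"
    unfolding hardy_norm_def using p by (intro powr_mono2) auto
  then show "hardy_norm p f \<le> c" using p c by (simp add: powr_powr)
qed

lemma integrable_radial:
  assumes f: "f \<in> borel_measurable borel" "f holomorphic_on ball 0 1" and p: "0 < p" and r: "0 \<le> r" "r < 1"
  shows "integrable circle_measure (\<lambda>z. norm (f (of_real r * z)) powr p)"
  using f p by (intro integrable_circle_continuous continuous_on_norm_powr continuous_on_self_map_circle[OF f(2) r]) auto

lemma hardy_norm_add:
  assumes q: "1 \<le> q" and f: "f \<in> hardy_space q" and g: "g \<in> hardy_space q"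
  shows "(\<lambda>z. f z + g z) \<in> hardy_space q"
    and "hardy_norm q (\<lambda>z. f z + g z) \<le> hardy_norm q f + hardy_norm q g"
proof -
  note [measurable] = hardy_spaceD(3)[OF f] hardy_spaceD(3)[OF g]
  \<comment> \<open>\<open>Minkowski_powr_bound\<close> asks for positive bounds, and a Hardy norm
    may be 0; the slack \<open>e\<close> is removed at the end.\<close>
  have *: "(\<lambda>z. f z + g z) \<in> hardy_space q \<and> hardy_norm q (\<lambda>z. f z + g z) \<le> (hardy_norm q f + e / 2) + (hardy_norm q g + e / 2)"
    if e: "0 < e" for e
  proof -
    define a where "a = hardy_norm q f + e / 2"
    define b where "b = hardy_norm q g + e / 2"
    have ab: "0 < a" "0 < b" using e hardy_norm_nonneg[of q f] hardy_norm_nonneg[of q g] by (auto simp: a_def b_def add_nonneg_pos)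
    have "radial_mean q (\<lambda>z. f z + g z) r \<le> (a + b) powr q" if r: "0 \<le> r" "r < 1" for r
      unfolding radial_mean_def
    proof (rule Minkowski_powr_bound(2)[OF q ab])
      show "integrable circle_measure (\<lambda>z. norm (f (of_real r * z)) powr q)" "integrable circle_measure (\<lambda>z. norm (g (of_real r * z)) powr q)"
        using q r by (auto intro!: integrable_radial hardy_spaceD(1,3)[OF f] hardy_spaceD(1,3)[OF g])
      have "radial_mean q f r \<le> hardy_norm q f powr q" "radial_mean q g r \<le> hardy_norm q g powr q"
        using q r by (auto intro!: radial_mean_le_hardy_norm f g)
      moreover have "hardy_norm q f powr q \<le> a powr q" "hardy_norm q g powr q \<le> b powr q"
        using q e hardy_norm_nonneg by (auto intro!: powr_mono2 simp: a_def b_def)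
      ultimately show "(AVG z. norm (f (of_real r * z)) powr q) \<le> a powr q" "(AVG z. norm (g (of_real r * z)) powr q) \<le> b powr q"
        unfolding radial_mean_def by linarith+
    qed measurable
    then show ?thesis
      using hardy_spaceI[of q "a + b" "\<lambda>z. f z + g z"] q ab hardy_spaceD(1,2)[OF f] hardy_spaceD(1,2)[OF g]
      by (auto simp: a_def b_def intro!: holomorphic_intros)
  qed
  show "(\<lambda>z. f z + g z) \<in> hardy_space q" using *[of 1] by simp
  show "hardy_norm q (\<lambda>z. f z + g z) \<le> hardy_norm q f + hardy_norm q g"
  proof (rule field_le_epsilon)
    fix e :: real assume "0 < e"
    from conjunct2[OF *[OF this]] show "hardy_norm q (\<lambda>z. f z + g z) \<le> hardy_norm q f + hardy_norm q g + e" by linarith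
  qed
qed

lemma hardy_norm_scale:
  assumes q: "0 < q" and f: "f \<in> hardy_space q"
  shows "(\<lambda>z. c * f z) \<in> hardy_space q" and "hardy_norm q (\<lambda>z. c * f z) \<le> norm c * hardy_norm q f"
proof -
  have "radial_mean q (\<lambda>z. c * f z) r \<le> (norm c * hardy_norm q f) powr q" if r: "0 \<le> r" "r < 1" for r
  proof -
    have "radial_mean q (\<lambda>z. c * f z) r = norm c powr q * radial_mean q f r"
      unfolding radial_mean_def by (simp add: norm_mult powr_mult)
    also have "\<dots> \<le> norm c powr q * hardy_norm q f powr q"
      by (intro mult_left_mono radial_mean_le_hardy_norm f q r) auto
    finally show ?thesis by (simp add: powr_mult hardy_norm_nonneg)
  qed
  then show "(\<lambda>z. c * f z) \<in> hardy_space q" "hardy_norm q (\<lambda>z. c * f z) \<le> norm c * hardy_norm q f"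
    using q hardy_norm_nonneg[of q f] hardy_spaceD(1,2)[OF f]
    by (auto intro!: hardy_spaceI[of q "norm c * hardy_norm q f"] holomorphic_intros)
qed

lemma hardy_norm_diff:
  assumes q: "1 \<le> q" and f: "f \<in> hardy_space q" and g: "g \<in> hardy_space q"
  shows "(\<lambda>z. f z - g z) \<in> hardy_space q"
    and "hardy_norm q (\<lambda>z. f z - g z) \<le> hardy_norm q f + hardy_norm q g"
proof -
  have q0: "0 < q" using q by simp
  note s = hardy_norm_scale[OF q0 g, of "-1"]
  show "(\<lambda>z. f z - g z) \<in> hardy_space q" "hardy_norm q (\<lambda>z. f z - g z) \<le> hardy_norm q f + hardy_norm q g"
    using hardy_norm_add[OF q f s(1)] s(2) by auto
qed

lemma integral_powr_le:
  fixes u :: "complex \<Rightarrow> 'b::{banach, second_countable_topology}"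
  assumes q: "0 < q" "q \<le> p" and [measurable]: "u \<in> borel_measurable borel"
    and I: "integrable circle_measure (\<lambda>z. norm (u z) powr p)"
  shows "integrable circle_measure (\<lambda>z. norm (u z) powr q)"
    and "(AVG z. norm (u z) powr q) \<le> (AVG z. norm (u z) powr p) powr (q / p)"
proof -
  have pq: "1 \<le> p / q" "0 < p" using q by auto
  have eq: "(norm (u z) powr q) powr (p / q) = norm (u z) powr p" for z using q by (simp add: powr_powr)
  note J = Jensen_powr_kernel[of "p / q" "\<lambda>z. norm (u z) powr q" circle_measure "\<lambda>_. 1", OF pq(1)]
  show I2: "integrable circle_measure (\<lambda>z. norm (u z) powr q)"
    using J(1) I circle.prob_space eq by simp
  have "(AVG z. norm (u z) powr q) powr (p / q) \<le> (AVG z. norm (u z) powr p)"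
    using J(2) I circle.prob_space eq by (simp add: abs_of_nonneg)
  then have "((AVG z. norm (u z) powr q) powr (p / q)) powr (q / p) \<le> (AVG z. norm (u z) powr p) powr (q / p)"
    using q by (intro powr_mono2) auto
  then show "(AVG z. norm (u z) powr q) \<le> (AVG z. norm (u z) powr p) powr (q / p)"
    using q by (simp add: powr_powr)
qed

lemma hardy_norm_mono:
  assumes q: "0 < q" "q \<le> p" and f: "f \<in> hardy_space p"
  shows "f \<in> hardy_space q" "hardy_norm q f \<le> hardy_norm p f"
proof -
  note [measurable] = hardy_spaceD(3)[OF f]
  have "radial_mean q f r \<le> hardy_norm p f powr q" if r: "0 \<le> r" "r < 1" for r
  proof -
    have "radial_mean q f r \<le> radial_mean p f r powr (q / p)"
      unfolding radial_mean_def using q r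
      by (intro integral_powr_le(2) integrable_radial hardy_spaceD(1,3)[OF f]) auto
    also have "\<dots> \<le> (hardy_norm p f powr p) powr (q / p)"
      using q r by (intro powr_mono2 radial_mean_le_hardy_norm f radial_mean_nonneg) auto
    finally show ?thesis using q by (simp add: powr_powr)
  qed
  then show "f \<in> hardy_space q" "hardy_norm q f \<le> hardy_norm p f"
    using q hardy_norm_nonneg[of p f] hardy_spaceD(1,2)[OF f]
    by (auto intro!: hardy_spaceI[of q "hardy_norm p f"])
qed

text \<open>Leads from the dilates of \<open>f\<close>, to which subordination applies, back to
  \<open>f\<close> itself. The radius \<open>r < 1\<close> keeps \<open>\<phi> (r * \<xi>)\<close>
  in a compact disc, where \<open>f\<close> is bounded; hence dominated convergence.\<close>

lemma radial_mean_dilation_limit: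
  assumes f [measurable]: "f \<in> borel_measurable borel" and hf: "f holomorphic_on ball 0 1"
    and \<phi> [measurable]: "\<phi> \<in> borel_measurable borel" and hol: "\<phi> holomorphic_on ball 0 1"
    and self: "\<phi> ` ball 0 1 \<subseteq> ball 0 1" and p: "0 < p" and r: "0 \<le> r" "r < 1"
    and Rn: "\<And>n. 0 \<le> Rn n" "\<And>n. Rn n \<le> 1" "Rn \<longlonglongrightarrow> 1"
  shows "(\<lambda>n. AVG \<xi>. norm (f (of_real (Rn n) * \<phi> (of_real r * \<xi>))) powr p) \<longlonglongrightarrow>
     (AVG \<xi>. norm (f (\<phi> (of_real r * \<xi>))) powr p)"
proof -
  obtain \<rho> where \<rho>: "0 \<le> \<rho>" "\<rho> < 1" "\<And>\<xi>. norm \<xi> = 1 \<Longrightarrow> norm (\<phi> (of_real r * \<xi>)) \<le> \<rho>"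
    using self_map_circle[OF hol self r] by blast
  have cf: "continuous_on (ball 0 1) f" by (rule holomorphic_on_imp_continuous_on[OF hf])
  have "compact (f ` cball 0 \<rho>)"
    using \<rho> by (intro compact_continuous_image continuous_on_subset[OF cf]) auto
  from compact_imp_bounded[OF this] obtain B where B: "\<And>z. norm z \<le> \<rho> \<Longrightarrow> norm (f z) \<le> B"
    unfolding bounded_iff by fastforce
  show ?thesis
  proof (rule integral_dominated_convergence[where w = "\<lambda>_. B powr p"])
    show "AE \<xi> in circle_measure. (\<lambda>n. norm (f (of_real (Rn n) * \<phi> (of_real r * \<xi>))) powr p) \<longlonglongrightarrow> norm (f (\<phi> (of_real r * \<xi>))) powr p"
      using AE_circle_measure
    proof eventually_elim
      case (elim \<xi>)
      have "isCont f (\<phi> (of_real r * \<xi>))"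
        using cf \<rho>(2) \<rho>(3)[OF elim] by (simp add: continuous_on_eq_continuous_at)
      moreover have "(\<lambda>n. of_real (Rn n) * \<phi> (of_real r * \<xi>)) \<longlonglongrightarrow> of_real 1 * \<phi> (of_real r * \<xi>)"
        by (intro tendsto_intros Rn)
      ultimately have "(\<lambda>n. f (of_real (Rn n) * \<phi> (of_real r * \<xi>))) \<longlonglongrightarrow> f (\<phi> (of_real r * \<xi>))"
        unfolding of_real_1 mult_1 by (intro isCont_tendsto_compose[of _ f])
      then show ?case using p by (intro tendsto_powr' tendsto_norm tendsto_const) auto
    qed
    show "AE \<xi> in circle_measure. norm (norm (f (of_real (Rn n) * \<phi> (of_real r * \<xi>))) powr p) \<le> B powr p" for n
      using AE_circle_measure
    proof eventually_elim
      case (elim \<xi>)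
      have "Rn n * norm (\<phi> (of_real r * \<xi>)) \<le> 1 * \<rho>"
        using Rn(1,2)[of n] \<rho>(3)[OF elim] by (intro mult_mono) auto
      then have "norm (f (of_real (Rn n) * \<phi> (of_real r * \<xi>))) \<le> B"
        using Rn(1)[of n] by (intro B) (simp add: norm_mult)
      then show ?case using p by (simp add: powr_mono2)
    qed
  qed auto
qed

text \<open>One fixed sequence, so that boundary values are limits of sequences of measurable
  functions. The offset 2 keeps also the first radius positive.\<close>

definition dilation_radius :: "nat \<Rightarrow> real" where "dilation_radius n = 1 - 1 / real (n + 2)"

lemma dilation_radius: "0 < dilation_radius n" "dilation_radius n < 1" "dilation_radius \<longlonglongrightarrow> 1"
proof -
  show "0 < dilation_radius n" "dilation_radius n < 1" by (auto simp: dilation_radius_def field_simps)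
  have "(\<lambda>n. 1 - 1 / real (n + 2)) \<longlonglongrightarrow> 1 - 0"
    by (intro tendsto_intros LIMSEQ_ignore_initial_segment[OF lim_const_over_n])
  then show "dilation_radius \<longlonglongrightarrow> 1" by (simp add: dilation_radius_def[abs_def])
qed

lemma hardy_norm_composition:
  assumes f: "f \<in> hardy_space p" and p: "1 \<le> p"
    and \<phi> [measurable]: "\<phi> \<in> borel_measurable borel" and hol: "\<phi> holomorphic_on ball 0 1"
    and self: "\<phi> ` ball 0 1 \<subseteq> ball 0 1"
  shows "composition_operator \<phi> f \<in> hardy_space p"
    and "hardy_norm p (composition_operator \<phi> f) \<le> ((1 + norm (\<phi> 0)) / (1 - norm (\<phi> 0))) powr (1 / p) * hardy_norm p f"
proof -
  note [measurable] = hardy_spaceD(3)[OF f]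
  let ?C = "(1 + norm (\<phi> 0)) / (1 - norm (\<phi> 0))"
  have \<phi>0: "norm (\<phi> 0) < 1" using self by (auto simp: image_subset_iff)
  then have C: "0 \<le> ?C" by simp
  have holc: "composition_operator \<phi> f holomorphic_on ball 0 1"
  proof -
    have "(f \<circ> \<phi>) holomorphic_on ball 0 1"
      by (rule holomorphic_on_compose_gen[OF hol hardy_spaceD(1)[OF f] self])
    then show ?thesis by (rule holomorphic_transform) (simp add: composition_operator_def)
  qed
  have "radial_mean p (composition_operator \<phi> f) r \<le> (?C powr (1 / p) * hardy_norm p f) powr p" if r: "0 \<le> r" "r < 1" for r
  proof -
    have "radial_mean p (composition_operator \<phi> f) r = (AVG \<xi>. norm (f (\<phi> (of_real r * \<xi>))) powr p)"
      unfolding radial_mean_def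
    proof (rule circle_integral_cong)
      have [measurable]: "composition_operator \<phi> f \<in> borel_measurable borel"
        by (rule borel_measurable_if_holomorphic[OF holc]) (simp add: composition_operator_def)
      show "(\<lambda>z. norm (composition_operator \<phi> f (of_real r * z)) powr p) \<in> borel_measurable borel" by measurable
    qed (use r in \<open>auto simp: composition_operator_def norm_mult\<close>)
    also have "\<dots> \<le> ?C * hardy_norm p f powr p"
    proof (rule LIMSEQ_le_const2)
      show "(\<lambda>n. AVG \<xi>. norm (f (of_real (dilation_radius n) * \<phi> (of_real r * \<xi>))) powr p) \<longlonglongrightarrow>
         (AVG \<xi>. norm (f (\<phi> (of_real r * \<xi>))) powr p)"
        using p r dilation_radius
        by (intro radial_mean_dilation_limit \<phi> hol self hardy_spaceD(1,3)[OF f]) (auto intro: less_imp_le)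
      have "(AVG \<xi>. norm (f (of_real (dilation_radius n) * \<phi> (of_real r * \<xi>))) powr p) \<le> ?C * hardy_norm p f powr p" for n
      proof -
        note R = dilation_radius(1,2)[of n]
        have "(AVG \<xi>. norm (f (of_real (dilation_radius n) * \<phi> (of_real r * \<xi>))) powr p) \<le>
          ?C * (AVG z. norm (f (of_real (dilation_radius n) * z)) powr p)"
          by (rule Littlewood_subordination(2)[OF _ holomorphic_dilation[OF hardy_spaceD(1)[OF f] R] \<phi> hol self p r]) measurable
        also have "\<dots> = ?C * radial_mean p f (dilation_radius n)" by (simp add: radial_mean_def)
        also have "\<dots> \<le> ?C * hardy_norm p f powr p"
          using R p by (intro mult_left_mono radial_mean_le_hardy_norm f C) auto
        finally show ?thesis .
      qed
      then show "\<exists>N. \<forall>n\<ge>N. (AVG \<xi>. norm (f (of_real (dilation_radius n) * \<phi> (of_real r * \<xi>))) powr p) \<le> ?C * hardy_norm p f powr p" by blast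
    qed
    also have "\<dots> = (?C powr (1 / p) * hardy_norm p f) powr p"
    proof -
      have "c * h powr p = (c powr (1 / p) * h) powr p" if "0 \<le> c" "0 \<le> h" for c h :: real
        using p that by (simp add: powr_mult powr_powr)
      then show ?thesis using C hardy_norm_nonneg[of p f] by blast
    qed
    finally show ?thesis .
  qed
  then show "composition_operator \<phi> f \<in> hardy_space p" "hardy_norm p (composition_operator \<phi> f) \<le> ?C powr (1 / p) * hardy_norm p f"
    using p hardy_norm_nonneg[of p f] holc
    by (auto intro!: hardy_spaceI[of p "?C powr (1 / p) * hardy_norm p f"] simp: composition_operator_def)
qed

lemma bounded_composition_operator:
  assumes "1 \<le> q" "q \<le> p" "\<phi> \<in> borel_measurable borel" "\<phi> holomorphic_on ball 0 1" "\<phi> ` ball 0 1 \<subseteq> ball 0 1"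
  shows "bounded_operator p q (composition_operator \<phi>)"
proof -
  have p: "1 \<le> p" "0 < q" using assms by auto
  note H = hardy_norm_composition[OF _ p(1) assms(3-5)]
  have "composition_operator \<phi> f \<in> hardy_space q" "hardy_norm q (composition_operator \<phi> f) \<le> hardy_norm p (composition_operator \<phi> f)"
    if "f \<in> hardy_space p" for f
    using hardy_norm_mono[OF p(2) assms(2) H(1)[OF that]] by auto
  with H(2) have "\<exists>C. \<forall>f\<in>hardy_space p. hardy_norm q (composition_operator \<phi> f) \<le> C * hardy_norm p f"
    by (meson order_trans)
  moreover have "linear_operator p q (composition_operator \<phi>)"
    unfolding linear_operator_def using \<open>\<And>f. f \<in> hardy_space p \<Longrightarrow> composition_operator \<phi> f \<in> hardy_space q\<close>
    by (simp add: composition_operator_def fun_eq_iff)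
  ultimately show ?thesis unfolding bounded_operator_def by blast
qed

section \<open>Pointwise estimates in the disc\<close>

lemma norm_one_minus_ge:
  assumes "norm w \<le> t" "norm z = 1"
  shows "1 - t \<le> norm (1 - w * cnj z)"
  using norm_triangle_ineq2[of 1 "w * cnj z"] assms by (simp add: norm_mult)

text \<open>A crude consequence of Cauchy's formula that suffices for local uniform boundedness, as
  wanted by Montel's theorem.\<close>

lemma disc_point_bound:
  assumes f [measurable]: "f \<in> borel_measurable borel" and hf: "f holomorphic_on ball 0 R" "1 < R" and w: "norm w < 1"
  shows "norm (f w) \<le> (AVG z. norm (f z)) / (1 - norm w)"
proof -
  note C = Cauchy_formula_circle[OF f hf w]
  have fI: "integrable circle_measure f"
    by (rule integrable_circle_continuous[OF f holomorphic_continuous_on_sphere[OF hf]])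
  have "norm (f w) \<le> (AVG z. norm (f z / (1 - w * cnj z)))"
    unfolding C(2)[symmetric] by (rule integral_norm_bound)
  also have "\<dots> \<le> (AVG z. norm (f z) / (1 - norm w))"
  proof (rule integral_mono_AE)
    show "AE z in circle_measure. norm (f z / (1 - w * cnj z)) \<le> norm (f z) / (1 - norm w)"
      using AE_circle_measure
    proof eventually_elim
      case (elim z)
      show ?case unfolding norm_divide using norm_one_minus_ge[OF order_refl elim, of w] w by (intro frac_le) auto
    qed
  qed (use C(1) fI in auto)
  finally show ?thesis by simp
qed

text \<open>The difference of the Cauchy kernels at \<open>w\<close> and \<open>\<rho> * w\<close>
  has the factor \<open>1 - \<rho>\<close>. The estimate involves \<open>f\<close> only through its
  L^1 norm, which makes it uniform over the unit ball.\<close>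

lemma disc_dilation_bound:
  assumes f [measurable]: "f \<in> borel_measurable borel" and hf: "f holomorphic_on ball 0 R" "1 < R"
    and w: "norm w \<le> t" "t < 1" and \<rho>: "0 \<le> \<rho>" "\<rho> \<le> 1"
  shows "norm (f w - f (of_real \<rho> * w)) \<le> (1 - \<rho>) / (1 - t)\<^sup>2 * (AVG z. norm (f z))"
proof -
  have w1: "norm w < 1" using w by simp
  have w2': "norm (of_real \<rho> * w) \<le> t"
    using w \<rho> mult_mono[of \<rho> 1 "norm w" t] by (simp add: norm_mult)
  then have w2: "norm (of_real \<rho> * w) < 1" using w by simp
  note C1 = Cauchy_formula_circle[OF f hf w1]
  note C2 = Cauchy_formula_circle[OF f hf w2]
  have fI: "integrable circle_measure f"
    by (rule integrable_circle_continuous[OF f holomorphic_continuous_on_sphere[OF hf]])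
  let ?d = "\<lambda>z. f z / (1 - w * cnj z) - f z / (1 - of_real \<rho> * w * cnj z)"
  have eq: "f w - f (of_real \<rho> * w) = (AVG z. ?d z)"
    unfolding Bochner_Integration.integral_diff[OF C1(1) C2(1)] C1(2) C2(2) ..
  have "norm (f w - f (of_real \<rho> * w)) \<le> (AVG z. norm (?d z))"
    unfolding eq by (rule integral_norm_bound)
  also have "\<dots> \<le> (AVG z. (1 - \<rho>) / (1 - t)\<^sup>2 * norm (f z))"
  proof (rule integral_mono_AE)
    show "integrable circle_measure (\<lambda>z. norm (?d z))"
      by (intro integrable_norm Bochner_Integration.integrable_diff C1(1) C2(1))
    show "AE z in circle_measure. norm (?d z) \<le> (1 - \<rho>) / (1 - t)\<^sup>2 * norm (f z)"
      using AE_circle_measure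
    proof eventually_elim
      case (elim z)
      have t0: "0 \<le> t" using w by (meson norm_ge_zero order_trans)
      have nz: "1 - w * cnj z \<noteq> 0" "1 - of_real \<rho> * w * cnj z \<noteq> 0"
        using one_minus_cnj_nonzero[OF w1 elim] one_minus_cnj_nonzero[OF w2 elim] by auto
      have "?d z = f z * (w * cnj z * of_real (1 - \<rho>)) / ((1 - w * cnj z) * (1 - of_real \<rho> * w * cnj z))"
        using nz by (simp add: field_simps)
      then have "norm (?d z) = norm (f z) * (norm w * (1 - \<rho>)) / (norm (1 - w * cnj z) * norm (1 - of_real \<rho> * w * cnj z))"
        using elim \<rho> by (simp add: norm_divide norm_mult del: of_real_diff)
      also have "\<dots> \<le> norm (f z) * (1 * (1 - \<rho>)) / ((1 - t) * (1 - t))"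
        using norm_one_minus_ge[OF w(1) elim] norm_one_minus_ge[OF w2' elim] w w1 \<rho> t0
        by (intro frac_le mult_left_mono mult_right_mono mult_mono mult_nonneg_nonneg mult_pos_pos) auto
      finally show ?case by (simp add: power2_eq_square mult.commute)
    qed
  qed (use fI in auto)
  finally show ?thesis by simp
qed

lemma hardy_point_bound:
  assumes f: "f \<in> hardy_space p" and p: "1 \<le> p" and w: "norm w < 1"
  shows "norm (f w) \<le> hardy_norm p f / (1 - norm w)"
proof (rule LIMSEQ_le_const2)
  note [measurable] = hardy_spaceD(3)[OF f]
  have "isCont f w"
    using holomorphic_on_imp_continuous_on[OF hardy_spaceD(1)[OF f]] w by (simp add: continuous_on_eq_continuous_at)
  moreover have "(\<lambda>n. of_real (dilation_radius n) * w) \<longlonglongrightarrow> of_real 1 * w"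
    by (intro tendsto_intros dilation_radius)
  ultimately show "(\<lambda>n. norm (f (of_real (dilation_radius n) * w))) \<longlonglongrightarrow> norm (f w)"
    unfolding of_real_1 mult_1 by (intro tendsto_norm isCont_tendsto_compose[of w f])
  have "norm (f (of_real (dilation_radius n) * w)) \<le> hardy_norm p f / (1 - norm w)" for n
  proof -
    note R = dilation_radius(1,2)[of n]
    have "norm (f (of_real (dilation_radius n) * w)) \<le> (AVG z. norm (f (of_real (dilation_radius n) * z))) / (1 - norm w)"
      by (rule disc_point_bound[OF _ holomorphic_dilation[OF hardy_spaceD(1)[OF f] R] w]) measurable
    also have "(AVG z. norm (f (of_real (dilation_radius n) * z))) = radial_mean 1 f (dilation_radius n)"
      by (simp add: radial_mean_def)
    also have "\<dots> \<le> hardy_norm 1 f powr 1"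
      by (rule radial_mean_le_hardy_norm[OF hardy_norm_mono(1)[OF _ p f]]) (use R in auto)
    also have "\<dots> \<le> hardy_norm p f" using hardy_norm_mono(2)[OF _ p f] hardy_norm_nonneg[of 1 f] by simp
    finally show ?thesis using w by (simp add: divide_right_mono)
  qed
  then show "\<exists>N. \<forall>n\<ge>N. norm (f (of_real (dilation_radius n) * w)) \<le> hardy_norm p f / (1 - norm w)" by blast
qed

section \<open>The push-forward of the contact set\<close>

lemma real_polynomial_on_circle:
  assumes "real_polynomial_function P"
  shows "\<exists>n Q. Q holomorphic_on UNIV \<and> (\<forall>z. norm z = 1 \<longrightarrow> z ^ n * of_real (P z) = (Q z :: complex))"
  using assms
proof induction
  case (linear f)
  interpret bounded_linear f by fact
  define Q where "Q = (\<lambda>z. (z\<^sup>2 + 1) / 2 * of_real (f 1) + (z\<^sup>2 - 1) / (2 * \<i>) * of_real (f \<i>))"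
  have "z ^ 1 * of_real (f z) = Q z" if z: "norm z = 1" for z
  proof -
    have zz: "z * cnj z = 1" using z by (simp add: complex_norm_square[symmetric])
    have "z = Re z *\<^sub>R 1 + Im z *\<^sub>R \<i>" by (simp add: complex_eq_iff)
    then have f: "f z = Re z * f 1 + Im z * f \<i>" by (metis add scaleR real_scaleR_def)
    \<comment> \<open>On the circle \<open>cnj z = 1 / z\<close>, hence
      \<open>Re z = (z + 1 / z) / 2\<close>, and one factor \<open>z\<close> suffices; likewise for
      \<open>Im z\<close>.\<close>
    have re: "z * of_real (Re z) = (z\<^sup>2 + 1) / 2"
    proof -
      have "z * (z + cnj z) = z\<^sup>2 + 1" using zz by (simp add: distrib_left power2_eq_square)
      then show ?thesis unfolding complex_add_cnj by (simp add: mult_ac)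
    qed
    have im: "z * of_real (Im z) = (z\<^sup>2 - 1) / (2 * \<i>)"
    proof -
      have "z * (z - cnj z) = z\<^sup>2 - 1" using zz by (simp add: right_diff_distrib power2_eq_square)
      then have "z * of_real (Im z) * (2 * \<i>) = z\<^sup>2 - 1" unfolding complex_diff_cnj by (simp add: mult_ac)
      moreover have "2 * \<i> \<noteq> (0::complex)" by simp
      ultimately show ?thesis by (metis nonzero_eq_divide_eq)
    qed
    show ?thesis unfolding f Q_def re[symmetric] im[symmetric] by (simp add: algebra_simps)
  qed
  moreover have "Q holomorphic_on UNIV" unfolding Q_def by (intro holomorphic_intros) auto
  ultimately show ?case by blast
next
  case (const c)
  show ?case by (rule exI[of _ 0], rule exI[of _ "\<lambda>_. of_real c"]) auto
next
  case (add f g)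
  then obtain n Q m S where Q: "Q holomorphic_on UNIV" "\<And>z. norm z = 1 \<Longrightarrow> z ^ n * of_real (f z) = (Q z :: complex)"
    and S: "S holomorphic_on UNIV" "\<And>z. norm z = 1 \<Longrightarrow> z ^ m * of_real (g z) = (S z :: complex)" by blast
  have "z ^ (n + m) * of_real (f z + g z) = z ^ m * Q z + z ^ n * S z" if "norm z = 1" for z
    using Q(2)[OF that, symmetric] S(2)[OF that, symmetric] by (simp add: power_add algebra_simps)
  moreover have "(\<lambda>z. z ^ m * Q z + z ^ n * S z) holomorphic_on UNIV" by (intro holomorphic_intros Q S)
  ultimately show ?case by blast
next
  case (mult f g)
  then obtain n Q m S where Q: "Q holomorphic_on UNIV" "\<And>z. norm z = 1 \<Longrightarrow> z ^ n * of_real (f z) = (Q z :: complex)"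
    and S: "S holomorphic_on UNIV" "\<And>z. norm z = 1 \<Longrightarrow> z ^ m * of_real (g z) = (S z :: complex)" by blast
  have "z ^ (n + m) * of_real (f z * g z) = Q z * S z" if "norm z = 1" for z
    using Q(2)[OF that, symmetric] S(2)[OF that, symmetric] by (simp add: power_add algebra_simps)
  moreover have "(\<lambda>z. Q z * S z) holomorphic_on UNIV" by (intro holomorphic_intros Q S)
  ultimately show ?case by blast
qed

text \<open>On the circle a trigonometric polynomial has the modulus of an analytic polynomial, because
  multiplication by \<open>z\<^sup>n\<close> removes the negative powers of \<open>z\<close>.\<close>

lemma continuous_modulus_approx:
  fixes g :: "complex \<Rightarrow> real"
  assumes g: "continuous_on (sphere 0 1) g" "\<And>z. norm z = 1 \<Longrightarrow> 0 \<le> g z" and e: "0 < e"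
  shows "\<exists>f. f holomorphic_on UNIV \<and> (\<forall>z. norm z = 1 \<longrightarrow> \<bar>norm (f z) - g z\<bar> < e)"
proof -
  obtain P where P: "real_polynomial_function P" "\<And>z. z \<in> sphere 0 1 \<Longrightarrow> \<bar>g z - P z\<bar> < e"
    using Stone_Weierstrass_real_polynomial_function[OF compact_sphere g(1) e] by blast
  obtain n Q where Q: "Q holomorphic_on UNIV" "\<And>z. norm z = 1 \<Longrightarrow> z ^ n * of_real (P z) = (Q z :: complex)"
    using real_polynomial_on_circle[OF P(1)] by blast
  have "\<bar>norm (Q z) - g z\<bar> < e" if z: "norm z = 1" for z
  proof -
    have "norm (Q z) = \<bar>P z\<bar>" using z by (simp flip: Q(2)[OF z] add: norm_mult norm_power)
    then show ?thesis using P(2)[of z] g(2)[OF z] z by auto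
  qed
  with Q(1) show ?thesis by blast
qed

lemma borel_measurable_entire: "f holomorphic_on UNIV \<Longrightarrow> f \<in> borel_measurable borel"
  by (intro borel_measurable_continuous_onI holomorphic_on_imp_continuous_on)

definition compact_bump :: "complex set \<Rightarrow> nat \<Rightarrow> complex \<Rightarrow> real" where
  "compact_bump K n z = max 0 (1 - real n * infdist z K)"

text \<open>The empty set has to be excluded: \<open>infdist z {} = 0\<close> would make its bump
  constantly 1.\<close>

lemma compact_bump:
  assumes "compact K" "K \<noteq> {}"
  shows "continuous_on UNIV (compact_bump K n)" "0 \<le> compact_bump K n z" "compact_bump K n z \<le> 1"
    and "(\<lambda>n. compact_bump K n z) \<longlonglongrightarrow> indicator K z"
proof -
  show "continuous_on UNIV (compact_bump K n)" unfolding compact_bump_def[abs_def]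
    by (intro continuous_intros)
  show "0 \<le> compact_bump K n z" "compact_bump K n z \<le> 1"
    unfolding compact_bump_def using infdist_nonneg[of z K] by auto
  show "(\<lambda>n. compact_bump K n z) \<longlonglongrightarrow> indicator K z"
  proof (cases "z \<in> K")
    case True
    then show ?thesis by (simp add: compact_bump_def)
  next
    case False
    then have d: "0 < infdist z K"
      using in_closed_iff_infdist_zero[OF compact_imp_closed[OF assms(1)] assms(2)] infdist_nonneg[of z K] by force
    obtain N :: nat where N: "1 / infdist z K < real N" using reals_Archimedean2 by blast
    have "compact_bump K n z = 0" if "N \<le> n" for n
    proof -
      have "1 < real N * infdist z K" using N d by (simp add: field_simps)
      also have "\<dots> \<le> real n * infdist z K" using that d by (intro mult_right_mono) auto
      finally show ?thesis by (simp add: compact_bump_def)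
    qed
    then have "eventually (\<lambda>n. compact_bump K n z = indicator K z) sequentially"
      unfolding eventually_sequentially using False by auto
    then show ?thesis by (rule tendsto_eventually)
  qed
qed

lemma compact_modulus_approx:
  assumes K: "compact K" "K \<noteq> {}"
  shows "\<exists>f :: nat \<Rightarrow> complex \<Rightarrow> complex. (\<forall>n. f n holomorphic_on UNIV) \<and>
    (\<forall>z. norm z = 1 \<longrightarrow> (\<lambda>n. norm (f n z)) \<longlonglongrightarrow> indicator K z \<and> (\<forall>n. norm (f n z) \<le> 2))"
proof -
  have "\<exists>f. f holomorphic_on UNIV \<and> (\<forall>z. norm z = 1 \<longrightarrow> \<bar>norm (f z) - compact_bump K n z\<bar> < 1 / real (Suc n))" for n
    by (rule continuous_modulus_approx) (use compact_bump[OF K] in \<open>auto intro: continuous_on_subset\<close>)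
  then obtain f where f: "\<And>n. f n holomorphic_on UNIV"
    "\<And>n z. norm z = 1 \<Longrightarrow> \<bar>norm (f n z) - compact_bump K n z\<bar> < 1 / real (Suc n)" by metis
  have "(\<lambda>n. norm (f n z)) \<longlonglongrightarrow> indicator K z \<and> (\<forall>n. norm (f n z) \<le> 2)" if z: "norm z = 1" for z
  proof
    have "(\<lambda>n. norm (f n z) - compact_bump K n z) \<longlonglongrightarrow> 0"
    proof (rule Lim_null_comparison)
      show "(\<lambda>n. 1 / real (Suc n)) \<longlonglongrightarrow> 0" by (rule LIMSEQ_Suc[OF lim_1_over_n])
      show "\<forall>\<^sub>F n in sequentially. norm (norm (f n z) - compact_bump K n z) \<le> 1 / real (Suc n)"
        using f(2)[OF z] by (intro always_eventually allI) (simp add: less_imp_le del: of_nat_Suc)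
    qed
    from tendsto_add[OF this compact_bump(4)[OF K, of z]] show "(\<lambda>n. norm (f n z)) \<longlonglongrightarrow> indicator K z" by simp
    show "\<forall>n. norm (f n z) \<le> 2"
    proof
      fix n
      have "1 / real (Suc n) \<le> 1" by simp
      then show "norm (f n z) \<le> 2" using f(2)[OF z, of n] compact_bump(3)[OF K, of n z] by linarith
    qed
  qed
  with f(1) show ?thesis by blast
qed

text \<open>Only indicators require work: inner regularity replaces the set by a compact subset,
  whose bumps converge to its indicator in L^1.\<close>

lemma continuous_L1_dense:
  fixes u :: "complex \<Rightarrow> real"
  assumes "integrable circle_measure u"
  shows "\<forall>e>0. \<exists>k. continuous_on UNIV k \<and> (AVG z. \<bar>u z - k z\<bar>) < e"
  using assms
proof (induction rule: integrable_induct)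
  case (base A c)
  show ?case
  proof (intro allI impI)
    fix e :: real assume e: "0 < e"
    show "\<exists>k. continuous_on UNIV k \<and> (AVG z. \<bar>indicator A z *\<^sub>R c - k z\<bar>) < e"
    proof (cases "A = {} \<or> c = 0 \<or> measure circle_measure A = 0")
      case True
      have "AE z in circle_measure. indicator A z *\<^sub>R c = 0"
      proof (cases "measure circle_measure A = 0")
        case True
        then have "A \<in> null_sets circle_measure" using base by (intro null_setsI) (auto simp: circle.emeasure_eq_measure)
        then have "AE z in circle_measure. z \<notin> A" by (rule AE_not_in)
        then show ?thesis by eventually_elim auto
      qed (use True in auto)
      then have "(AVG z. \<bar>indicator A z *\<^sub>R c - 0\<bar>) = 0"
        by (intro integral_eq_zero_AE) (auto elim!: eventually_mono)
      then show ?thesis using e by (intro exI[of _ "\<lambda>_. 0"]) auto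
    next
      case False
      \<comment> \<open>Two errors below \<open>d\<close>, from inner regularity and from the bump,
        are each multiplied by \<open>|c|\<close>.\<close>
      define d where "d = e / (2 * \<bar>c\<bar>)"
      have d: "0 < d" using False e by (simp add: d_def)
      have Am [measurable]: "A \<in> sets borel" using base by simp
      have "\<exists>K. K \<subseteq> A \<and> compact K \<and> K \<noteq> {} \<and> measure circle_measure A - measure circle_measure K < d"
      proof -
        \<comment> \<open>Capped by the measure of \<open>A\<close>, so that the lower bound for the
          measure of \<open>K\<close> is nonnegative and \<open>K\<close> is nonempty.\<close>
        define d' where "d' = min d (measure circle_measure A)"
        have d': "0 < d'" "d' \<le> d" "d' \<le> measure circle_measure A"
          using d False measure_nonneg[of circle_measure A] by (auto simp: d'_def order_less_le)
        have "emeasure circle_measure A = (SUP K\<in>{K. K \<subseteq> A \<and> compact K}. emeasure circle_measure K)"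
          by (rule inner_regular) (auto simp: circle.emeasure_eq_measure)
        moreover have "ennreal (measure circle_measure A - d') < emeasure circle_measure A"
          using d' by (simp add: circle.emeasure_eq_measure ennreal_less_iff)
        ultimately obtain K where K: "K \<subseteq> A" "compact K" "ennreal (measure circle_measure A - d') < emeasure circle_measure K"
          by (auto simp: less_SUP_iff)
        then have "measure circle_measure A - d' < measure circle_measure K"
          using d' by (simp add: circle.emeasure_eq_measure ennreal_less_iff)
        moreover from this have "K \<noteq> {}" using d' by auto
        ultimately show ?thesis using K d' by (intro exI[of _ K]) auto
      qed
      then obtain K where K: "K \<subseteq> A" "compact K" "K \<noteq> {}" "measure circle_measure A - measure circle_measure K < d" by blast
      have Km [measurable]: "K \<in> sets borel" using K by (simp add: borel_compact)
      have bm [measurable]: "compact_bump K n \<in> borel_measurable borel" for n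
        using compact_bump(1)[OF K(2,3)] by (rule borel_measurable_continuous_onI)
      have "(\<lambda>n. AVG z. \<bar>indicator K z - compact_bump K n z\<bar>) \<longlonglongrightarrow> (AVG z. \<bar>indicator K z - indicator K z\<bar>)"
      proof (rule integral_dominated_convergence[where w = "\<lambda>_. 1"])
        show "AE z in circle_measure. (\<lambda>n. \<bar>indicator K z - compact_bump K n z\<bar>) \<longlonglongrightarrow> \<bar>indicator K z - indicator K z\<bar>"
          by (intro AE_I2 tendsto_intros compact_bump(4)[OF K(2,3)])
        show "AE z in circle_measure. norm \<bar>indicator K z - compact_bump K n z\<bar> \<le> 1" for n
        proof (rule AE_I2)
          fix z show "norm \<bar>indicator K z - compact_bump K n z\<bar> \<le> 1"
            using compact_bump(2,3)[OF K(2,3), of n z] by (auto split: split_indicator)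
        qed
      qed auto
      then have "eventually (\<lambda>n. (AVG z. \<bar>indicator K z - compact_bump K n z\<bar>) < d) sequentially"
        using d by (intro order_tendstoD(2)[where y = 0]) auto
      then obtain n where n: "(AVG z. \<bar>indicator K z - compact_bump K n z\<bar>) < d"
        by (auto simp: eventually_sequentially)
      have bI: "integrable circle_measure (\<lambda>z. \<bar>indicator K z - compact_bump K n z\<bar>)"
        by (rule integrable_circle_bounded[where B = 1])
           (use compact_bump(2,3)[OF K(2,3), of n] in \<open>auto split: split_indicator\<close>)
      have AI: "integrable circle_measure (\<lambda>z. indicator A z - indicator K z :: real)"
        by (auto simp: circle.emeasure_eq_measure)
      have "(AVG z. \<bar>indicator A z *\<^sub>R c - c * compact_bump K n z\<bar>) \<le>
         (AVG z. \<bar>c\<bar> * ((indicator A z - indicator K z) + \<bar>indicator K z - compact_bump K n z\<bar>))"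
      proof (rule integral_mono)
        show "integrable circle_measure (\<lambda>z. \<bar>indicator A z *\<^sub>R c - c * compact_bump K n z\<bar>)"
        proof (rule integrable_circle_bounded[where B = "\<bar>c\<bar>"])
          fix z :: complex
          have "indicator A z *\<^sub>R c - c * compact_bump K n z = c * (indicator A z - compact_bump K n z)" by (simp add: algebra_simps)
          then have "\<bar>indicator A z *\<^sub>R c - c * compact_bump K n z\<bar> = \<bar>c\<bar> * \<bar>indicator A z - compact_bump K n z\<bar>" by (simp add: abs_mult)
          also have "\<dots> \<le> \<bar>c\<bar> * 1" using compact_bump(2,3)[OF K(2,3), of n z]
            by (intro mult_left_mono) (auto split: split_indicator)
          finally show "norm \<bar>indicator A z *\<^sub>R c - c * compact_bump K n z\<bar> \<le> \<bar>c\<bar>" by simp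
        qed measurable
        fix z :: complex
        have "indicator A z *\<^sub>R c - c * compact_bump K n z = c * (indicator A z - compact_bump K n z)" by (simp add: algebra_simps)
        then have "\<bar>indicator A z *\<^sub>R c - c * compact_bump K n z\<bar> = \<bar>c\<bar> * \<bar>indicator A z - compact_bump K n z\<bar>" by (simp add: abs_mult)
        also have "\<dots> \<le> \<bar>c\<bar> * ((indicator A z - indicator K z) + \<bar>indicator K z - compact_bump K n z\<bar>)"
          using K(1) by (intro mult_left_mono) (auto split: split_indicator)
        finally show "\<bar>indicator A z *\<^sub>R c - c * compact_bump K n z\<bar> \<le> \<bar>c\<bar> * ((indicator A z - indicator K z) + \<bar>indicator K z - compact_bump K n z\<bar>)" .
      qed (use bI AI in auto)
      also have "\<dots> = \<bar>c\<bar> * ((AVG z. indicator A z - indicator K z) + (AVG z. \<bar>indicator K z - compact_bump K n z\<bar>))"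
        using bI AI by simp
      also have "(AVG z. indicator A z - indicator K z) = measure circle_measure A - measure circle_measure K"
        by (subst Bochner_Integration.integral_diff) (auto simp: circle.emeasure_eq_measure)
      also have "\<bar>c\<bar> * (measure circle_measure A - measure circle_measure K + (AVG z. \<bar>indicator K z - compact_bump K n z\<bar>)) < \<bar>c\<bar> * (d + d)"
        using n K(4) False by (intro mult_strict_left_mono) auto
      also have "\<dots> = e" using False by (simp add: d_def)
      finally show ?thesis using compact_bump(1)[OF K(2,3), of n]
        by (intro exI[of _ "\<lambda>z. c * compact_bump K n z"]) (auto intro!: continuous_intros)
    qed
  qed
next
  case (add f g)
  show ?case
  proof (intro allI impI)
    fix e :: real assume e: "0 < e"
    then have "0 < e / 2" by simp
    then obtain k l where k: "continuous_on UNIV k" "(AVG z. \<bar>f z - k z\<bar>) < e / 2"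
      and l: "continuous_on UNIV l" "(AVG z. \<bar>g z - l z\<bar>) < e / 2"
      using add.IH by meson
    have kI: "integrable circle_measure k" "integrable circle_measure l"
      using k(1) l(1) by (auto intro!: integrable_circle_continuous borel_measurable_continuous_onI intro: continuous_on_subset)
    have "(AVG z. \<bar>f z + g z - (k z + l z)\<bar>) \<le> (AVG z. \<bar>f z - k z\<bar> + \<bar>g z - l z\<bar>)"
      using add.hyps kI by (intro integral_mono) auto
    also have "\<dots> < e" using add.hyps kI k(2) l(2) by simp
    finally show "\<exists>k. continuous_on UNIV k \<and> (AVG z. \<bar>f z + g z - k z\<bar>) < e"
      using k(1) l(1) by (intro exI[of _ "\<lambda>z. k z + l z"]) (auto intro!: continuous_intros)
  qed
next
  case (lim f s)
  have [measurable]: "f \<in> borel_measurable borel" "\<And>i. s i \<in> borel_measurable borel"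
    using lim by (auto intro: borel_measurable_circle_integrable)
  show ?case
  proof (intro allI impI)
    fix e :: real assume e: "0 < e"
    have "(\<lambda>i. AVG z. \<bar>f z - s i z\<bar>) \<longlonglongrightarrow> (AVG z. \<bar>f z - f z\<bar>)"
    \<comment> \<open>The induction rule supplies \<open>|s i z| \<le> 2 * |f z|\<close>; hence the
      3.\<close>
    proof (rule integral_dominated_convergence[where w = "\<lambda>z. 3 * \<bar>f z\<bar>"])
      show "AE z in circle_measure. (\<lambda>i. \<bar>f z - s i z\<bar>) \<longlonglongrightarrow> \<bar>f z - f z\<bar>"
        using lim.hyps by (intro AE_I2 tendsto_intros) auto
      show "AE z in circle_measure. norm \<bar>f z - s i z\<bar> \<le> 3 * \<bar>f z\<bar>" for i
      proof (rule AE_I2)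
        fix z show "norm \<bar>f z - s i z\<bar> \<le> 3 * \<bar>f z\<bar>" using lim.hyps(3)[of z i] by simp
      qed
    qed (use lim in auto)
    then have "eventually (\<lambda>i. (AVG z. \<bar>f z - s i z\<bar>) < e / 2) sequentially"
      using e by (intro order_tendstoD(2)[where y = 0]) auto
    then obtain i where i: "(AVG z. \<bar>f z - s i z\<bar>) < e / 2" by (auto simp: eventually_sequentially)
    obtain k where k: "continuous_on UNIV k" "(AVG z. \<bar>s i z - k z\<bar>) < e / 2"
      using lim.IH[of i] e by (meson half_gt_zero)
    have kI: "integrable circle_measure k"
      using k(1) by (auto intro!: integrable_circle_continuous borel_measurable_continuous_onI intro: continuous_on_subset)
    have "(AVG z. \<bar>f z - k z\<bar>) \<le> (AVG z. \<bar>f z - s i z\<bar> + \<bar>s i z - k z\<bar>)"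
      using lim kI by (intro integral_mono) auto
    also have "\<dots> < e" using lim kI k(2) i by simp
    finally show "\<exists>k. continuous_on UNIV k \<and> (AVG z. \<bar>f z - k z\<bar>) < e" using k(1) by blast
  qed
qed

text \<open>Measurability on the whole plane is arranged in the final theorem by setting the map to
  0 off the disc.\<close>

locale disc_self_map =
  fixes \<phi> :: "complex \<Rightarrow> complex"
  assumes borel [measurable]: "\<phi> \<in> borel_measurable borel"
    and hol: "\<phi> holomorphic_on ball 0 1"
    and self: "\<phi> ` ball 0 1 \<subseteq> ball 0 1"
    and contact_pos: "measure circle_measure (contact_set \<phi>) > 0"
begin

text \<open>The limit along one sequence is a Borel function on the whole plane. It agrees with
  \<open>radial_limit\<close> wherever the radial limit exists, hence almost everywhere.\<close>

definition boundary :: "complex \<Rightarrow> complex" where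
  "boundary \<xi> = lim (\<lambda>n. \<phi> (of_real (dilation_radius n) * \<xi>))"

definition subordination_const :: real where
  "subordination_const = (1 + norm (\<phi> 0)) / (1 - norm (\<phi> 0))"

abbreviation "E \<equiv> contact_set \<phi>"
abbreviation "\<mu> \<equiv> contact_pushforward \<phi>"
abbreviation "F \<equiv> contact_density \<phi>"

lemma norm_phi_less: "norm z < 1 \<Longrightarrow> norm (\<phi> z) < 1"
  using self by (auto simp: image_subset_iff)

lemma subordination_const_ge: "1 \<le> subordination_const"
  using norm_phi_less[of 0] by (simp add: subordination_const_def field_simps)

lemma borel_measurable_boundary [measurable]: "boundary \<in> borel_measurable borel"
  unfolding boundary_def[abs_def] by measurable

lemma radial_imp_boundary:
  assumes "((\<lambda>r. \<phi> (of_real r * \<xi>)) \<longlongrightarrow> l) (at_left 1)"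
  shows "(\<lambda>n. \<phi> (of_real (dilation_radius n) * \<xi>)) \<longlonglongrightarrow> l" "boundary \<xi> = l" "radial_limit \<phi> \<xi> = l"
proof -
  have "filterlim dilation_radius (at_left 1) sequentially"
    unfolding filterlim_at using dilation_radius by (auto simp: order_less_imp_not_eq)
  from filterlim_compose[OF assms this] show 1: "(\<lambda>n. \<phi> (of_real (dilation_radius n) * \<xi>)) \<longlonglongrightarrow> l" .
  then show "boundary \<xi> = l" unfolding boundary_def by (rule limI)
  show "radial_limit \<phi> \<xi> = l" unfolding radial_limit_def
    by (rule tendsto_Lim[OF _ assms]) simp
qed

lemma AE_boundary:
  "AE \<xi> in circle_measure. norm \<xi> = 1 \<and> (\<lambda>n. \<phi> (of_real (dilation_radius n) * \<xi>)) \<longlonglongrightarrow> boundary \<xi> \<and>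
     norm (boundary \<xi>) \<le> 1 \<and> (\<xi> \<in> E \<longleftrightarrow> norm (boundary \<xi>) = 1)"
proof -
  have "AE \<xi> in circle_measure. \<exists>l. ((\<lambda>r. \<phi> (of_real r * \<xi>)) \<longlongrightarrow> l) (at_left 1)"
    by (rule Fatou_radial_limits[OF borel hol]) (use norm_phi_less in \<open>auto intro: less_imp_le\<close>)
  with AE_circle_measure show ?thesis
  proof eventually_elim
    case (elim \<xi>)
    then obtain l where l: "((\<lambda>r. \<phi> (of_real r * \<xi>)) \<longlongrightarrow> l) (at_left 1)" by blast
    note R = radial_imp_boundary[OF l]
    have "norm l \<le> 1"
    proof (rule LIMSEQ_le_const2[OF tendsto_norm[OF R(1)]])
      have "norm (\<phi> (of_real (dilation_radius n) * \<xi>)) \<le> 1" for n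
        using dilation_radius(1,2)[of n] elim by (intro less_imp_le[OF norm_phi_less]) (simp add: norm_mult)
      then show "\<exists>N. \<forall>n\<ge>N. norm (\<phi> (of_real (dilation_radius n) * \<xi>)) \<le> 1" by blast
    qed
    then show ?case using R l elim unfolding contact_set_def by auto
  qed
qed

lemma contact_setD:
  assumes "\<xi> \<in> E" shows "norm \<xi> = 1" "radial_limit \<phi> \<xi> = boundary \<xi>" "norm (boundary \<xi>) = 1"
  using assms radial_imp_boundary unfolding contact_set_def by auto

text \<open>The measure of a set outside the sigma-algebra is 0 by convention, so the positivity
  assumed for \<open>E\<close> already yields its measurability.\<close>

lemma contact_set_borel [measurable]: "E \<in> sets borel"
  using contact_pos measure_notin_sets[of E circle_measure] by fastforce

lemma radial_limit_measurable: "radial_limit \<phi> \<in> borel_measurable (restrict_space circle_measure E)"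
proof -
  have "boundary \<in> borel_measurable (restrict_space circle_measure E)"
    by (intro measurable_restrict_space1) simp
  then show ?thesis
    by (rule measurable_cong[THEN iffD1, rotated]) (simp add: space_restrict_space contact_setD)
qed

lemma sets_mu [simp, measurable_cong]: "sets \<mu> = sets borel"
  by (simp add: contact_pushforward_def)

lemma finite_measure_mu: "finite_measure \<mu>"
  unfolding contact_pushforward_def
  by (intro finite_measure.finite_measure_distr finite_measure_restrict_space radial_limit_measurable)
     (auto simp: circle.finite_measure_axioms)

lemma AE_mu: "AE z in \<mu>. norm z = 1"
  unfolding contact_pushforward_def
  by (subst AE_distr_iff[OF radial_limit_measurable]) (auto simp: space_restrict_space contact_setD intro!: AE_I2)

lemma integral_mu:
  fixes g :: "complex \<Rightarrow> real"
  assumes [measurable]: "g \<in> borel_measurable borel"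
  shows "(LINT z|\<mu>. g z) = (AVG \<xi>. indicator E \<xi> * g (boundary \<xi>))"
proof -
  have "(LINT z|\<mu>. g z) = (LINT \<xi>|restrict_space circle_measure E. g (radial_limit \<phi> \<xi>))"
    unfolding contact_pushforward_def by (intro integral_distr radial_limit_measurable) simp
  also have "\<dots> = (AVG \<xi>. indicator E \<xi> *\<^sub>R g (radial_limit \<phi> \<xi>))"
    by (rule integral_restrict_space) simp
  also have "\<dots> = (AVG \<xi>. indicator E \<xi> * g (boundary \<xi>))"
    by (intro Bochner_Integration.integral_cong) (auto simp: contact_setD split: split_indicator)
  finally show ?thesis .
qed

text \<open>Because \<open>f\<close> is continuous and bounded on the closed disc, the radial limits
  of \<open>\<phi>\<close> and dominated convergence are enough; no boundary values of Hardy
  functions occur.\<close>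

lemma boundary_limit:
  assumes f [measurable]: "f \<in> borel_measurable borel" and hf: "f holomorphic_on ball 0 R" "1 < R" and q: "0 < q"
  shows "integrable circle_measure (\<lambda>\<xi>. norm (f (boundary \<xi>)) powr q)"
    and "(\<lambda>n. AVG \<xi>. norm (f (\<phi> (of_real (dilation_radius n) * \<xi>))) powr q) \<longlonglongrightarrow>
      (AVG \<xi>. norm (f (boundary \<xi>)) powr q)"
proof -
  have cf: "continuous_on (cball 0 1) f" by (rule continuous_on_cball_if_holomorphic[OF hf])
  have "compact (f ` cball 0 1)" by (intro compact_continuous_image cf) simp
  from compact_imp_bounded[OF this] obtain B where B: "\<And>z. norm z \<le> 1 \<Longrightarrow> norm (f z) \<le> B"
    unfolding bounded_iff by fastforce
  have isc: "isCont f z" if "norm z \<le> 1" for z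
    using holomorphic_on_imp_continuous_on[OF hf(1)] hf(2) that by (simp add: continuous_on_eq_continuous_at)
  have lim: "AE \<xi> in circle_measure. (\<lambda>n. norm (f (\<phi> (of_real (dilation_radius n) * \<xi>))) powr q) \<longlonglongrightarrow> norm (f (boundary \<xi>)) powr q"
    using AE_boundary
  proof eventually_elim
    case (elim \<xi>)
    then have "(\<lambda>n. f (\<phi> (of_real (dilation_radius n) * \<xi>))) \<longlonglongrightarrow> f (boundary \<xi>)"
      by (intro isCont_tendsto_compose[OF isc]) auto
    then show ?case using q by (intro tendsto_powr' tendsto_norm tendsto_const) auto
  qed
  have bd: "AE \<xi> in circle_measure. norm (norm (f (\<phi> (of_real (dilation_radius n) * \<xi>))) powr q) \<le> B powr q" for n
    using AE_circle_measure
  proof eventually_elim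
    case (elim \<xi>)
    have "norm (\<phi> (of_real (dilation_radius n) * \<xi>)) \<le> 1"
      using dilation_radius(1,2)[of n] elim by (intro less_imp_le[OF norm_phi_less]) (simp add: norm_mult)
    then have "norm (f (\<phi> (of_real (dilation_radius n) * \<xi>))) \<le> B" by (rule B)
    then show ?case using q by (simp add: powr_mono2)
  qed
  show "integrable circle_measure (\<lambda>\<xi>. norm (f (boundary \<xi>)) powr q)"
    by (rule integrable_dominated_convergence[OF _ _ _ lim bd]) auto
  show "(\<lambda>n. AVG \<xi>. norm (f (\<phi> (of_real (dilation_radius n) * \<xi>))) powr q) \<longlonglongrightarrow>
      (AVG \<xi>. norm (f (boundary \<xi>)) powr q)"
    by (rule integral_dominated_convergence[OF _ _ _ lim bd]) auto
qed

lemma boundary_subordination: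
  assumes f [measurable]: "f \<in> borel_measurable borel" and hf: "f holomorphic_on ball 0 R" "1 < R" and p: "1 \<le> p"
  shows "(AVG \<xi>. norm (f (boundary \<xi>)) powr p) \<le> subordination_const * (AVG z. norm (f z) powr p)"
proof (rule LIMSEQ_le_const2[OF boundary_limit(2)[OF f hf]])
  show "\<exists>N. \<forall>n\<ge>N. (AVG \<xi>. norm (f (\<phi> (of_real (dilation_radius n) * \<xi>))) powr p)
      \<le> subordination_const * (AVG z. norm (f z) powr p)"
    unfolding subordination_const_def
    using Littlewood_subordination(2)[OF f hf borel hol self p] dilation_radius(1,2) by (auto intro: less_imp_le)
qed (use p in simp)

text \<open>Subordination applies only to moduli of holomorphic functions. Those of suitable entire
  functions converge boundedly to the indicator of \<open>K\<close> on the circle, which carries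
  both measures, so the case \<open>p = 1\<close> passes to the limit.\<close>

lemma measure_mu_compact_le:
  assumes K: "compact K"
  shows "measure \<mu> K \<le> subordination_const * measure circle_measure K"
proof (cases "K = {}")
  case False
  interpret mu: finite_measure \<mu> by (rule finite_measure_mu)
  have [measurable]: "K \<in> sets borel" using K by (simp add: borel_compact)
  obtain f where f: "\<And>n. f n holomorphic_on UNIV"
    "\<And>z. norm z = 1 \<Longrightarrow> (\<lambda>n. norm (f n z)) \<longlonglongrightarrow> indicator K z" "\<And>n z. norm z = 1 \<Longrightarrow> norm (f n z) \<le> 2"
    using compact_modulus_approx[OF K False] by blast
  have [measurable]: "f n \<in> borel_measurable borel" for n by (rule borel_measurable_entire[OF f(1)])
  have 1: "(\<lambda>n. LINT z|\<mu>. norm (f n z)) \<longlonglongrightarrow> (LINT z|\<mu>. indicator K z)"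
    by (rule integral_dominated_convergence[where w = "\<lambda>_. 2"])
       (use AE_mu f in \<open>auto elim!: eventually_mono\<close>)
  have 2: "(\<lambda>n. AVG z. norm (f n z)) \<longlonglongrightarrow> (AVG z. indicator K z)"
    by (rule integral_dominated_convergence[where w = "\<lambda>_. 2"])
       (use AE_circle_measure f in \<open>auto elim!: eventually_mono\<close>)
  have le: "(LINT z|\<mu>. norm (f n z)) \<le> subordination_const * (AVG z. norm (f n z))" for n
  proof -
    have hf: "f n holomorphic_on ball 0 2" using f(1) by (rule holomorphic_on_subset) simp
    have "(LINT z|\<mu>. norm (f n z)) = (AVG \<xi>. indicator E \<xi> * norm (f n (boundary \<xi>)))"
      by (rule integral_mu) measurable
    also have "\<dots> \<le> (AVG \<xi>. norm (f n (boundary \<xi>)) powr 1)"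
    proof (rule integral_mono)
      show I: "integrable circle_measure (\<lambda>\<xi>. norm (f n (boundary \<xi>)) powr 1)"
        by (rule boundary_limit(1)[OF _ hf]) auto
      show "integrable circle_measure (\<lambda>\<xi>. indicator E \<xi> * norm (f n (boundary \<xi>)))"
        using integrable_mult_indicator[OF _ I, of E] by simp
    qed (auto split: split_indicator)
    also have "\<dots> \<le> subordination_const * (AVG z. norm (f n z) powr 1)"
      by (rule boundary_subordination[OF _ hf]) auto
    finally show ?thesis by simp
  qed
  have "(LINT z|\<mu>. indicator K z) \<le> subordination_const * (AVG z. indicator K z :: real)"
    by (rule LIMSEQ_le[OF 1 tendsto_mult[OF tendsto_const 2]]) (use le in auto)
  then show ?thesis by simp
qed (simp)

text \<open>Inner regularity of the finite measure \<open>\<mu>\<close> extends the bound from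
  compact sets to all Borel sets. Absolute continuity follows, so that the Radon-Nikodym derivative
  really is a density.\<close>

lemma emeasure_mu_le:
  assumes [measurable]: "A \<in> sets borel"
  shows "emeasure \<mu> A \<le> ennreal subordination_const * emeasure circle_measure A"
proof -
  interpret mu: finite_measure \<mu> by (rule finite_measure_mu)
  have C: "0 \<le> subordination_const" using subordination_const_ge by simp
  have "emeasure \<mu> A = (SUP K\<in>{K. K \<subseteq> A \<and> compact K}. emeasure \<mu> K)"
    by (rule inner_regular) (auto simp: mu.emeasure_eq_measure)
  also have "\<dots> \<le> ennreal subordination_const * emeasure circle_measure A"
  proof (rule SUP_least)
    fix K assume "K \<in> {K. K \<subseteq> A \<and> compact K}"
    then have K: "K \<subseteq> A" "compact K" by auto
    have "measure \<mu> K \<le> subordination_const * measure circle_measure K" by (rule measure_mu_compact_le[OF K(2)])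
    also have "\<dots> \<le> subordination_const * measure circle_measure A"
      using K(1) C by (intro mult_left_mono circle.finite_measure_mono) auto
    finally show "emeasure \<mu> K \<le> ennreal subordination_const * emeasure circle_measure A"
      using C by (simp add: mu.emeasure_eq_measure circle.emeasure_eq_measure ennreal_mult[symmetric] ennreal_leI)
  qed
  finally show ?thesis .
qed

lemma density_mu: "density circle_measure (RN_deriv circle_measure \<mu>) = \<mu>"
proof (rule circle.density_RN_deriv)
  show "absolutely_continuous circle_measure \<mu>"
    unfolding absolutely_continuous_def
  proof
    fix N assume N: "N \<in> null_sets circle_measure"
    then have "emeasure \<mu> N \<le> 0" using emeasure_mu_le[of N] by (auto simp: null_sets_def)
    then show "N \<in> null_sets \<mu>" using N by (auto simp: null_sets_def)
  qed
qed simp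

lemma borel_measurable_density [measurable]: "F \<in> borel_measurable borel"
proof -
  have "RN_deriv circle_measure \<mu> \<in> borel_measurable borel"
    using borel_measurable_RN_deriv[of circle_measure \<mu>] measurable_cong_sets[OF sets_circle_measure refl] by blast
  then show ?thesis unfolding contact_density_def[abs_def] by measurable
qed

lemma density_nonneg: "0 \<le> F z"
  by (simp add: contact_density_def)

text \<open>On the set \<open>A\<close> where the bound fails,
  \<open>(C + 1) * \<sigma> A \<le> \<mu> A \<le> C * \<sigma> A\<close> with \<open>C\<close> the
  subordination constant. The added 1 makes \<open>\<sigma> A = 0\<close> immediate.\<close>

lemma AE_RN_le: "AE z in circle_measure. RN_deriv circle_measure \<mu> z \<le> ennreal (subordination_const + 1)"
proof -
  let ?D = "RN_deriv circle_measure \<mu>"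
  define A where "A = {z. ennreal (subordination_const + 1) < ?D z}"
  have A [measurable]: "A \<in> sets borel"
  proof -
    have "{z \<in> space circle_measure. ennreal (subordination_const + 1) < ?D z} \<in> sets circle_measure" by measurable
    then show ?thesis by (simp add: A_def)
  qed
  have C: "0 \<le> subordination_const" using subordination_const_ge by simp
  have "ennreal (subordination_const + 1) * emeasure circle_measure A = (\<integral>\<^sup>+z. ennreal (subordination_const + 1) * indicator A z \<partial>circle_measure)"
    by (simp add: nn_integral_cmult_indicator)
  also have "\<dots> \<le> (\<integral>\<^sup>+z. ?D z * indicator A z \<partial>circle_measure)"
    by (intro nn_integral_mono) (auto simp: A_def split: split_indicator)
  also have "\<dots> = emeasure (density circle_measure ?D) A"
    by (rule emeasure_density[symmetric]) auto
  also have "\<dots> \<le> ennreal subordination_const * emeasure circle_measure A"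
    unfolding density_mu by (rule emeasure_mu_le[OF A])
  finally have "(subordination_const + 1) * measure circle_measure A \<le> subordination_const * measure circle_measure A"
    using C by (simp add: circle.emeasure_eq_measure ennreal_mult[symmetric] del: ennreal_plus)
  then have "measure circle_measure A = 0" using measure_nonneg[of circle_measure A] by (simp add: algebra_simps)
  then have "A \<in> null_sets circle_measure"
    by (intro null_setsI) (auto simp: circle.emeasure_eq_measure)
  then have "AE z in circle_measure. z \<notin> A" by (rule AE_not_in)
  then show ?thesis by eventually_elim (simp add: A_def not_less)
qed

lemma AE_density_le: "AE z in circle_measure. F z \<le> subordination_const + 1"
  using AE_RN_le
proof eventually_elim
  case (elim z)
  then have "F z \<le> enn2real (ennreal (subordination_const + 1))"
    unfolding contact_density_def by (intro enn2real_mono) auto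
  then show ?case using subordination_const_ge by (simp del: ennreal_plus)
qed

text \<open>\<open>enn2real\<close> sends infinity to 0, so the real-valued \<open>F\<close> is a
  density only because the derivative is finite almost everywhere.\<close>

lemma mu_eq_density: "\<mu> = density circle_measure (\<lambda>z. ennreal (F z))"
proof -
  have "AE z in circle_measure. RN_deriv circle_measure \<mu> z = ennreal (F z)"
    using AE_RN_le
  proof eventually_elim
    case (elim z)
    then have "RN_deriv circle_measure \<mu> z \<noteq> \<infinity>" by (auto simp: top_unique)
    then show ?case unfolding contact_density_def by (simp add: less_top)
  qed
  then have "density circle_measure (RN_deriv circle_measure \<mu>) = density circle_measure (\<lambda>z. ennreal (F z))"
    by (intro density_cong) auto
  then show ?thesis using density_mu by simp
qed

lemma integral_contact:
  fixes g :: "complex \<Rightarrow> real"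
  assumes [measurable]: "g \<in> borel_measurable borel"
  shows "(AVG \<xi>. indicator E \<xi> * g (boundary \<xi>)) = (AVG z. F z * g z)"
proof -
  have "(LINT z|density circle_measure (\<lambda>z. ennreal (F z)). g z) = (AVG z. F z *\<^sub>R g z)"
    by (rule integral_density) (auto simp: density_nonneg)
  then show ?thesis using integral_mu[of g] mu_eq_density by simp
qed

end

section \<open>The lower bound\<close>

definition disc_restriction :: "(complex \<Rightarrow> complex) \<Rightarrow> complex \<Rightarrow> complex" where
  "disc_restriction f = (\<lambda>z. if z \<in> ball 0 1 then f z else 0)"

text \<open>Subordination to the identity, whose constant is 1, bounds the means over smaller
  circles by the mean over the unit circle.\<close>

lemma hardy_norm_disc_restriction:
  assumes f [measurable]: "f \<in> borel_measurable borel" and hf: "f holomorphic_on ball 0 R" "1 < R"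
    and p: "1 \<le> p" and c: "0 \<le> c" and le: "(AVG z. norm (f z) powr p) \<le> c powr p"
  shows "disc_restriction f \<in> hardy_space p" "hardy_norm p (disc_restriction f) \<le> c"
proof -
  have hol: "disc_restriction f holomorphic_on ball 0 1"
    by (rule holomorphic_transform[of f])
       (use hf in \<open>auto simp: disc_restriction_def intro: holomorphic_on_subset\<close>)
  have [measurable]: "disc_restriction f \<in> borel_measurable borel"
    by (rule borel_measurable_if_holomorphic[OF hol]) (simp add: disc_restriction_def)
  have "radial_mean p (disc_restriction f) r \<le> c powr p" if r: "0 \<le> r" "r < 1" for r
  proof -
    have "radial_mean p (disc_restriction f) r = (AVG \<xi>. norm (f (of_real r * \<xi>)) powr p)"
      unfolding radial_mean_def
      by (rule circle_integral_cong) (use r in \<open>auto simp: disc_restriction_def norm_mult\<close>)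
    also have "\<dots> \<le> (1 + norm (0::complex)) / (1 - norm (0::complex)) * (AVG z. norm (f z) powr p)"
      by (rule Littlewood_subordination(2)[OF f hf _ _ _ p r, of "\<lambda>z. z"]) auto
    finally show ?thesis using le by simp
  qed
  then show "disc_restriction f \<in> hardy_space p" "hardy_norm p (disc_restriction f) \<le> c"
    using p c hol by (auto intro!: hardy_spaceI[of p c] simp: disc_restriction_def)
qed

lemma hardy_space_0: "0 < p \<Longrightarrow> (\<lambda>z. 0) \<in> hardy_space p" "0 < p \<Longrightarrow> hardy_norm p (\<lambda>z. 0) = 0"
proof -
  assume p: "0 < p"
  have "radial_mean p (\<lambda>z. 0) r \<le> 0 powr p" for r by (simp add: radial_mean_def)
  then have "(\<lambda>z. 0) \<in> hardy_space p \<and> hardy_norm p (\<lambda>z. 0) \<le> 0"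
    using hardy_spaceI[of p 0 "\<lambda>z. 0"] p by auto
  then show "(\<lambda>z. 0) \<in> hardy_space p" "hardy_norm p (\<lambda>z. 0) = 0"
    using hardy_norm_nonneg[of p "\<lambda>z. 0"] by auto
qed

lemma hardy_norm_sum:
  assumes q: "1 \<le> q" and S: "finite S" and h: "\<And>k. k \<in> S \<Longrightarrow> h k \<in> hardy_space q"
  shows "(\<lambda>z. \<Sum>k\<in>S. h k z) \<in> hardy_space q \<and> hardy_norm q (\<lambda>z. \<Sum>k\<in>S. h k z) \<le> (\<Sum>k\<in>S. hardy_norm q (h k))"
  using S h
proof (induction S)
  case empty
  then show ?case using hardy_space_0[of q] q by simp
next
  case (insert x S)
  then have "(\<lambda>z. h x z + (\<Sum>k\<in>S. h k z)) \<in> hardy_space q"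
    "hardy_norm q (\<lambda>z. h x z + (\<Sum>k\<in>S. h k z)) \<le> hardy_norm q (h x) + hardy_norm q (\<lambda>z. \<Sum>k\<in>S. h k z)"
    by (auto intro!: hardy_norm_add q)
  with insert show ?case by (auto intro: order_trans)
qed

text \<open>Linearity is available on the Hardy space only, so the induction also has to secure
  membership of the partial sums. The value at the zero function comes from homogeneity with factor
  0.\<close>

lemma linear_operator_sum:
  assumes K: "linear_operator p q K" and q: "1 \<le> q" "1 \<le> p" and S: "finite S" and h: "\<And>k. k \<in> S \<Longrightarrow> h k \<in> hardy_space p"
  shows "K (\<lambda>z. \<Sum>k\<in>S. c * h k z) = (\<lambda>z. \<Sum>k\<in>S. c * K (h k) z)"
  using S h
proof (induction S)
  case empty
  have "K (\<lambda>z. 0 * 0) = (\<lambda>z. 0 * K (\<lambda>z. 0) z)"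
    using K hardy_space_0(1)[of p] q unfolding linear_operator_def by fastforce
  then show ?case by simp
next
  case (insert x S)
  have hx: "h x \<in> hardy_space p" using insert.prems by simp
  have c: "(\<lambda>z. c * h k z) \<in> hardy_space p" if "k \<in> insert x S" for k
    using hardy_norm_scale(1)[of p "h k" c] insert.prems[OF that] q by simp
  have s: "(\<lambda>z. \<Sum>k\<in>S. c * h k z) \<in> hardy_space p"
    using hardy_norm_sum[of p S "\<lambda>k z. c * h k z"] q insert.hyps c by auto
  have "K (\<lambda>z. c * h x z + (\<Sum>k\<in>S. c * h k z)) = (\<lambda>z. K (\<lambda>z. c * h x z) z + K (\<lambda>z. \<Sum>k\<in>S. c * h k z) z)"
    using K c[of x] s unfolding linear_operator_def by simp
  also have "K (\<lambda>z. c * h x z) = (\<lambda>z. c * K (h x) z)"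
    using K hx unfolding linear_operator_def by simp
  finally show ?case using insert by simp
qed

lemma linear_operator_mem: "linear_operator p q K \<Longrightarrow> f \<in> hardy_space p \<Longrightarrow> K f \<in> hardy_space q"
  by (simp add: linear_operator_def)

lemma compact_operator_linear: "compact_operator p q K \<Longrightarrow> linear_operator p q K"
  by (simp add: compact_operator_def)

lemmas compact_operator_mem = linear_operator_mem[OF compact_operator_linear]

lemma compact_operator_subseq:
  assumes "compact_operator p q K" "\<And>n. f n \<in> hardy_space p" "\<And>n. hardy_norm p (f n) \<le> B"
  obtains u g where "strict_mono (u :: nat \<Rightarrow> nat)" "g \<in> hardy_space q"
    "(\<lambda>n. hardy_norm q (\<lambda>z. K (f (u n)) z - g z)) \<longlonglongrightarrow> 0"
proof -
  have "bdd_above (range (\<lambda>n. hardy_norm p (f n)))" using assms(3) by (intro bdd_aboveI2) auto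
  with assms(2) have "(\<forall>n. f n \<in> hardy_space p) \<and> bdd_above (range (\<lambda>n. hardy_norm p (f n)))" by simp
  from assms(1)[unfolded compact_operator_def, THEN conjunct2, rule_format, OF this]
  show ?thesis using that by (elim exE conjE)
qed

text \<open>Boundedness is not built into \<open>compact_operator\<close>, but the real supremum in
  \<open>operator_norm\<close> is meaningful only with it. Images of unit-ball elements with norms
  tending to infinity have no convergent subsequence.\<close>

lemma compact_operator_bounded:
  assumes K: "compact_operator p q K" and q: "1 \<le> q"
  shows "\<exists>M>0. \<forall>f\<in>hardy_space p. hardy_norm p f \<le> 1 \<longrightarrow> hardy_norm q (K f) \<le> M"
proof (rule ccontr)
  assume neg: "\<not> ?thesis"
  have "\<exists>f. f \<in> hardy_space p \<and> hardy_norm p f \<le> 1 \<and> real (Suc n) < hardy_norm q (K f)" for n :: nat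
    using neg[unfolded not_ex, rule_format, of "real (Suc n)"] by (auto simp: not_le)
  then obtain f where f: "\<And>n. f n \<in> hardy_space p" "\<And>n. hardy_norm p (f n) \<le> 1" "\<And>n. real (Suc n) < hardy_norm q (K (f n))"
    by metis
  obtain u :: "nat \<Rightarrow> nat" and g where ug: "strict_mono u" "g \<in> hardy_space q"
     "(\<lambda>n. hardy_norm q (\<lambda>z. K (f (u n)) z - g z)) \<longlonglongrightarrow> 0"
    by (rule compact_operator_subseq[OF K f(1,2)])
  have Kf: "K (f n) \<in> hardy_space q" for n
    by (rule compact_operator_mem[OF K f(1)])
  have "eventually (\<lambda>n. hardy_norm q (\<lambda>z. K (f (u n)) z - g z) < 1) sequentially"
    using ug(3) by (rule order_tendstoD(2)) simp
  then obtain N where N: "\<And>n. N \<le> n \<Longrightarrow> hardy_norm q (\<lambda>z. K (f (u n)) z - g z) < 1"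
    by (auto simp: eventually_sequentially)
  obtain m :: nat where m: "1 + hardy_norm q g < real m" using reals_Archimedean2 by blast
  define n where "n = max N m"
  have "hardy_norm q (K (f (u n))) \<le> hardy_norm q (\<lambda>z. K (f (u n)) z - g z) + hardy_norm q g"
    using hardy_norm_add(2)[OF q hardy_norm_diff(1)[OF q Kf ug(2)] ug(2), of "u n"] by simp
  also have "\<dots> < 1 + hardy_norm q g" using N[of n] by (simp add: n_def)
  also have "\<dots> < real m" by (rule m)
  also have "\<dots> \<le> real (u n)" using seq_suble[OF ug(1), of n] by (simp add: n_def)
  finally show False using f(3)[of "u n"] by simp
qed

text \<open>Homogeneity with a positive bound \<open>c\<close> in place of the norm, which may
  vanish.\<close>

lemma operator_bound_scale:
  assumes K: "linear_operator p q K" and p: "1 \<le> p" "1 \<le> q"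
    and M: "\<And>f. f \<in> hardy_space p \<Longrightarrow> hardy_norm p f \<le> 1 \<Longrightarrow> hardy_norm q (K f) \<le> M"
    and f: "f \<in> hardy_space p" "hardy_norm p f \<le> c" and c: "0 < c"
  shows "hardy_norm q (K f) \<le> c * M"
proof -
  define g where "g = (\<lambda>z. of_real (1 / c) * f z)"
  have g: "g \<in> hardy_space p" "hardy_norm p g \<le> norm (of_real (1 / c) :: complex) * hardy_norm p f"
    unfolding g_def using hardy_norm_scale[of p f "of_real (1 / c)"] p f by auto
  have "norm (of_real (1 / c) :: complex) = 1 / c" using c by (simp only: norm_of_real) simp
  then have "hardy_norm p g \<le> hardy_norm p f / c" using g(2) by simp
  also have "\<dots> \<le> c / c" using f(2) c by (intro divide_right_mono) auto
  finally have g1: "hardy_norm p g \<le> 1" using c by simp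
  have "f = (\<lambda>z. of_real c * g z)" using c by (simp add: g_def fun_eq_iff)
  then have "K f = (\<lambda>z. of_real c * K g z)" using K g(1) unfolding linear_operator_def by simp
  then have "hardy_norm q (K f) \<le> norm (of_real c :: complex) * hardy_norm q (K g)"
    using hardy_norm_scale(2)[of q "K g" "of_real c"] p K g(1) unfolding linear_operator_def by simp
  also have "\<dots> \<le> c * M" using c M[OF g(1) g1] by (simp add: mult_left_mono)
  finally show ?thesis .
qed

section \<open>Compact operators on modulated functions\<close>

lemma integral_monomial_product:
  "(AVG z. z ^ m * cnj (z ^ n)) = (if m = n then 1 else 0)"
proof -
  have ge: "(AVG z. z ^ m * cnj (z ^ n)) = (if m = n then 1 else 0)" if "n \<le> m" for m n :: nat
  proof -
    \<comment> \<open>The trivial denominator brings the integral into the form of Cauchy's formula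
      at the centre.\<close>
    have "(AVG z. z ^ m * cnj (z ^ n)) = (AVG z. z ^ (m - n) / (1 - 0 * cnj z))"
    proof (rule circle_integral_cong)
      fix z :: complex assume z: "norm z = 1"
      have "z ^ m = z ^ (m - n) * z ^ n" using that by (simp flip: power_add)
      moreover have "z * cnj z = 1" using z by (simp add: complex_norm_square[symmetric])
      then have "z ^ n * cnj (z ^ n) = 1" by (simp flip: power_mult_distrib)
      ultimately show "z ^ m * cnj (z ^ n) = z ^ (m - n) / (1 - 0 * cnj z)" by (simp add: mult.assoc)
    qed auto
    also have "\<dots> = 0 ^ (m - n)"
      by (rule Cauchy_formula_circle(2)[of "\<lambda>z. z ^ (m - n)" 2]) (auto intro!: holomorphic_intros)
    finally show ?thesis using that by (auto simp: power_0_left)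
  qed
  show ?thesis
  proof (cases "n \<le> m")
    case True then show ?thesis by (rule ge)
  next
    case False
    have "(AVG z. z ^ m * cnj (z ^ n)) = (AVG z. cnj (z ^ n * cnj (z ^ m)))"
      by (intro Bochner_Integration.integral_cong) (auto simp: mult.commute)
    also have "\<dots> = cnj (AVG z. z ^ n * cnj (z ^ m))" by (rule Bochner_Integration.integral_cnj)
    finally show ?thesis using ge[of m n] False by simp
  qed
qed

lemma integral_power_sum_square:
  assumes u: "inj u" and S: "finite S"
  shows "(AVG z. (norm (\<Sum>k\<in>S. z ^ u k))\<^sup>2) = real (card S)"
proof -
  have I: "integrable circle_measure (\<lambda>z. z ^ m * cnj (z ^ n))" for m n :: nat
    by (rule integrable_circle_bounded[where B = 1]) (auto simp: norm_mult norm_power)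
  have "complex_of_real (AVG z. (norm (\<Sum>k\<in>S. z ^ u k))\<^sup>2) = (AVG z. of_real ((norm (\<Sum>k\<in>S. z ^ u k))\<^sup>2))"
    by (rule integral_complex_of_real[symmetric])
  also have "\<dots> = (AVG z. (\<Sum>a\<in>S. \<Sum>b\<in>S. z ^ u a * cnj (z ^ u b)))"
    unfolding complex_norm_square cnj_sum sum_product ..
  also have "\<dots> = (\<Sum>a\<in>S. \<Sum>b\<in>S. (AVG z. z ^ u a * cnj (z ^ u b)))"
    using I by (subst Bochner_Integration.integral_sum; auto intro!: Bochner_Integration.integrable_sum sum.cong Bochner_Integration.integral_sum)
  also have "\<dots> = (\<Sum>a\<in>S. \<Sum>b\<in>S. if b = a then 1 else 0)"
    unfolding integral_monomial_product using inj_eq[OF u] by (intro sum.cong refl) auto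
  also have "\<dots> = of_nat (card S)" using S by (simp add: sum.delta)
  finally show ?thesis by (metis of_real_eq_iff of_real_of_nat_eq)
qed

text \<open>The average \<open>w\<close> of \<open>N\<close> distinct monomials satisfies
  \<open>|w| \<le> 1\<close> on the circle and has square mean \<open>1 / N\<close>. For
  \<open>p \<ge> 2\<close> one uses \<open>|w|^p \<le> |w|^2\<close>, for smaller \<open>p\<close>
  the monotonicity of the norms in the exponent; \<open>max p 2\<close> covers both cases.\<close>

lemma integral_power_average:
  fixes p :: real and N :: nat
  assumes u: "inj u" and N: "1 \<le> N" and p: "1 \<le> p"
  shows "(AVG z. norm (of_real (1 / real N) * (\<Sum>k\<in>{N..<2*N}. z ^ u k) :: complex) powr p) \<le> (1 / real N) powr (p / max p 2)"
proof -
  define w where "w = (\<lambda>z::complex. of_real (1 / real N) * (\<Sum>k\<in>{N..<2*N}. z ^ u k) :: complex)"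
  define P where "P = max p 2"
  have wm [measurable]: "w \<in> borel_measurable borel" unfolding w_def by measurable
  have w1: "norm (w z) \<le> 1" if "norm z = 1" for z
  proof -
    have "norm (\<Sum>k\<in>{N..<2*N}. z ^ u k) \<le> real N"
      using norm_sum[of "\<lambda>k. z ^ u k" "{N..<2*N}"] that by (simp add: norm_power)
    then show ?thesis using N by (simp add: w_def norm_mult norm_divide field_simps)
  qed
  have P: "0 < p" "p \<le> P" "2 \<le> P" using p by (auto simp: P_def)
  have I: "integrable circle_measure (\<lambda>z. norm (w z) powr a)" if "0 < a" for a
    by (rule integrable_circle_bounded[where B = 1]) (use w1 powr_mono2[of a _ 1] that in auto)
  have "(AVG z. norm (w z) powr P) \<le> (AVG z. norm (w z) powr 2)"
  proof (rule integral_mono_AE)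
    show "AE z in circle_measure. norm (w z) powr P \<le> norm (w z) powr 2"
      using AE_circle_measure
    proof eventually_elim
      case (elim z)
      show ?case by (rule powr_mono') (use w1[OF elim] P in auto)
    qed
  qed (rule I, use P in simp)+
  also have "\<dots> = (AVG z. (1 / real N)\<^sup>2 * (norm (\<Sum>k\<in>{N..<2*N}. z ^ u k))\<^sup>2)"
    unfolding w_def by (simp add: norm_mult norm_divide power_mult_distrib power_divide)
  also have "\<dots> = (1 / real N)\<^sup>2 * real N"
    using integral_power_sum_square[OF u, of "{N..<2*N}"] by simp
  also have "\<dots> = 1 / real N" using N by (simp add: power2_eq_square)
  finally have le: "(AVG z. norm (w z) powr P) \<le> 1 / real N" .
  have "(AVG z. norm (w z) powr p) \<le> (AVG z. norm (w z) powr P) powr (p / P)"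
    by (rule integral_powr_le(2)[OF P(1,2) wm I]) (use P in simp)
  also have "\<dots> \<le> (1 / real N) powr (p / P)" using le P by (intro powr_mono2) auto
  finally show ?thesis unfolding w_def P_def .
qed

definition modulated :: "(complex \<Rightarrow> complex) \<Rightarrow> nat \<Rightarrow> complex \<Rightarrow> complex" where
  "modulated Q n = disc_restriction (\<lambda>z. z ^ n * Q z)"

lemma modulated_hardy:
  assumes Q: "Q holomorphic_on UNIV" and p: "1 \<le> p" and c: "0 \<le> c" and le: "(AVG z. norm (Q z) powr p) \<le> c powr p"
  shows "modulated Q n \<in> hardy_space p" "hardy_norm p (modulated Q n) \<le> c"
proof -
  have [measurable]: "Q \<in> borel_measurable borel" by (rule borel_measurable_entire[OF Q])
  have h: "(\<lambda>z. z ^ n * Q z) holomorphic_on ball 0 2"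
    by (intro holomorphic_intros holomorphic_on_subset[OF Q]) auto
  have "(AVG z. norm (z ^ n * Q z) powr p) = (AVG z. norm (Q z) powr p)"
    by (rule circle_integral_cong) (auto simp: norm_mult norm_power)
  with le have "(AVG z. norm (z ^ n * Q z) powr p) \<le> c powr p" by simp
  from hardy_norm_disc_restriction[OF _ h _ p c this]
  show "modulated Q n \<in> hardy_space p" "hardy_norm p (modulated Q n) \<le> c"
    unfolding modulated_def by auto
qed

text \<open>The functions \<open>z\<^sup>n Q\<close> converge weakly to \<open>0\<close>. In place of weak convergence, the proof uses that
  averages of \<open>N\<close> of them have norm \<open>O(N\<^bsup>-1/max p 2\<^esup>)\<close>: their images under \<open>K\<close> then tend to \<open>0\<close>, while
  they also tend to every limit point of \<open>K (z\<^sup>n Q)\<close>.\<close>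

lemma compact_operator_modulated:
  assumes K: "compact_operator p q K" and p: "1 \<le> p" and q: "1 \<le> q" and Q: "Q holomorphic_on UNIV"
  shows "\<exists>u::nat\<Rightarrow>nat. strict_mono u \<and> (\<lambda>n. hardy_norm q (K (modulated Q (u n)))) \<longlonglongrightarrow> 0"
proof -
  have [measurable]: "Q \<in> borel_measurable borel" by (rule borel_measurable_entire[OF Q])
  have "continuous_on (sphere 0 1) Q" using holomorphic_on_imp_continuous_on[OF Q] by (rule continuous_on_subset) simp
  then obtain B0 where B0: "\<And>z. norm z = 1 \<Longrightarrow> norm (Q z) \<le> B0" using continuous_on_sphere_bounded by blast
  \<comment> \<open>Made positive because \<open>operator_bound_scale\<close> is applied with a
    multiple of \<open>B\<close>.\<close>
  define B where "B = max B0 1"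
  have B: "0 < B" "\<And>z. norm z = 1 \<Longrightarrow> norm (Q z) \<le> B" using B0 by (auto simp: B_def intro: le_max_iff_disj[THEN iffD2])
  have QB: "(AVG z. norm (Q z) powr p) \<le> B powr p"
  proof -
    have "(AVG z. norm (Q z) powr p) \<le> (AVG z. B powr p)"
    proof (rule integral_mono_AE)
      have b: "norm (Q z) powr p \<le> B powr p" if "norm z = 1" for z using B(2)[OF that] p by (intro powr_mono2) auto
      show "integrable circle_measure (\<lambda>z. norm (Q z) powr p)"
        by (rule integrable_circle_bounded[where B = "B powr p"]) (use b in auto)
      show "AE z in circle_measure. norm (Q z) powr p \<le> B powr p"
        using AE_circle_measure by eventually_elim (rule b)
    qed auto
    then show ?thesis using circle.prob_space by simp
  qed
  have f: "modulated Q n \<in> hardy_space p" "hardy_norm p (modulated Q n) \<le> B" for n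
    using modulated_hardy[OF Q p _ QB] B by auto
  have lin: "linear_operator p q K" by (rule compact_operator_linear[OF K])
  have Kf: "K h \<in> hardy_space q" if "h \<in> hardy_space p" for h
    by (rule compact_operator_mem[OF K that])
  obtain u :: "nat \<Rightarrow> nat" and g where ug: "strict_mono u" "g \<in> hardy_space q"
     "(\<lambda>n. hardy_norm q (\<lambda>z. K (modulated Q (u n)) z - g z)) \<longlonglongrightarrow> 0"
    by (rule compact_operator_subseq[OF K f])
  have injD: "inj u" using ug(1) by (rule strict_mono_imp_inj_on)
  obtain M where M: "0 < M" "\<And>f. f \<in> hardy_space p \<Longrightarrow> hardy_norm p f \<le> 1 \<Longrightarrow> hardy_norm q (K f) \<le> M"
    using compact_operator_bounded[OF K q] by blast
  define P where "P = max p 2"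
  have P: "0 < P" using p by (simp add: P_def)
  have g0: "hardy_norm q g \<le> e" if e: "0 < e" for e
  proof -
    have "eventually (\<lambda>n. hardy_norm q (\<lambda>z. K (modulated Q (u n)) z - g z) < e / 2) sequentially"
      using ug(3) by (rule order_tendstoD(2)) (use e in simp)
    then obtain N0 where N0: "\<And>n. N0 \<le> n \<Longrightarrow> hardy_norm q (\<lambda>z. K (modulated Q (u n)) z - g z) < e / 2"
      by (auto simp: eventually_sequentially)
    have "(\<lambda>n. B * (1 / real n) powr (1 / P) * M) \<longlonglongrightarrow> B * 0 powr (1 / P) * M"
      using P by (intro tendsto_intros tendsto_powr' lim_1_over_n) auto
    then have "eventually (\<lambda>n. B * (1 / real n) powr (1 / P) * M < e / 2) sequentially"
      using e by (intro order_tendstoD(2)[where y = "B * 0 powr (1 / P) * M"]) auto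
    then obtain N1 where N1: "\<And>n. N1 \<le> n \<Longrightarrow> B * (1 / real n) powr (1 / P) * M < e / 2"
      by (auto simp: eventually_sequentially)
    define N where "N = Max {N0, N1, 1}"
    have N: "N0 \<le> N" "N1 \<le> N" "1 \<le> N" by (auto simp: N_def)
    \<comment> \<open>Exactly \<open>N\<close> indices, all of them beyond the threshold
      \<open>N0\<close> of the convergence.\<close>
    define S where "S = {N..<2*N}"
    define A where "A = (\<lambda>z. \<Sum>k\<in>S. of_real (1 / real N) * modulated Q (u k) z)"
    define w where "w = (\<lambda>z::complex. of_real (1 / real N) * (\<Sum>k\<in>S. z ^ u k) :: complex)"
    have [measurable]: "w \<in> borel_measurable borel" unfolding w_def by measurable
    have A_eq: "A = disc_restriction (\<lambda>z. w z * Q z)"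
      unfolding A_def w_def modulated_def disc_restriction_def
      by (auto simp: fun_eq_iff sum_distrib_left sum_distrib_right mult_ac)
    define c where "c = B * (1 / real N) powr (1 / P)"
    have c: "0 < c" using B N by (simp add: c_def)
    have w1: "norm (w z) \<le> 1" if "norm z = 1" for z
    proof -
      have "norm (\<Sum>k\<in>S. z ^ u k) \<le> real N"
        using norm_sum[of "\<lambda>k. z ^ u k" S] that by (simp add: norm_power S_def)
      then show ?thesis using N by (simp add: w_def norm_mult norm_divide field_simps)
    qed
    have "(AVG z. norm (w z * Q z) powr p) \<le> (AVG z. B powr p * norm (w z) powr p)"
    proof (rule integral_mono_AE)
      have b: "norm (w z * Q z) powr p \<le> B powr p * norm (w z) powr p" if z: "norm z = 1" for z
      proof -
        have "norm (w z * Q z) \<le> B * norm (w z)" using B(2)[OF z] by (simp add: norm_mult mult_right_mono mult.commute[of "norm (w z)"])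
        then have "norm (w z * Q z) powr p \<le> (B * norm (w z)) powr p" using p by (intro powr_mono2) auto
        then show ?thesis using B by (simp add: powr_mult)
      qed
      show wI: "integrable circle_measure (\<lambda>z. B powr p * norm (w z) powr p)"
        by (intro integrable_mult_right integrable_circle_bounded[where B = 1]) (use w1 powr_mono2[of p _ 1] p in auto)
      show "integrable circle_measure (\<lambda>z. norm (w z * Q z) powr p)"
        by (rule Bochner_Integration.integrable_bound[OF wI])
           (use AE_circle_measure b in \<open>auto elim!: eventually_mono\<close>)
      show "AE z in circle_measure. norm (w z * Q z) powr p \<le> B powr p * norm (w z) powr p"
        using AE_circle_measure by eventually_elim (rule b)
    qed
    also have "\<dots> = B powr p * (AVG z. norm (w z) powr p)" by simp
    also have "\<dots> \<le> B powr p * (1 / real N) powr (p / P)"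
      using integral_power_average[OF injD N(3) p] unfolding w_def S_def P_def by (intro mult_left_mono) auto
    also have "\<dots> = c powr p"
      using B by (simp add: c_def powr_mult powr_powr)
    finally have Ale: "(AVG z. norm (w z * Q z) powr p) \<le> c powr p" .
    have hw: "(\<lambda>z. w z * Q z) holomorphic_on ball 0 2" unfolding w_def
      by (intro holomorphic_intros holomorphic_on_subset[OF Q]) auto
    have Ah: "A \<in> hardy_space p" "hardy_norm p A \<le> c"
      unfolding A_eq using hardy_norm_disc_restriction[OF _ hw _ p _ Ale] c by auto
    have KA: "hardy_norm q (K A) \<le> c * M"
      by (rule operator_bound_scale[OF lin p q M(2) Ah c])
    have KA_eq: "K A = (\<lambda>z. \<Sum>k\<in>S. of_real (1 / real N) * K (modulated Q (u k)) z)"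
      unfolding A_def by (rule linear_operator_sum[OF lin q p]) (auto simp: S_def f(1))
    have card: "(\<Sum>k\<in>S. of_real (1 / real N) * g z) = g z" for z
      using N by (simp add: S_def)
    \<comment> \<open>The weights add up to 1, so subtracting \<open>g\<close> from the image of the
      average averages the differences.\<close>
    have diff: "(\<lambda>z. K A z - g z) = (\<lambda>z. \<Sum>k\<in>S. of_real (1 / real N) * (K (modulated Q (u k)) z - g z))"
      unfolding KA_eq right_diff_distrib sum_subtractf card ..
    have d: "(\<lambda>z. K (modulated Q (u k)) z - g z) \<in> hardy_space q" for k
      by (rule hardy_norm_diff(1)[OF q Kf[OF f(1)] ug(2)])
    have q0: "0 < q" using q by simp
    have "hardy_norm q (\<lambda>z. K A z - g z) \<le> (\<Sum>k\<in>S. hardy_norm q (\<lambda>z. of_real (1 / real N) * (K (modulated Q (u k)) z - g z)))"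
      unfolding diff by (rule conjunct2[OF hardy_norm_sum[OF q _ hardy_norm_scale(1)[OF q0 d]]]) (simp add: S_def)
    also have "\<dots> \<le> (\<Sum>k\<in>S. (1 / real N) * (e / 2))"
    proof (rule sum_mono)
      fix k assume "k \<in> S"
      then have "N0 \<le> k" using N by (auto simp: S_def)
      have "hardy_norm q (\<lambda>z. of_real (1 / real N) * (K (modulated Q (u k)) z - g z)) \<le>
          norm (of_real (1 / real N) :: complex) * hardy_norm q (\<lambda>z. K (modulated Q (u k)) z - g z)"
        by (rule hardy_norm_scale(2)[OF q0 d])
      also have "\<dots> \<le> (1 / real N) * (e / 2)"
        using N0[OF \<open>N0 \<le> k\<close>] N by (intro mult_mono) (auto simp: norm_divide hardy_norm_nonneg)
      finally show "hardy_norm q (\<lambda>z. of_real (1 / real N) * (K (modulated Q (u k)) z - g z)) \<le> (1 / real N) * (e / 2)" .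
    qed
    also have "\<dots> = e / 2" using N by (simp add: S_def)
    finally have "hardy_norm q (\<lambda>z. K A z - g z) \<le> e / 2" .
    moreover have "hardy_norm q g \<le> hardy_norm q (K A) + hardy_norm q (\<lambda>z. K A z - g z)"
      using hardy_norm_diff(2)[OF q Kf[OF Ah(1)] hardy_norm_diff(1)[OF q Kf[OF Ah(1)] ug(2)]] by simp
    moreover have "c * M < e / 2" using N1[OF N(2)] by (simp add: c_def)
    ultimately show ?thesis using KA by linarith
  qed
  then have g0': "hardy_norm q g = 0"
    using hardy_norm_nonneg[of q g] by (meson dense_ge antisym)
  \<comment> \<open>It suffices that \<open>g\<close> has norm 0; the triangle inequality then lets
    it be dropped from the differences.\<close>
  have "(\<lambda>n. hardy_norm q (K (modulated Q (u n)))) \<longlonglongrightarrow> 0"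
  proof (rule tendsto_sandwich[OF _ _ tendsto_const ug(3)])
    show "\<forall>\<^sub>F n in sequentially. hardy_norm q (K (modulated Q (u n))) \<le> hardy_norm q (\<lambda>z. K (modulated Q (u n)) z - g z)"
    proof (intro always_eventually allI)
      fix n
      show "hardy_norm q (K (modulated Q (u n))) \<le> hardy_norm q (\<lambda>z. K (modulated Q (u n)) z - g z)"
        using hardy_norm_add(2)[OF q hardy_norm_diff(1)[OF q Kf[OF f(1)] ug(2)] ug(2), of "u n"] g0' by simp
    qed
  qed (simp add: hardy_norm_nonneg)
  with ug(1) show ?thesis by blast
qed

text \<open>Entire functions have too rigid moduli to equal \<open>h\<close>, so \<open>h\<close> is
  approximated in L^1 by moduli, and a subsequence converges almost everywhere. The common bound
  permits dominated convergence for every exponent later.\<close>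

lemma bounded_modulus_approx:
  fixes h :: "complex \<Rightarrow> real"
  assumes [measurable]: "h \<in> borel_measurable borel" and h: "\<And>z. 0 \<le> h z" "\<And>z. h z \<le> M"
  shows "\<exists>Q :: nat \<Rightarrow> complex \<Rightarrow> complex. (\<forall>n. Q n holomorphic_on UNIV) \<and> (\<forall>n z. norm z = 1 \<longrightarrow> norm (Q n z) \<le> M + 1) \<and>
    (AE z in circle_measure. (\<lambda>n. norm (Q n z)) \<longlonglongrightarrow> h z)"
proof -
  have M: "0 \<le> M" using h[of 0] by linarith
  have hI: "integrable circle_measure h"
    by (rule integrable_circle_bounded[where B = M]) (use h in auto)
  have "\<exists>Q. Q holomorphic_on UNIV \<and> (\<forall>z. norm z = 1 \<longrightarrow> norm (Q z) \<le> M + 1) \<and>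
     (AVG z. \<bar>norm (Q z) - h z\<bar>) \<le> 2 / real (Suc n)" for n
  proof -
    define e where "e = 1 / real (Suc n)"
    have e: "0 < e" "e \<le> 1" by (auto simp: e_def)
    obtain k where k: "continuous_on UNIV k" "(AVG z. \<bar>h z - k z\<bar>) < e"
      using continuous_L1_dense[OF hI] e(1) by blast
    \<comment> \<open>Clamping to \<open>[0, M]\<close>, where \<open>h\<close> takes its values,
      does not increase the distance to \<open>h\<close> and gives the uniform bound.\<close>
    define k' where "k' = (\<lambda>z. max 0 (min M (k z)))"
    have ck': "continuous_on UNIV k'" unfolding k'_def by (intro continuous_intros k(1))
    obtain Q where Q: "Q holomorphic_on UNIV" "\<And>z. norm z = 1 \<Longrightarrow> \<bar>norm (Q z) - k' z\<bar> < e"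
      using continuous_modulus_approx[OF continuous_on_subset[OF ck'] _ e(1)] by (auto simp: k'_def)
    have [measurable]: "Q \<in> borel_measurable borel" "k \<in> borel_measurable borel"
      using borel_measurable_entire[OF Q(1)] borel_measurable_continuous_onI[OF k(1)] by auto
    have k'_le: "k' z \<le> M" for z using M by (simp add: k'_def)
    have bd: "norm (Q z) \<le> M + 1" if "norm z = 1" for z using Q(2)[OF that] k'_le[of z] e(2) by linarith
    have kI: "integrable circle_measure k"
      using k(1) by (intro integrable_circle_continuous) (auto intro: continuous_on_subset)
    have QI: "integrable circle_measure (\<lambda>z. norm (Q z))"
      by (rule integrable_circle_bounded[where B = "M + 1"]) (use bd in auto)
    have "(AVG z. \<bar>norm (Q z) - h z\<bar>) \<le> (AVG z. e + \<bar>h z - k z\<bar>)"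
    proof (rule integral_mono_AE)
      show "AE z in circle_measure. \<bar>norm (Q z) - h z\<bar> \<le> e + \<bar>h z - k z\<bar>"
        using AE_circle_measure
      proof eventually_elim
        case (elim z)
        have "\<bar>h z - k' z\<bar> \<le> \<bar>h z - k z\<bar>" using h[of z] M unfolding k'_def by (auto simp: max_def min_def)
        then show ?case using Q(2)[OF elim] by linarith
      qed
    qed (use hI kI QI in auto)
    also have "\<dots> = e + (AVG z. \<bar>h z - k z\<bar>)" using hI kI circle.prob_space by simp
    also have "\<dots> \<le> 2 / real (Suc n)" using k(2) by (simp add: e_def)
    finally show ?thesis using Q(1) bd by blast
  qed
  then obtain Q where Q: "\<And>n. Q n holomorphic_on UNIV" "\<And>n z. norm z = 1 \<Longrightarrow> norm (Q n z) \<le> M + 1"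
     "\<And>n. (AVG z. \<bar>norm (Q n z) - h z\<bar>) \<le> 2 / real (Suc n)" by metis
  have [measurable]: "Q n \<in> borel_measurable borel" for n by (rule borel_measurable_entire[OF Q(1)])
  have QI: "integrable circle_measure (\<lambda>z. norm (Q n z) - h z)" for n
    by (rule Bochner_Integration.integrable_diff[OF integrable_circle_bounded[where B = "M + 1"] hI]) (use Q(2) in auto)
  have "(\<lambda>n. AVG z. norm (norm (Q n z) - h z)) \<longlonglongrightarrow> 0"
  proof (rule tendsto_sandwich[OF _ _ tendsto_const])
    show "(\<lambda>n. 2 / real (Suc n)) \<longlonglongrightarrow> 0" by (rule LIMSEQ_Suc[OF lim_const_over_n])
  qed (use Q(3) in auto)
  from tendsto_L1_AE_subseq[OF QI this] obtain r :: "nat \<Rightarrow> nat"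
    where r: "AE z in circle_measure. (\<lambda>n. norm (Q (r n) z) - h z) \<longlonglongrightarrow> 0" by blast
  have "AE z in circle_measure. (\<lambda>n. norm (Q (r n) z)) \<longlonglongrightarrow> h z"
    using r by eventually_elim (simp add: LIM_zero_iff)
  then show ?thesis using Q(1,2) by (intro exI[of _ "\<lambda>n. Q (r n)"]) auto
qed

section \<open>Test functions and the lower estimate\<close>

context disc_self_map
begin

text \<open>A representative of \<open>F\<close> that is bounded everywhere and not only almost
  everywhere.\<close>

definition truncated_density :: "complex \<Rightarrow> real" where "truncated_density z = min (F z) (subordination_const + 1)"

lemma truncated_density: "0 \<le> truncated_density z" "truncated_density z \<le> subordination_const + 1" "AE z in circle_measure. F z = truncated_density z"
  and truncated_density_measurable [measurable]: "truncated_density \<in> borel_measurable borel"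
proof -
  show "0 \<le> truncated_density z" "truncated_density z \<le> subordination_const + 1"
    using density_nonneg[of z] subordination_const_ge by (auto simp: truncated_density_def)
  show "AE z in circle_measure. F z = truncated_density z" using AE_density_le by eventually_elim (simp add: truncated_density_def)
  show "truncated_density \<in> borel_measurable borel" unfolding truncated_density_def[abs_def] by measurable
qed

lemma density_in_circle_Lp:
  assumes "0 < s" shows "integrable circle_measure (\<lambda>z. F z powr s)" "F \<in> circle_Lp s"
proof -
  have "integrable circle_measure (\<lambda>z. truncated_density z powr s)"
    by (rule integrable_circle_bounded[where B = "(subordination_const + 1) powr s"])
       (use truncated_density(1,2) assms in \<open>auto intro!: powr_mono2\<close>)
  then show I: "integrable circle_measure (\<lambda>z. F z powr s)"
    by (rule integrable_cong_AE_imp) (use truncated_density(3) in \<open>auto elim!: eventually_mono\<close>)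
  have "F \<in> borel_measurable circle_measure" using borel_measurable_density by simp
  then show "F \<in> circle_Lp s" using I by (simp add: circle_Lp_def density_nonneg)
qed

text \<open>The extremal case of Hoelder's inequality: for \<open>|Q| = F^(1 / (p - q))\<close> both
  \<open>|Q|^p\<close> and \<open>F * |Q|^q\<close> equal \<open>F^s\<close>. The modulus of an
  entire function only approximates this choice, hence a value \<open>x\<close> strictly below the
  norm.\<close>

lemma near_optimal_test_function:
  assumes q: "1 \<le> q" "q < p" and s: "s = p / (p - q)" and x: "0 \<le> x" "x < circle_Lp_norm s F"
  shows "\<exists>Q. Q holomorphic_on UNIV \<and> (AVG z. norm (Q z) powr p) \<le> 1 \<and> x \<le> (AVG z. F z * norm (Q z) powr q)"
proof -
  define I where "I = (AVG z. truncated_density z powr s)"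
  have "circle_Lp_norm s F = (AVG z. truncated_density z powr s) powr (1 / s)"
  proof -
    have "(AVG z. \<bar>F z\<bar> powr s) = (AVG z. truncated_density z powr s)"
      using truncated_density(3) by (intro integral_cong_AE) (auto simp: density_nonneg elim!: eventually_mono)
    then show ?thesis unfolding circle_Lp_norm_def by simp
  qed
  then have norm_eq: "circle_Lp_norm s F = I powr (1 / s)" by (simp add: I_def)
  have "I \<noteq> 0" using x norm_eq by auto
  then have I: "0 < I" unfolding I_def by (simp add: order_less_le)
  define h where "h = (\<lambda>z. truncated_density z powr (1 / (p - q)))"
  define M where "M = (subordination_const + 1) powr (1 / (p - q))"
  have h: "0 \<le> h z" "h z \<le> M" for z
    using truncated_density(1,2)[of z] q by (auto simp: h_def M_def intro!: powr_mono2)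
  have [measurable]: "h \<in> borel_measurable borel" unfolding h_def by measurable
  obtain Q where Q: "\<And>n. Q n holomorphic_on UNIV" "\<And>n z. norm z = 1 \<Longrightarrow> norm (Q n z) \<le> M + 1"
    "AE z in circle_measure. (\<lambda>n. norm (Q n z)) \<longlonglongrightarrow> h z"
    using bounded_modulus_approx[of h M] h by auto
  have [measurable]: "Q n \<in> borel_measurable borel" for n by (rule borel_measurable_entire[OF Q(1)])
  define a where "a = (\<lambda>n. AVG z. norm (Q n z) powr p)"
  define b where "b = (\<lambda>n. AVG z. F z * norm (Q n z) powr q)"
  have hp: "h z powr p = truncated_density z powr s" for z using q by (simp add: h_def powr_powr s)
  have hq: "truncated_density z * h z powr q = truncated_density z powr s" for z
  proof -
    have "truncated_density z * h z powr q = truncated_density z powr 1 * truncated_density z powr (q / (p - q))" using truncated_density(1)[of z] by (simp add: h_def powr_powr)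
    also have "\<dots> = truncated_density z powr (1 + q / (p - q))" by (rule powr_add[symmetric])
    also have "1 + q / (p - q) = s" using q by (simp add: s field_simps)
    finally show ?thesis .
  qed
  have a: "a \<longlonglongrightarrow> I"
  proof -
    have "a \<longlonglongrightarrow> (AVG z. h z powr p)" unfolding a_def
    proof (rule integral_dominated_convergence[where w = "\<lambda>_. (M + 1) powr p"])
      show "AE z in circle_measure. (\<lambda>n. norm (Q n z) powr p) \<longlonglongrightarrow> h z powr p"
        using Q(3) by eventually_elim (use q in \<open>auto intro!: tendsto_powr'\<close>)
      show "AE z in circle_measure. norm (norm (Q n z) powr p) \<le> (M + 1) powr p" for n
        using AE_circle_measure by eventually_elim (use Q(2) q in \<open>auto intro!: powr_mono2\<close>)
    qed auto
    then show ?thesis by (simp add: hp I_def)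
  qed
  have b: "b \<longlonglongrightarrow> I"
  proof -
    have "b \<longlonglongrightarrow> (AVG z. truncated_density z * h z powr q)" unfolding b_def
    proof (rule integral_dominated_convergence[where w = "\<lambda>_. (subordination_const + 1) * (M + 1) powr q"])
      show "AE z in circle_measure. (\<lambda>n. F z * norm (Q n z) powr q) \<longlonglongrightarrow> truncated_density z * h z powr q"
        using Q(3) truncated_density(3) by eventually_elim (use q in \<open>auto intro!: tendsto_mult tendsto_powr'\<close>)
      show "AE z in circle_measure. norm (F z * norm (Q n z) powr q) \<le> (subordination_const + 1) * (M + 1) powr q" for n
        using AE_circle_measure truncated_density(3)
      proof eventually_elim
        case (elim z)
        have "truncated_density z * norm (Q n z) powr q \<le> (subordination_const + 1) * (M + 1) powr q"
          using Q(2)[OF elim(1)] q truncated_density(1,2)[of z] subordination_const_ge by (intro mult_mono powr_mono2) auto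
        then show ?case using elim truncated_density(1)[of z] by simp
      qed
    qed auto
    then show ?thesis by (simp add: hq I_def)
  qed
  have s1: "1 / s = 1 - q / p" using q by (simp add: s field_simps)
  \<comment> \<open>This quotient does not change when \<open>Q n\<close> is multiplied by a
    constant, so the normalization can wait until \<open>n\<close> is chosen.\<close>
  have "(\<lambda>n. b n / a n powr (q / p)) \<longlonglongrightarrow> I / I powr (q / p)"
    using I q by (intro tendsto_divide tendsto_powr a b tendsto_const) auto
  also have "I / I powr (q / p) = I powr (1 / s)" unfolding s1 using I by (simp add: powr_diff)
  finally have "eventually (\<lambda>n. x < b n / a n powr (q / p)) sequentially"
    using x(2) unfolding norm_eq by (rule order_tendstoD(1))
  moreover have "eventually (\<lambda>n. 0 < a n) sequentially" using a I by (rule order_tendstoD(1))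
  ultimately have "eventually (\<lambda>n. x < b n / a n powr (q / p) \<and> 0 < a n) sequentially" by eventually_elim simp
  then obtain n where n: "x < b n / a n powr (q / p)" "0 < a n" by (auto simp: eventually_sequentially)
  \<comment> \<open>Normalizes the p-th mean of the chosen \<open>Q n\<close> to 1.\<close>
  define c where "c = a n powr (- 1 / p)"
  have c: "0 < c" using n by (simp add: c_def)
  have "c powr p = a n powr (- 1)" "c powr q = a n powr (- (q / p))"
    using q by (simp_all add: c_def powr_powr)
  then have cp: "c powr p * a n = 1" and cq: "c powr q * b n = b n / a n powr (q / p)"
    using n by (simp_all add: powr_minus_divide)
  show ?thesis
  proof (intro exI[of _ "\<lambda>z. of_real c * Q n z"] conjI)
    show "(\<lambda>z. of_real c * Q n z) holomorphic_on UNIV" by (intro holomorphic_intros Q)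
    have "(AVG z. norm (of_real c * Q n z) powr p) = c powr p * a n"
      using c by (simp add: norm_mult powr_mult a_def)
    then show "(AVG z. norm (of_real c * Q n z) powr p) \<le> 1" using cp by simp
    have "(AVG z. F z * norm (of_real c * Q n z) powr q) = (AVG z. c powr q * (F z * norm (Q n z) powr q))"
      using c by (intro Bochner_Integration.integral_cong) (auto simp: norm_mult powr_mult)
    also have "\<dots> = c powr q * b n" by (simp add: b_def)
    finally show "x \<le> (AVG z. F z * norm (of_real c * Q n z) powr q)" using cq n by simp
  qed
qed

text \<open>On \<open>E\<close> the boundary values of \<open>\<phi>\<close> are unimodular, so the
  factor \<open>z ^ n\<close> does not change the contact part of the boundary integral; the rest of
  that integral is nonnegative and is dropped. The bound is therefore the same for all
  \<open>n\<close>.\<close>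

lemma composition_modulated_ge:
  assumes q: "1 \<le> q" and Q: "Q holomorphic_on UNIV" and h: "modulated Q n \<in> hardy_space q"
  shows "(AVG z. F z * norm (Q z) powr q) powr (1 / q) \<le> hardy_norm q (composition_operator \<phi> (modulated Q n))"
proof -
  let ?f = "\<lambda>z. z ^ n * Q z"
  have [measurable]: "Q \<in> borel_measurable borel" by (rule borel_measurable_entire[OF Q])
  have fh: "?f holomorphic_on ball 0 2" by (intro holomorphic_intros holomorphic_on_subset[OF Q]) auto
  have fm: "?f \<in> borel_measurable borel" by measurable
  have q0: "0 < q" using q by simp
  note C = hardy_norm_composition[OF h q borel hol self]
  note bl = boundary_limit[OF fm fh _ q0]
  have "(AVG z. F z * norm (Q z) powr q) = (AVG \<xi>. indicator E \<xi> * norm (Q (boundary \<xi>)) powr q)"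
    by (rule integral_contact[symmetric]) measurable
  also have "\<dots> = (AVG \<xi>. indicator E \<xi> * norm (?f (boundary \<xi>)) powr q)"
    by (intro Bochner_Integration.integral_cong) (auto simp: norm_mult norm_power contact_setD split: split_indicator)
  also have "\<dots> \<le> (AVG \<xi>. norm (?f (boundary \<xi>)) powr q)"
  proof (rule integral_mono)
    show I: "integrable circle_measure (\<lambda>\<xi>. norm (?f (boundary \<xi>)) powr q)" by (rule bl(1)) simp
    show "integrable circle_measure (\<lambda>\<xi>. indicator E \<xi> * norm (?f (boundary \<xi>)) powr q)"
      using integrable_mult_indicator[OF _ I, of E] by simp
  qed (auto split: split_indicator)
  also have "\<dots> \<le> hardy_norm q (composition_operator \<phi> (modulated Q n)) powr q"
  proof (rule LIMSEQ_le_const2)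
    show "(\<lambda>n. AVG \<xi>. norm (?f (\<phi> (of_real (dilation_radius n) * \<xi>))) powr q) \<longlonglongrightarrow> (AVG \<xi>. norm (?f (boundary \<xi>)) powr q)"
      by (rule bl(2)) simp
    have "(AVG \<xi>. norm (?f (\<phi> (of_real (dilation_radius k) * \<xi>))) powr q) \<le> hardy_norm q (composition_operator \<phi> (modulated Q n)) powr q" for k
    proof -
      note R = dilation_radius(1,2)[of k]
      have "(AVG \<xi>. norm (?f (\<phi> (of_real (dilation_radius k) * \<xi>))) powr q) = radial_mean q (composition_operator \<phi> (modulated Q n)) (dilation_radius k)"
        unfolding radial_mean_def
      proof (rule circle_integral_cong)
        have [measurable]: "composition_operator \<phi> (modulated Q n) \<in> borel_measurable borel" by (rule hardy_spaceD(3)[OF C(1)])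
        show "(\<lambda>z. norm (composition_operator \<phi> (modulated Q n) (of_real (dilation_radius k) * z)) powr q) \<in> borel_measurable borel" by measurable
        fix \<xi> :: complex assume "norm \<xi> = 1"
        then have "norm (of_real (dilation_radius k) * \<xi>) < 1" using R by (simp add: norm_mult)
        then show "norm (?f (\<phi> (of_real (dilation_radius k) * \<xi>))) powr q = norm (composition_operator \<phi> (modulated Q n) (of_real (dilation_radius k) * \<xi>)) powr q"
          using norm_phi_less by (simp add: composition_operator_def modulated_def disc_restriction_def)
      qed measurable
      also have "\<dots> \<le> hardy_norm q (composition_operator \<phi> (modulated Q n)) powr q"
        using R by (intro radial_mean_le_hardy_norm C(1) q0) auto
      finally show ?thesis .
    qed
    then show "\<exists>N. \<forall>k\<ge>N. (AVG \<xi>. norm (?f (\<phi> (of_real (dilation_radius k) * \<xi>))) powr q) \<le> hardy_norm q (composition_operator \<phi> (modulated Q n)) powr q" by blast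
  qed
  finally have "(AVG z. F z * norm (Q z) powr q) powr (1 / q) \<le> (hardy_norm q (composition_operator \<phi> (modulated Q n)) powr q) powr (1 / q)"
    using q by (intro powr_mono2) (auto simp: density_nonneg)
  then show ?thesis using q by (simp add: powr_powr hardy_norm_nonneg)
qed

lemma bdd_above_composition_minus_compact:
  assumes q: "1 \<le> q" "q < p" and K: "compact_operator p q K"
  shows "bdd_above ((\<lambda>f. hardy_norm q (\<lambda>z. composition_operator \<phi> f z - K f z)) ` {f \<in> hardy_space p. hardy_norm p f \<le> 1})"
proof -
  have p: "1 \<le> p" "0 < q" "q \<le> p" using q by auto
  obtain M where M: "\<And>f. f \<in> hardy_space p \<Longrightarrow> hardy_norm p f \<le> 1 \<Longrightarrow> hardy_norm q (K f) \<le> M"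
    using compact_operator_bounded[OF K q(1)] by blast
  have "bounded_operator p q (composition_operator \<phi>)"
    by (rule bounded_composition_operator[OF q(1) p(3) borel hol self])
  then obtain C where C: "\<And>f. f \<in> hardy_space p \<Longrightarrow> hardy_norm q (composition_operator \<phi> f) \<le> C * hardy_norm p f"
    and lin: "linear_operator p q (composition_operator \<phi>)"
    unfolding bounded_operator_def by blast
  have "hardy_norm q (\<lambda>z. composition_operator \<phi> f z - K f z) \<le> \<bar>C\<bar> + M" if f: "f \<in> hardy_space p" "hardy_norm p f \<le> 1" for f
  proof -
    have "composition_operator \<phi> f \<in> hardy_space q" "K f \<in> hardy_space q"
      by (rule linear_operator_mem[OF lin f(1)], rule compact_operator_mem[OF K f(1)])
    then have "hardy_norm q (\<lambda>z. composition_operator \<phi> f z - K f z) \<le> hardy_norm q (composition_operator \<phi> f) + hardy_norm q (K f)"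
      by (rule hardy_norm_diff(2)[OF q(1)])
    also have "hardy_norm q (composition_operator \<phi> f) \<le> \<bar>C\<bar> * 1"
    proof -
      have "C * hardy_norm p f \<le> \<bar>C\<bar> * 1" using f(2) hardy_norm_nonneg[of p f] by (intro mult_mono) auto
      then show ?thesis using C[OF f(1)] by linarith
    qed
    finally show ?thesis using M[OF f] by simp
  qed
  then show ?thesis by (intro bdd_aboveI2) auto
qed

text \<open>On modulated functions of norm at most 1 the composition operator keeps a fixed norm
  while \<open>K\<close> tends to 0 along a subsequence, so subtracting \<open>K\<close> does not
  help.\<close>

lemma operator_norm_ge:
  assumes q: "1 \<le> q" "q < p" and s: "s = p / (p - q)" and K: "compact_operator p q K"
  shows "circle_Lp_norm s F powr (1 / q) \<le> operator_norm p q (\<lambda>f z. composition_operator \<phi> f z - K f z)"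
proof -
  let ?L = "operator_norm p q (\<lambda>f z. composition_operator \<phi> f z - K f z)"
  have p: "1 \<le> p" "0 < q" "q \<le> p" using q by auto
  have le: "hardy_norm q (\<lambda>z. composition_operator \<phi> f z - K f z) \<le> ?L" if "f \<in> hardy_space p" "hardy_norm p f \<le> 1" for f
    unfolding operator_norm_def
    by (rule cSUP_upper[OF _ bdd_above_composition_minus_compact[OF q K]]) (use that in auto)
  have L0: "0 \<le> ?L"
    using le[OF hardy_space_0(1)] hardy_space_0(2)[of p] p hardy_norm_nonneg[of q "\<lambda>z. composition_operator \<phi> (\<lambda>z. 0) z - K (\<lambda>z. 0) z"] by force
  have "x \<le> ?L powr q" if x: "0 \<le> x" "x < circle_Lp_norm s F" for x
  proof -
    obtain Q where Q: "Q holomorphic_on UNIV" "(AVG z. norm (Q z) powr p) \<le> 1" "x \<le> (AVG z. F z * norm (Q z) powr q)"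
      using near_optimal_test_function[OF q s x] by blast
    have f: "modulated Q n \<in> hardy_space p" "hardy_norm p (modulated Q n) \<le> 1" for n
      using modulated_hardy[OF Q(1) p(1), of 1] Q(2) by auto
    have fq: "modulated Q n \<in> hardy_space q" for n by (rule hardy_norm_mono(1)[OF p(2,3) f(1)])
    obtain u :: "nat \<Rightarrow> nat" where u: "(\<lambda>n. hardy_norm q (K (modulated Q (u n)))) \<longlonglongrightarrow> 0"
      using compact_operator_modulated[OF K p(1) q(1) Q(1)] by blast
    have "x powr (1 / q) \<le> (AVG z. F z * norm (Q z) powr q) powr (1 / q)"
      using x Q(3) p by (intro powr_mono2) auto
    also have "\<dots> \<le> ?L"
    proof (rule LIMSEQ_le_const)
      show "(\<lambda>n. ?L + hardy_norm q (K (modulated Q (u n)))) \<longlonglongrightarrow> ?L"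
        using tendsto_add[OF tendsto_const u, of ?L] by simp
      have "(AVG z. F z * norm (Q z) powr q) powr (1 / q) \<le> ?L + hardy_norm q (K (modulated Q (u n)))" for n
      proof -
        let ?f = "modulated Q (u n)"
        have C: "composition_operator \<phi> ?f \<in> hardy_space q" by (rule hardy_norm_composition(1)[OF fq q(1) borel hol self])
        have Kf: "K ?f \<in> hardy_space q" by (rule compact_operator_mem[OF K f(1)])
        have "(AVG z. F z * norm (Q z) powr q) powr (1 / q) \<le> hardy_norm q (composition_operator \<phi> ?f)"
          by (rule composition_modulated_ge[OF q(1) Q(1) fq])
        also have "\<dots> \<le> hardy_norm q (\<lambda>z. composition_operator \<phi> ?f z - K ?f z) + hardy_norm q (K ?f)"
          using hardy_norm_add(2)[OF q(1) hardy_norm_diff(1)[OF q(1) C Kf] Kf] by simp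
        finally show ?thesis using le[OF f(1,2), of "u n"] by linarith
      qed
      then show "\<exists>N. \<forall>n\<ge>N. (AVG z. F z * norm (Q z) powr q) powr (1 / q) \<le> ?L + hardy_norm q (K (modulated Q (u n)))" by blast
    qed
    finally have "(x powr (1 / q)) powr q \<le> ?L powr q" using p by (intro powr_mono2) auto
    then show ?thesis using p x by (simp add: powr_powr)
  qed
  then have "circle_Lp_norm s F \<le> ?L powr q"
    by (cases "circle_Lp_norm s F \<le> 0") (auto intro: order_trans dense_le_bounded[of 0])
  then have "circle_Lp_norm s F powr (1 / q) \<le> (?L powr q) powr (1 / q)"
    using p by (intro powr_mono2) (auto simp: circle_Lp_norm_def)
  then show ?thesis using p L0 by (simp add: powr_powr)
qed

end

section \<open>The upper bound\<close>

lemma hardy_norm_bounded: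
  assumes q: "0 < q" and B: "0 \<le> B" and hol: "g holomorphic_on ball 0 1"
    and out: "\<And>z. z \<notin> ball 0 1 \<Longrightarrow> g z = 0" and le: "\<And>z. norm z < 1 \<Longrightarrow> norm (g z) \<le> B"
  shows "g \<in> hardy_space q" "hardy_norm q g \<le> B"
proof -
  have [measurable]: "g \<in> borel_measurable borel" by (rule borel_measurable_if_holomorphic[OF hol out])
  have "radial_mean q g r \<le> B powr q" if r: "0 \<le> r" "r < 1" for r
  proof -
    have "radial_mean q g r \<le> (AVG z. B powr q)" unfolding radial_mean_def
    proof (rule integral_mono_AE)
      show "integrable circle_measure (\<lambda>z. norm (g (of_real r * z)) powr q)"
        by (rule integrable_radial[OF _ hol q r]) simp
      show "AE z in circle_measure. norm (g (of_real r * z)) powr q \<le> B powr q"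
        using AE_circle_measure
      proof eventually_elim
        case (elim z)
        then show ?case using le[of "of_real r * z"] q r by (intro powr_mono2) (auto simp: norm_mult)
      qed
    qed simp
    then show ?thesis using circle.prob_space by simp
  qed
  then show "g \<in> hardy_space q" "hardy_norm q g \<le> B"
    using hardy_spaceI[OF q B hol out] by auto
qed

text \<open>Subordination to the identity once more, for the dilate of \<open>G\<close> that extends
  beyond the closed disc.\<close>

lemma radial_integral_mono:
  assumes G [measurable]: "G \<in> borel_measurable borel" and hol: "G holomorphic_on ball 0 1" and q: "1 \<le> q"
    and r: "0 \<le> r" "r \<le> r'" "0 < r'" "r' < 1"
  shows "(AVG \<xi>. norm (G (of_real r * \<xi>)) powr q) \<le> (AVG \<xi>. norm (G (of_real r' * \<xi>)) powr q)"
proof (cases "r = r'")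
  case False
  have rr: "0 \<le> r / r'" "r / r' < 1" using r False by auto
  have "(AVG \<xi>. norm (G (of_real r' * (of_real (r / r') * \<xi>))) powr q) \<le>
      (1 + norm (0::complex)) / (1 - norm (0::complex)) * (AVG \<xi>. norm (G (of_real r' * \<xi>)) powr q)"
    by (rule Littlewood_subordination(2)[OF _ holomorphic_dilation[OF hol r(3,4)] _ _ _ q rr, of "\<lambda>z. z"]) auto
  moreover have "of_real r' * (of_real (r / r') * \<xi>) = of_real r * \<xi>" for \<xi> :: complex using r by simp
  ultimately show ?thesis by simp
qed simp

definition dilated_composition :: "(complex \<Rightarrow> complex) \<Rightarrow> real \<Rightarrow> (complex \<Rightarrow> complex) \<Rightarrow> complex \<Rightarrow> complex" where
  "dilated_composition \<phi> \<rho> f = (\<lambda>z. if z \<in> ball 0 1 then f (of_real \<rho> * \<phi> z) else 0)"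

text \<open>Stand-ins for the unit ball of H^p that have honest values on the circle: dilates of
  unit-ball elements are of this kind.\<close>

definition disc_test :: "real \<Rightarrow> (complex \<Rightarrow> complex) \<Rightarrow> bool" where
  "disc_test p f \<longleftrightarrow> f \<in> borel_measurable borel \<and> (\<exists>R>1. f holomorphic_on ball 0 R) \<and> (AVG z. norm (f z) powr p) \<le> 1"

text \<open>The triangle inequality in the last bound is the origin of the factor 2. One radius
  \<open>R\<close> serves all functions involved.\<close>

lemma disc_test_dilation:
  assumes f: "disc_test p f" and p: "1 \<le> p" and \<rho>: "0 < \<rho>" "\<rho> < 1"
  obtains R where "1 < R" "f holomorphic_on ball 0 R" "(\<lambda>z. f (of_real \<rho> * z)) holomorphic_on ball 0 R"
    "(\<lambda>z. f z - f (of_real \<rho> * z)) holomorphic_on ball 0 R"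
    "(AVG z. norm (f (of_real \<rho> * z)) powr p) \<le> 1"
    "(AVG z. norm (f z - f (of_real \<rho> * z)) powr p) \<le> 2 powr p"
proof -
  obtain R where fm [measurable]: "f \<in> borel_measurable borel" and R: "1 < R" "f holomorphic_on ball 0 R"
    and le: "(AVG z. norm (f z) powr p) \<le> 1"
    using f unfolding disc_test_def by blast
  have d: "(\<lambda>z. f (of_real \<rho> * z)) holomorphic_on ball 0 R"
  proof -
    have im: "(\<lambda>z. of_real \<rho> * z) ` ball (0::complex) R \<subseteq> ball 0 R"
    proof (rule image_subsetI)
      fix z :: complex assume "z \<in> ball 0 R"
      then have "\<rho> * norm z \<le> 1 * norm z" using \<rho> by (intro mult_right_mono) auto
      then show "of_real \<rho> * z \<in> ball 0 R" using \<open>z \<in> ball 0 R\<close> \<rho> by (simp add: norm_mult)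
    qed
    show ?thesis by (rule holomorphic_on_compose_gen[OF _ R(2) im, unfolded o_def]) (intro holomorphic_intros)
  qed
  have "(AVG z. norm (f (of_real \<rho> * z)) powr p) \<le>
      (1 + norm (0::complex)) / (1 - norm (0::complex)) * (AVG z. norm (f z) powr p)"
    by (rule Littlewood_subordination(2)[OF fm R(2,1) _ _ _ p, of "\<lambda>z. z"]) (use \<rho> in auto)
  then have le2: "(AVG z. norm (f (of_real \<rho> * z)) powr p) \<le> 1" using le by simp
  have I: "integrable circle_measure (\<lambda>z. norm (g z) powr p)" if "g \<in> borel_measurable borel" "g holomorphic_on ball 0 R" for g
    using p that by (intro integrable_circle_continuous continuous_on_norm_powr holomorphic_continuous_on_sphere[OF that(2) R(1)]) auto
  have "(AVG z. norm (f z + - f (of_real \<rho> * z)) powr p) \<le> (1 + 1) powr p"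
    by (rule Minkowski_powr_bound(2)[OF p]) (use I[OF _ R(2)] I[OF _ d] le le2 in auto)
  then show ?thesis using that[OF R d holomorphic_on_diff[OF R(2) d] le2] by simp
qed

lemma disc_test_L1:
  assumes f: "disc_test p f" and p: "1 \<le> p"
  shows "(AVG z. norm (f z)) \<le> 1"
proof -
  obtain R where fm [measurable]: "f \<in> borel_measurable borel" and R: "1 < R" "f holomorphic_on ball 0 R"
    and le: "(AVG z. norm (f z) powr p) \<le> 1"
    using f unfolding disc_test_def by blast
  have "integrable circle_measure (\<lambda>z. norm (f z) powr p)"
    using p by (intro integrable_circle_continuous continuous_on_norm_powr holomorphic_continuous_on_sphere[OF R(2,1)]) auto
  then have "(AVG z. norm (f z) powr 1) \<le> (AVG z. norm (f z) powr p) powr (1 / p)"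
    using p by (intro integral_powr_le(2)) auto
  also have "\<dots> \<le> 1 powr (1 / p)" using le p by (intro powr_mono2) auto
  finally show ?thesis by simp
qed

text \<open>No splitting of the circle into near and far arcs: \<open>|k \<xi> - k z|\<close> is at
  most \<open>e / 2\<close> plus a multiple of \<open>|\<xi> - z|^2\<close>, and the Poisson mean of
  \<open>|\<xi> - z|^2\<close> is exactly \<open>2 - 2 * r\<close>.\<close>

lemma poisson_operator_uniform:
  fixes k :: "complex \<Rightarrow> real"
  assumes k: "continuous_on UNIV k" and e: "0 < e"
  shows "eventually (\<lambda>n. \<forall>\<xi>. norm \<xi> = 1 \<longrightarrow> \<bar>k \<xi> - poisson_operator (dilation_radius n) k \<xi>\<bar> \<le> e) sequentially"
proof -
  have ks: "continuous_on (sphere 0 1) k" using k by (rule continuous_on_subset) simp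
  have [measurable]: "k \<in> borel_measurable borel" by (rule borel_measurable_continuous_onI[OF k])
  obtain B where B: "\<And>z. norm z = 1 \<Longrightarrow> norm (k z) \<le> B" using continuous_on_sphere_bounded[OF ks] by blast
  have B0: "0 \<le> B" using B[of 1] by (simp add: order_trans[OF abs_ge_zero])
  have "uniformly_continuous_on (sphere 0 1) k" by (rule compact_uniformly_continuous[OF ks]) simp
  then obtain \<delta> where \<delta>: "0 < \<delta>" "\<And>x y. norm x = 1 \<Longrightarrow> norm y = 1 \<Longrightarrow> dist y x < \<delta> \<Longrightarrow> dist (k y) (k x) < e / 2"
    unfolding uniformly_continuous_on_def using e by (metis half_gt_zero mem_sphere_0)
  \<comment> \<open>Where \<open>z\<close> is at distance at least \<open>\<delta>\<close> from
    \<open>\<xi>\<close>, the term \<open>L * |\<xi> - z|^2\<close> exceeds the trivial bound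
    \<open>2 * B\<close>.\<close>
  define L where "L = 2 * B / \<delta>\<^sup>2"
  have L: "0 \<le> L" using B0 by (simp add: L_def)
  have kI: "integrable circle_measure k" by (rule integrable_circle_continuous[OF _ ks]) simp
  have mod: "\<bar>k \<xi> - k z\<bar> \<le> e / 2 + L * (norm (\<xi> - z))\<^sup>2" if "norm \<xi> = 1" "norm z = 1" for \<xi> z
  proof (cases "dist \<xi> z < \<delta>")
    case True
    then have "\<bar>k \<xi> - k z\<bar> < e / 2" using \<delta>(2)[of z \<xi>] that by (simp add: dist_real_def)
    moreover have "0 \<le> L * (norm (\<xi> - z))\<^sup>2" using L by simp
    ultimately show ?thesis by linarith
  next
    case False
    then have "\<delta>\<^sup>2 \<le> (norm (\<xi> - z))\<^sup>2" using \<delta>(1) by (intro power_mono) (auto simp: dist_norm)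
    then have "2 * B \<le> L * (norm (\<xi> - z))\<^sup>2"
      using \<delta>(1) B0 mult_left_mono[of "\<delta>\<^sup>2" "(norm (\<xi> - z))\<^sup>2" L] L by (simp add: L_def)
    moreover have "\<bar>k \<xi> - k z\<bar> \<le> 2 * B" using B[OF that(1)] B[OF that(2)] by simp
    ultimately show ?thesis using e by linarith
  qed
  have main: "\<bar>k \<xi> - poisson_operator r k \<xi>\<bar> \<le> e / 2 + L * (2 - 2 * r)" if r: "0 \<le> r" "r < 1" and \<xi>: "norm \<xi> = 1" for r \<xi>
  proof -
    define w where "w = of_real r * \<xi>"
    have w: "norm w < 1" using r \<xi> by (simp add: w_def norm_mult)
    note PK = integral_poisson_kernel[OF w]
    have h: "(\<lambda>z. z * cnj \<xi>) holomorphic_on ball 0 2" by (intro holomorphic_intros)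
    have hm: "(\<lambda>z. z * cnj \<xi>) \<in> borel_measurable borel" by measurable
    note PF = poisson_formula[OF hm h _ w]
    have sq: "(norm (\<xi> - z))\<^sup>2 = 2 - 2 * Re (z * cnj \<xi>)" if "norm z = 1" for z
    proof -
      have "(norm (\<xi> - z))\<^sup>2 = (norm \<xi>)\<^sup>2 + (norm z)\<^sup>2 - 2 * Re (z * cnj \<xi>)"
        unfolding cmod_power2 by (simp add: power2_eq_square algebra_simps)
      then show ?thesis using that \<xi> by simp
    qed
    have RI: "integrable circle_measure (\<lambda>z. poisson_kernel w z * Re (z * cnj \<xi>))"
      using integrable_Re[OF PF(1)] by simp
    \<comment> \<open>The Poisson formula for the linear function \<open>z * cnj \<xi>\<close>,
      whose value at \<open>r * \<xi>\<close> is \<open>r\<close>.\<close>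
    have RV: "(AVG z. poisson_kernel w z * Re (z * cnj \<xi>)) = r"
    proof -
      have "(AVG z. Re (poisson_kernel w z *\<^sub>R (z * cnj \<xi>))) = Re (w * cnj \<xi>)"
        using integral_Re[OF PF(1)] PF(2) by simp
      also have "w * cnj \<xi> = of_real r" using \<xi> by (simp add: w_def mult.assoc complex_norm_square[symmetric])
      finally show ?thesis by simp
    qed
    have I1: "integrable circle_measure (\<lambda>z. poisson_kernel w z * (k \<xi> - k z))"
      using integrable_poisson_mult[of "\<lambda>z. k \<xi> - k z" w] kI w by simp
    have "k \<xi> - poisson_operator r k \<xi> = (AVG z. poisson_kernel w z * (k \<xi> - k z))"
      using PK integrable_poisson_mult[OF kI w] unfolding poisson_operator_def w_def[symmetric]
      by (simp add: right_diff_distrib)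
    then have "\<bar>k \<xi> - poisson_operator r k \<xi>\<bar> \<le> (AVG z. \<bar>poisson_kernel w z * (k \<xi> - k z)\<bar>)"
      using integral_norm_bound[of circle_measure "\<lambda>z. poisson_kernel w z * (k \<xi> - k z)"] by simp
    also have "\<dots> \<le> (AVG z. (e / 2 + 2 * L) * poisson_kernel w z - 2 * L * (poisson_kernel w z * Re (z * cnj \<xi>)))"
    proof (rule integral_mono_AE)
      show "AE z in circle_measure. \<bar>poisson_kernel w z * (k \<xi> - k z)\<bar> \<le> (e / 2 + 2 * L) * poisson_kernel w z - 2 * L * (poisson_kernel w z * Re (z * cnj \<xi>))"
        using AE_circle_measure
      proof eventually_elim
        case (elim z)
        have P0: "0 \<le> poisson_kernel w z" by (rule poisson_kernel_nonneg[OF w])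
        have "\<bar>poisson_kernel w z * (k \<xi> - k z)\<bar> = poisson_kernel w z * \<bar>k \<xi> - k z\<bar>" using P0 by (simp add: abs_mult)
        also have "\<dots> \<le> poisson_kernel w z * (e / 2 + L * (norm (\<xi> - z))\<^sup>2)"
          by (intro mult_left_mono mod \<xi> elim P0)
        finally show ?case unfolding sq[OF elim] by (simp only: algebra_simps)
      qed
    qed (use I1 PK(1) RI in auto)
    also have "\<dots> = (e / 2 + 2 * L) * 1 - 2 * L * r"
      using PK RI RV by (subst Bochner_Integration.integral_diff) (auto simp del: minus_complex.sel times_complex.sel)
    finally show ?thesis by (simp add: algebra_simps)
  qed
  have "(\<lambda>n. e / 2 + L * (2 - 2 * dilation_radius n)) \<longlonglongrightarrow> e / 2 + L * (2 - 2 * 1)"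
    by (intro tendsto_intros dilation_radius)
  then have "eventually (\<lambda>n. e / 2 + L * (2 - 2 * dilation_radius n) < e) sequentially"
    using e by (intro order_tendstoD(2)[where y = "e / 2 + L * (2 - 2 * 1)"]) auto
  then show ?thesis
  proof eventually_elim
    case (elim n)
    then show ?case using main dilation_radius(1,2)[of n] by (meson less_imp_le order_trans)
  qed
qed

text \<open>Uniform convergence for continuous functions extends to L^1 by density, the Poisson
  operators being contractions there.\<close>

lemma poisson_operator_L1_limit:
  fixes a :: "complex \<Rightarrow> real"
  assumes a: "integrable circle_measure a"
  shows "(\<lambda>n. AVG \<xi>. \<bar>a \<xi> - poisson_operator (dilation_radius n) a \<xi>\<bar>) \<longlonglongrightarrow> 0"
proof (rule order_tendstoI)
  fix y :: real assume "y < 0"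
  then show "eventually (\<lambda>n. y < (AVG \<xi>. \<bar>a \<xi> - poisson_operator (dilation_radius n) a \<xi>\<bar>)) sequentially"
    by (auto intro!: always_eventually less_le_trans[of y 0])
next
  fix e :: real assume e: "0 < e"
  have e3: "0 < e / 4" using e by simp
  obtain k where k: "continuous_on UNIV k" "(AVG z. \<bar>a z - k z\<bar>) < e / 4"
    using continuous_L1_dense[OF a] e3 by blast
  have kI: "integrable circle_measure k"
    using k(1) by (intro integrable_circle_continuous) (auto intro: continuous_on_subset borel_measurable_continuous_onI)
  have akI: "integrable circle_measure (\<lambda>z. k z - a z)" using a kI by simp
  from poisson_operator_uniform[OF k(1) e3]
  show "eventually (\<lambda>n. (AVG \<xi>. \<bar>a \<xi> - poisson_operator (dilation_radius n) a \<xi>\<bar>) < e) sequentially"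
  proof eventually_elim
    case (elim n)
    note r = less_imp_le[OF dilation_radius(1)[of n]] dilation_radius(2)[of n]
    let ?P = "\<lambda>u. poisson_operator (dilation_radius n) u"
    have PI: "integrable circle_measure (?P u)" if "integrable circle_measure u" for u :: "complex \<Rightarrow> real"
      by (rule integrable_poisson_operator[OF that r])
    have pw: "\<bar>a \<xi> - ?P a \<xi>\<bar> \<le> \<bar>a \<xi> - k \<xi>\<bar> + e / 4 + \<bar>?P (\<lambda>z. k z - a z) \<xi>\<bar>" if \<xi>: "norm \<xi> = 1" for \<xi>
    proof -
      have "?P (\<lambda>z. a z + (k z - a z)) \<xi> = ?P a \<xi> + ?P (\<lambda>z. k z - a z) \<xi>"
        by (rule poisson_operator_add[OF a akI r \<xi>])
      then have "?P k \<xi> = ?P a \<xi> + ?P (\<lambda>z. k z - a z) \<xi>" by simp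
      moreover have "\<bar>k \<xi> - ?P k \<xi>\<bar> \<le> e / 4" using elim \<xi> by blast
      ultimately show ?thesis by linarith
    qed
    have "(AVG \<xi>. \<bar>a \<xi> - ?P a \<xi>\<bar>) \<le> (AVG \<xi>. \<bar>a \<xi> - k \<xi>\<bar> + e / 4 + \<bar>?P (\<lambda>z. k z - a z) \<xi>\<bar>)"
    proof (rule integral_mono_AE)
      show "AE \<xi> in circle_measure. \<bar>a \<xi> - ?P a \<xi>\<bar> \<le> \<bar>a \<xi> - k \<xi>\<bar> + e / 4 + \<bar>?P (\<lambda>z. k z - a z) \<xi>\<bar>"
        using AE_circle_measure by eventually_elim (rule pw)
    qed (use a kI PI[OF a] PI[OF akI] in auto)
    also have "\<dots> = (AVG \<xi>. \<bar>a \<xi> - k \<xi>\<bar>) + e / 4 + (AVG \<xi>. \<bar>?P (\<lambda>z. k z - a z) \<xi>\<bar>)"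
      using a kI PI[OF akI] circle.prob_space by simp
    also have "(AVG \<xi>. \<bar>?P (\<lambda>z. k z - a z) \<xi>\<bar>) \<le> (AVG \<xi>. \<bar>k \<xi> - a \<xi>\<bar>)"
    proof -
      have "(\<lambda>z. k z - a z) \<in> borel_measurable borel" by (rule borel_measurable_circle_integrable[OF akI])
      from poisson_operator_contraction(2)[OF order_refl this _ r] show ?thesis using akI by simp
    qed
    also have "(AVG \<xi>. \<bar>k \<xi> - a \<xi>\<bar>) = (AVG \<xi>. \<bar>a \<xi> - k \<xi>\<bar>)"
      by (simp add: abs_minus_commute)
    finally show ?case using k(2) e by linarith
  qed
qed

section \<open>Compact approximation of the composition operator\<close>

context disc_self_map
begin

lemma dilated_composition_holomorphic:
  assumes f: "f holomorphic_on ball 0 1" and \<rho>: "0 < \<rho>" "\<rho> < 1"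
  shows "dilated_composition \<phi> \<rho> f holomorphic_on ball 0 1"
    and "\<And>z. norm z < 1 \<Longrightarrow> of_real \<rho> * \<phi> z \<in> cball 0 \<rho>"
proof -
  show b: "of_real \<rho> * \<phi> z \<in> cball 0 \<rho>" if "norm z < 1" for z
    using norm_phi_less[OF that] \<rho> mult_left_mono[of "norm (\<phi> z)" 1 \<rho>] by (simp add: norm_mult)
  have "(\<lambda>z. f (of_real \<rho> * \<phi> z)) holomorphic_on ball 0 1"
  proof (rule holomorphic_on_compose_gen[OF _ f, unfolded o_def])
    show "(\<lambda>z. of_real \<rho> * \<phi> z) holomorphic_on ball 0 1" by (intro holomorphic_intros hol)
    show "(\<lambda>z. of_real \<rho> * \<phi> z) ` ball 0 1 \<subseteq> ball 0 1" using b \<rho> by fastforce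
  qed
  then show "dilated_composition \<phi> \<rho> f holomorphic_on ball 0 1"
    by (rule holomorphic_transform) (simp add: dilated_composition_def)
qed

text \<open>The operator sees \<open>f\<close> only on the compact disc of radius
  \<open>\<rho>\<close>, where bounded sequences of H^p have uniformly convergent subsequences by
  Montel's theorem.\<close>

lemma compact_dilated_composition:
  assumes p: "1 \<le> p" "1 \<le> q" and \<rho>: "0 < \<rho>" "\<rho> < 1"
  shows "compact_operator p q (dilated_composition \<phi> \<rho>)"
proof -
  note hd = dilated_composition_holomorphic[OF _ \<rho>]
  have q0: "0 < q" using p by simp
  \<comment> \<open>Stated for every holomorphic \<open>f\<close>, since it is also applied to the
    limit from Montel's theorem, whose membership in H^p is not established.\<close>
  have mem: "dilated_composition \<phi> \<rho> f \<in> hardy_space q" if f: "f holomorphic_on ball 0 1" for f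
  proof -
    have "compact (f ` cball 0 \<rho>)"
      using \<rho> by (intro compact_continuous_image holomorphic_on_imp_continuous_on holomorphic_on_subset[OF f]) auto
    from compact_imp_bounded[OF this] obtain B where B: "\<And>z. z \<in> cball 0 \<rho> \<Longrightarrow> norm (f z) \<le> B"
      unfolding bounded_iff by blast
    have "0 \<in> cball (0::complex) \<rho>" using \<rho> by simp
    from order_trans[OF norm_ge_zero B[OF this]] have B0: "0 \<le> B" .
    show ?thesis
      by (rule hardy_norm_bounded(1)[OF q0 B0 hd(1)[OF f]])
         (use B hd(2)[OF f] in \<open>auto simp: dilated_composition_def simp del: mem_cball_0\<close>)
  qed
  have lin: "linear_operator p q (dilated_composition \<phi> \<rho>)"
    unfolding linear_operator_def using mem hardy_spaceD(1)
    by (simp add: dilated_composition_def fun_eq_iff)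
  have "\<exists>u g. strict_mono (u :: nat \<Rightarrow> nat) \<and> g \<in> hardy_space q \<and>
       (\<lambda>n. hardy_norm q (\<lambda>z. dilated_composition \<phi> \<rho> (f (u n)) z - g z)) \<longlonglongrightarrow> 0"
    if f: "\<And>n. f n \<in> hardy_space p" and bdd: "bdd_above (range (\<lambda>n. hardy_norm p (f n)))" for f :: "nat \<Rightarrow> complex \<Rightarrow> complex"
  proof -
    obtain B where B: "\<And>n. hardy_norm p (f n) \<le> B" using bdd unfolding bdd_above_def by blast
    define H where "H = {h. h holomorphic_on ball 0 1 \<and> (\<forall>z\<in>ball 0 1. norm (h z) \<le> B / (1 - norm z))}"
    have fH: "range f \<subseteq> H"
    proof
      fix h assume "h \<in> range f"
      then obtain n where h: "h = f n" by blast
      have "norm (f n z) \<le> B / (1 - norm z)" if "norm z < 1" for z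
        using hardy_point_bound[OF f p(1) that] B[of n] that by (meson divide_right_mono order_trans diff_ge_0_iff_ge less_imp_le)
      then show "h \<in> H" using hardy_spaceD(1)[OF f] unfolding h H_def by auto
    qed
    have "open (ball (0::complex) 1)" by simp
    moreover have "h holomorphic_on ball 0 1" if "h \<in> H" for h using that by (simp add: H_def)
    moreover have "\<exists>b. \<forall>h\<in>H. \<forall>z\<in>S. norm (h z) \<le> b" if S: "compact S" "S \<subseteq> ball 0 1" for S
    proof -
      have "1 - norm z \<noteq> 0" if "z \<in> S" for z using S(2) that by force
      then have "compact ((\<lambda>z. B / (1 - norm z)) ` S)" by (intro compact_continuous_image continuous_intros S) auto
      from compact_imp_bounded[OF this] obtain b where b: "\<And>z. z \<in> S \<Longrightarrow> norm (B / (1 - norm z)) \<le> b"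
        unfolding bounded_iff by blast
      have "norm (h z) \<le> b" if "h \<in> H" "z \<in> S" for h z
      proof -
        have "norm (h z) \<le> B / (1 - norm z)" using that S(2) by (auto simp: H_def)
        also have "\<dots> \<le> norm (B / (1 - norm z))" unfolding real_norm_def by (rule abs_ge_self)
        also have "\<dots> \<le> b" by (rule b[OF that(2)])
        finally show ?thesis .
      qed
      then show ?thesis by blast
    qed
    ultimately obtain g r where g: "g holomorphic_on ball 0 1" "strict_mono (r :: nat \<Rightarrow> nat)"
      "\<And>S. compact S \<Longrightarrow> S \<subseteq> ball 0 1 \<Longrightarrow> uniform_limit S (f \<circ> r) g sequentially"
      using Montel[OF _ _ _ fH] by (metis (no_types, lifting))
    have ul: "uniform_limit (cball 0 \<rho>) (f \<circ> r) g sequentially"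
      by (rule g(3)) (use \<rho> in auto)
    have "(\<lambda>n. hardy_norm q (\<lambda>z. dilated_composition \<phi> \<rho> (f (r n)) z - dilated_composition \<phi> \<rho> g z)) \<longlonglongrightarrow> 0"
    proof (rule tendstoI)
      fix e :: real assume e: "0 < e"
      then have "0 < e / 2" by simp
      from uniform_limitD[OF ul this]
      show "\<forall>\<^sub>F n in sequentially. dist (hardy_norm q (\<lambda>z. dilated_composition \<phi> \<rho> (f (r n)) z - dilated_composition \<phi> \<rho> g z)) 0 < e"
      proof eventually_elim
        case (elim n)
        have "hardy_norm q (\<lambda>z. dilated_composition \<phi> \<rho> (f (r n)) z - dilated_composition \<phi> \<rho> g z) \<le> e / 2"
        proof (rule hardy_norm_bounded(2)[OF q0])
          show "(\<lambda>z. dilated_composition \<phi> \<rho> (f (r n)) z - dilated_composition \<phi> \<rho> g z) holomorphic_on ball 0 1"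
            by (intro holomorphic_on_diff hd(1) g(1) hardy_spaceD(1)[OF f])
          fix z :: complex assume z: "norm z < 1"
          have "dist ((f \<circ> r) n (of_real \<rho> * \<phi> z)) (g (of_real \<rho> * \<phi> z)) < e / 2"
            using elim hd(2)[OF g(1) z] by blast
          then show "norm (dilated_composition \<phi> \<rho> (f (r n)) z - dilated_composition \<phi> \<rho> g z) \<le> e / 2"
            using z by (simp add: dilated_composition_def dist_norm)
        qed (use e in \<open>auto simp: dilated_composition_def\<close>)
        then show ?case using e hardy_norm_nonneg by simp
      qed
    qed
    then show ?thesis using g(2) mem[OF g(1)] by blast
  qed
  with lin show ?thesis unfolding compact_operator_def by blast
qed

text \<open>Two limits in the right order. For a fixed dilate of \<open>u\<close> the means over
  inner circles are at most the boundary integral, by monotonicity in the radius; then the dilation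
  is removed on each inner circle separately. Dilations commute with each other, so the dilated
  difference is the difference formed from the dilate.\<close>

lemma dilated_difference_norm_le:
  assumes p: "1 \<le> q" "q \<le> p" and \<rho>: "0 < \<rho>" "\<rho> < 1" and Y: "0 \<le> Y"
    and le: "\<And>f. disc_test p f \<Longrightarrow> (AVG \<xi>. norm (f (boundary \<xi>) - f (of_real \<rho> * boundary \<xi>)) powr q) \<le> Y"
    and u: "u \<in> hardy_space p" "hardy_norm p u \<le> 1"
  shows "hardy_norm q (\<lambda>z. composition_operator \<phi> u z - dilated_composition \<phi> \<rho> u z) \<le> Y powr (1 / q)"
proof -
  note uh = hardy_spaceD(1)[OF u(1)] and um [measurable] = hardy_spaceD(3)[OF u(1)]
  have q0: "0 < q" and p1: "1 \<le> p" using p by auto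
  define h where "h = (\<lambda>w. u w - u (of_real \<rho> * w))"
  have hm [measurable]: "h \<in> borel_measurable borel" unfolding h_def by measurable
  have "ball (0::complex) 1 \<subseteq> ball 0 (1 / \<rho>)" using \<rho> by (intro subset_ball) auto
  then have hh: "h holomorphic_on ball 0 1" unfolding h_def
    by (intro holomorphic_on_diff uh holomorphic_on_subset[OF holomorphic_dilation(1)[OF uh \<rho>]])
  have step: "(AVG \<xi>. norm (h (of_real (dilation_radius n) * \<phi> (of_real r * \<xi>))) powr q) \<le> Y"
    if r: "0 \<le> r" "r < 1" for n r
  proof -
    note R = dilation_radius(1,2)[of n]
    define f where "f = (\<lambda>z. u (of_real (dilation_radius n) * z))"
    define g where "g = (\<lambda>z. h (of_real (dilation_radius n) * z))"
    note fh = holomorphic_dilation[OF uh R, folded f_def]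
    note gh = holomorphic_dilation[OF hh R, folded g_def]
    have [measurable]: "f \<in> borel_measurable borel" "g \<in> borel_measurable borel" unfolding f_def g_def by measurable
    have gf: "g w = f w - f (of_real \<rho> * w)" for w by (simp add: g_def f_def h_def mult_ac)
    have "(AVG z. norm (f z) powr p) = radial_mean p u (dilation_radius n)" by (simp add: f_def radial_mean_def)
    also have "\<dots> \<le> hardy_norm p u powr p" using R p1 by (intro radial_mean_le_hardy_norm u) auto
    also have "\<dots> \<le> 1 powr p" using u(2) p1 by (intro powr_mono2) (auto simp: hardy_norm_nonneg)
    finally have "disc_test p f" unfolding disc_test_def using fh by auto
    from le[OF this] have bY: "(AVG \<xi>. norm (g (boundary \<xi>)) powr q) \<le> Y" by (simp add: gf)
    have Gh: "(\<lambda>z. g (\<phi> z)) holomorphic_on ball 0 1"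
    proof (rule holomorphic_on_compose_gen[OF hol gh(1), unfolded o_def])
      show "\<phi> ` ball 0 1 \<subseteq> ball 0 (1 / dilation_radius n)"
        using self gh(2) by (auto simp: image_subset_iff intro: less_trans)
    qed
    have "(AVG \<xi>. norm (g (\<phi> (of_real r * \<xi>))) powr q) \<le> (AVG \<xi>. norm (g (boundary \<xi>)) powr q)"
    proof (rule LIMSEQ_le_const)
      show "(\<lambda>k. AVG \<xi>. norm (g (\<phi> (of_real (dilation_radius k) * \<xi>))) powr q) \<longlonglongrightarrow> (AVG \<xi>. norm (g (boundary \<xi>)) powr q)"
        by (rule boundary_limit(2)[OF _ gh q0]) measurable
      have "eventually (\<lambda>k. r < dilation_radius k) sequentially" using dilation_radius(3) r(2) by (rule order_tendstoD(1))
      then have "eventually (\<lambda>k. (AVG \<xi>. norm (g (\<phi> (of_real r * \<xi>))) powr q) \<le> (AVG \<xi>. norm (g (\<phi> (of_real (dilation_radius k) * \<xi>))) powr q)) sequentially"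
      proof eventually_elim
        case (elim k)
        then show ?case using radial_integral_mono[OF _ Gh p(1) r(1), of "dilation_radius k"] dilation_radius(1,2)[of k] by simp
      qed
      then show "\<exists>N. \<forall>k\<ge>N. (AVG \<xi>. norm (g (\<phi> (of_real r * \<xi>))) powr q) \<le> (AVG \<xi>. norm (g (\<phi> (of_real (dilation_radius k) * \<xi>))) powr q)"
        by (simp add: eventually_sequentially)
    qed
    with bY show ?thesis by (simp add: g_def)
  qed
  show ?thesis
  proof (rule hardy_spaceI(2)[OF q0])
    let ?T = "\<lambda>z. composition_operator \<phi> u z - dilated_composition \<phi> \<rho> u z"
    have C: "composition_operator \<phi> u \<in> hardy_space p" by (rule hardy_norm_composition(1)[OF u(1) p1 borel hol self])
    show Th: "?T holomorphic_on ball 0 1"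
      by (intro holomorphic_on_diff hardy_spaceD(1)[OF C] dilated_composition_holomorphic(1)[OF uh \<rho>])
    show out: "\<And>z. z \<notin> ball 0 1 \<Longrightarrow> ?T z = 0" by (auto simp: composition_operator_def dilated_composition_def)
    have [measurable]: "?T \<in> borel_measurable borel" by (rule borel_measurable_if_holomorphic[OF Th out])
    fix r :: real assume r: "0 \<le> r" "r < 1"
    have "radial_mean q ?T r = (AVG \<xi>. norm (h (\<phi> (of_real r * \<xi>))) powr q)"
      unfolding radial_mean_def
    proof (rule circle_integral_cong)
      show "(\<lambda>z. norm (?T (of_real r * z)) powr q) \<in> borel_measurable borel"
        using \<open>?T \<in> borel_measurable borel\<close> by measurable
      fix \<xi> :: complex assume "norm \<xi> = 1"
      then have "norm (of_real r * \<xi>) < 1" using r by (simp add: norm_mult)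
      then show "norm (?T (of_real r * \<xi>)) powr q = norm (h (\<phi> (of_real r * \<xi>))) powr q"
        by (simp add: composition_operator_def dilated_composition_def h_def)
    qed measurable
    also have "\<dots> \<le> Y"
    proof (rule LIMSEQ_le_const2)
      show "(\<lambda>n. AVG \<xi>. norm (h (of_real (dilation_radius n) * \<phi> (of_real r * \<xi>))) powr q) \<longlonglongrightarrow> (AVG \<xi>. norm (h (\<phi> (of_real r * \<xi>))) powr q)"
        by (rule radial_mean_dilation_limit[OF hm hh borel hol self q0 r]) (use dilation_radius in \<open>auto intro: less_imp_le\<close>)
      show "\<exists>N. \<forall>n\<ge>N. (AVG \<xi>. norm (h (of_real (dilation_radius n) * \<phi> (of_real r * \<xi>))) powr q) \<le> Y"
        using step[OF r] by blast
    qed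
    also have "Y = (Y powr (1 / q)) powr q" using Y q0 by (simp add: powr_powr)
    finally show "radial_mean q ?T r \<le> (Y powr (1 / q)) powr q" .
  qed simp
qed

text \<open>Where \<open>|boundary \<xi>| \<le> t\<close>, the difference is small by
  \<open>disc_dilation_bound\<close>. The shell \<open>t < |boundary \<xi>| < 1\<close> has small
  measure for \<open>t\<close> close to 1, and there Hoelder's inequality trades the bounded L^p
  norm for smallness in L^q.\<close>

lemma off_contact_small:
  assumes q: "1 \<le> q" "q < p" and e: "0 < e"
  shows "eventually (\<lambda>n. \<forall>f. disc_test p f \<longrightarrow>
    (AVG \<xi>. indicator (- E) \<xi> * norm (f (boundary \<xi>) - f (of_real (dilation_radius n) * boundary \<xi>)) powr q) \<le> e) sequentially"
proof -
  define s where "s = p / (p - q)"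
  have s: "1 < s" "1 < p / q" "1 / s + 1 / (p / q) = 1" using q by (auto simp: s_def field_simps)
  have p1: "1 \<le> p" "0 < q" using q by auto
  define S where "S = (\<lambda>t. {\<xi>. t < norm (boundary \<xi>) \<and> norm (boundary \<xi>) < 1})"
  have Sm [measurable]: "S t \<in> sets borel" for t unfolding S_def by measurable
  \<comment> \<open>Bounds the L^p factor in Hoelder's inequality for all test functions at once:
    subordination together with the bound \<open>2 powr p\<close> for the difference.\<close>
  define A where "A = (subordination_const * 2 powr p) powr (q / p)"
  have mono: "dilation_radius m \<le> dilation_radius n" if "m \<le> n" for m n
    using that by (auto simp: dilation_radius_def intro!: divide_left_mono)
  have "(\<lambda>n. measure circle_measure (S (dilation_radius n))) \<longlonglongrightarrow> measure circle_measure (\<Inter>n. S (dilation_radius n))"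
    by (rule circle.finite_Lim_measure_decseq) (auto simp: decseq_def S_def intro: le_less_trans[OF mono])
  moreover have "(\<Inter>n. S (dilation_radius n)) = {}"
  proof (rule equals0I)
    fix \<xi> assume "\<xi> \<in> (\<Inter>n. S (dilation_radius n))"
    then have "\<And>n. dilation_radius n < norm (boundary \<xi>)" "norm (boundary \<xi>) < 1" by (auto simp: S_def)
    then show False using LIMSEQ_le_const2[OF dilation_radius(3), of "norm (boundary \<xi>)"] by (meson less_imp_le not_less)
  qed
  ultimately have "(\<lambda>n. measure circle_measure (S (dilation_radius n))) \<longlonglongrightarrow> 0" by simp
  then have "(\<lambda>n. measure circle_measure (S (dilation_radius n)) powr (1 / s) * A) \<longlonglongrightarrow> 0 powr (1 / s) * A"
    using s by (intro tendsto_mult tendsto_powr' tendsto_const) auto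
  then have "eventually (\<lambda>n. measure circle_measure (S (dilation_radius n)) powr (1 / s) * A < e / 2) sequentially"
    by (rule order_tendstoD(2)) (use e in simp)
  then obtain m where m: "measure circle_measure (S (dilation_radius m)) powr (1 / s) * A < e / 2"
    by (auto simp: eventually_sequentially)
  \<comment> \<open>\<open>t\<close> is fixed before the dilation radius: the estimate inside the
    disc \<open>|w| \<le> t\<close> degenerates as \<open>t\<close> approaches 1.\<close>
  define t where "t = dilation_radius m"
  have t: "0 < t" "t < 1" using dilation_radius(1,2)[of m] by (auto simp: t_def)
  have "(\<lambda>n. ((1 - dilation_radius n) / (1 - t)\<^sup>2) powr q) \<longlonglongrightarrow> ((1 - 1) / (1 - t)\<^sup>2) powr q"
    using t p1 less_imp_le[OF dilation_radius(2)]
    by (intro tendsto_powr' tendsto_intros dilation_radius(3)) (auto intro!: always_eventually divide_nonneg_nonneg)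
  then have "eventually (\<lambda>n. ((1 - dilation_radius n) / (1 - t)\<^sup>2) powr q < e / 2) sequentially"
    by (rule order_tendstoD(2)) (use e in simp)
  then show ?thesis
  proof eventually_elim
    case (elim n)
    define \<rho> where "\<rho> = dilation_radius n"
    have \<rho>: "0 < \<rho>" "\<rho> < 1" using dilation_radius(1,2)[of n] by (auto simp: \<rho>_def)
    show ?case unfolding \<rho>_def[symmetric]
    proof (intro allI impI)
      fix f assume f: "disc_test p f"
      have fm [measurable]: "f \<in> borel_measurable borel" using f by (simp add: disc_test_def)
      obtain R where R: "1 < R" "f holomorphic_on ball 0 R" "(\<lambda>z. f (of_real \<rho> * z)) holomorphic_on ball 0 R"
        "(\<lambda>z. f z - f (of_real \<rho> * z)) holomorphic_on ball 0 R"
        "(AVG z. norm (f z - f (of_real \<rho> * z)) powr p) \<le> 2 powr p"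
        by (rule disc_test_dilation[OF f p1(1) \<rho>])
      define g where "g = (\<lambda>z. f z - f (of_real \<rho> * z))"
      have gm [measurable]: "g \<in> borel_measurable borel" unfolding g_def by measurable
      note gh = R(4)[folded g_def]
      have L1: "(AVG z. norm (f z)) \<le> 1" by (rule disc_test_L1[OF f p1(1)])
      have small: "norm (g w) powr q \<le> e / 2" if w: "norm w \<le> t" for w
      proof -
        have "norm (g w) \<le> (1 - \<rho>) / (1 - t)\<^sup>2 * (AVG z. norm (f z))"
          unfolding g_def using disc_dilation_bound[OF fm R(2,1) w t(2), of \<rho>] \<rho> by simp
        also have "\<dots> \<le> (1 - \<rho>) / (1 - t)\<^sup>2 * 1" using L1 \<rho> by (intro mult_left_mono) auto
        finally have "norm (g w) powr q \<le> ((1 - \<rho>) / (1 - t)\<^sup>2) powr q" using p1 by (intro powr_mono2) auto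
        then show ?thesis using elim by (simp add: \<rho>_def)
      qed
      have gI: "integrable circle_measure (\<lambda>\<xi>. norm (g (boundary \<xi>)) powr a)" if "0 < a" for a
        by (rule boundary_limit(1)[OF gm gh R(1) that])
      have IS: "integrable circle_measure (\<lambda>\<xi>. indicator (S t) \<xi> * norm (g (boundary \<xi>)) powr q)"
        using integrable_mult_indicator[OF _ gI[OF p1(2)], of "S t"] by simp
      have "(AVG \<xi>. indicator (S t) \<xi> * norm (g (boundary \<xi>)) powr q) \<le>
         (AVG \<xi>. indicator (S t) \<xi> powr s) powr (1 / s) * (AVG \<xi>. (norm (g (boundary \<xi>)) powr q) powr (p / q)) powr (1 / (p / q))"
      proof (rule Hoelder_inequality(2)[OF s])
        show "integrable circle_measure (\<lambda>x. indicator (S t) x powr s)"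
          by (rule integrable_circle_bounded[where B = 1]) (auto split: split_indicator)
        show "integrable circle_measure (\<lambda>x. (norm (g (boundary x)) powr q) powr (p / q))"
          using gI[of p] p1 by (simp add: powr_powr)
      qed auto
      also have "(AVG \<xi>. indicator (S t) \<xi> powr s) = (AVG \<xi>. indicator (S t) \<xi>)"
        using s by (intro Bochner_Integration.integral_cong) (auto split: split_indicator)
      also have "(AVG \<xi>. indicator (S t) \<xi>) = measure circle_measure (S t)" by simp
      also have "(AVG \<xi>. (norm (g (boundary \<xi>)) powr q) powr (p / q)) = (AVG \<xi>. norm (g (boundary \<xi>)) powr p)"
        using p1 by (simp add: powr_powr)
      also have "measure circle_measure (S t) powr (1 / s) * (AVG \<xi>. norm (g (boundary \<xi>)) powr p) powr (1 / (p / q)) \<le> measure circle_measure (S t) powr (1 / s) * A"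
      proof (rule mult_left_mono)
        have "(AVG \<xi>. norm (g (boundary \<xi>)) powr p) \<le> subordination_const * (AVG z. norm (g z) powr p)"
          by (rule boundary_subordination[OF gm gh R(1) p1(1)])
        also have "\<dots> \<le> subordination_const * 2 powr p"
          using R(5) subordination_const_ge by (intro mult_left_mono) (auto simp: g_def)
        finally show "(AVG \<xi>. norm (g (boundary \<xi>)) powr p) powr (1 / (p / q)) \<le> A"
          unfolding A_def using p1 q by (simp add: powr_mono2)
      qed simp
      also have "\<dots> < e / 2" using m by (simp add: t_def)
      finally have 1: "(AVG \<xi>. indicator (S t) \<xi> * norm (g (boundary \<xi>)) powr q) < e / 2" .
      have "(AVG \<xi>. indicator (- E) \<xi> * norm (g (boundary \<xi>)) powr q) \<le>
          (AVG \<xi>. e / 2 + indicator (S t) \<xi> * norm (g (boundary \<xi>)) powr q)"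
      proof (rule integral_mono_AE)
        show "integrable circle_measure (\<lambda>\<xi>. indicator (- E) \<xi> * norm (g (boundary \<xi>)) powr q)"
          using integrable_mult_indicator[OF _ gI[OF p1(2)], of "- E"] by simp
        show "AE \<xi> in circle_measure. indicator (- E) \<xi> * norm (g (boundary \<xi>)) powr q \<le> e / 2 + indicator (S t) \<xi> * norm (g (boundary \<xi>)) powr q"
          using AE_boundary
        proof eventually_elim
          case (elim \<xi>)
          show ?case
          proof (cases "\<xi> \<in> E \<or> \<xi> \<in> S t")
            case True then show ?thesis using e by (auto split: split_indicator)
          next
            case False
            then have "norm (boundary \<xi>) \<le> t" using elim by (auto simp: S_def)
            then show ?thesis using small False by simp
          qed
        qed
      qed (use IS in auto)
      also have "\<dots> = e / 2 + (AVG \<xi>. indicator (S t) \<xi> * norm (g (boundary \<xi>)) powr q)"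
        using IS circle.prob_space by simp
      finally show "(AVG \<xi>. indicator (- E) \<xi> * norm (f (boundary \<xi>) - f (of_real \<rho> * boundary \<xi>)) powr q) \<le> e"
        using 1 by (simp add: g_def)
    qed
  qed
qed

text \<open>Isolates the contact part, the only one with a contribution in the limit. It is used
  with \<open>2 powr q\<close> times the norm of \<open>F\<close> for \<open>Z\<close> in general
  and with the norm itself for \<open>q = 2\<close>.\<close>

lemma essential_norm_le:
  assumes q: "1 \<le> q" "q < p" and Z: "0 \<le> Z"
    and le: "\<And>e. 0 < e \<Longrightarrow> eventually (\<lambda>n. \<forall>f. disc_test p f \<longrightarrow>
      (AVG z. F z * norm (f z - f (of_real (dilation_radius n) * z)) powr q) \<le> Z + e) sequentially"
  shows "essential_norm p q (composition_operator \<phi>) \<le> Z powr (1 / q)"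
proof -
  have p: "1 \<le> p" "0 < q" "q \<le> p" using q by auto
  \<comment> \<open>A real infimum is below its members only if the set is bounded below; the lower
    estimate supplies the bound.\<close>
  have bdd: "bdd_below ((\<lambda>K. operator_norm p q (\<lambda>f z. composition_operator \<phi> f z - K f z)) ` {K. compact_operator p q K})"
    using operator_norm_ge[OF q refl] by (intro bdd_belowI2) auto
  have main: "essential_norm p q (composition_operator \<phi>) \<le> (Z + (e + e)) powr (1 / q)" if e: "0 < e" for e
  proof -
    have "eventually (\<lambda>n. (\<forall>f. disc_test p f \<longrightarrow> (AVG z. F z * norm (f z - f (of_real (dilation_radius n) * z)) powr q) \<le> Z + e) \<and>
       (\<forall>f. disc_test p f \<longrightarrow> (AVG \<xi>. indicator (- E) \<xi> * norm (f (boundary \<xi>) - f (of_real (dilation_radius n) * boundary \<xi>)) powr q) \<le> e)) sequentially"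
      by (rule eventually_conj[OF le[OF e] off_contact_small[OF q e]])
    then obtain n where n: "\<And>f. disc_test p f \<Longrightarrow> (AVG z. F z * norm (f z - f (of_real (dilation_radius n) * z)) powr q) \<le> Z + e"
      "\<And>f. disc_test p f \<Longrightarrow> (AVG \<xi>. indicator (- E) \<xi> * norm (f (boundary \<xi>) - f (of_real (dilation_radius n) * boundary \<xi>)) powr q) \<le> e"
      by (auto simp: eventually_sequentially)
    define \<rho> where "\<rho> = dilation_radius n"
    have \<rho>: "0 < \<rho>" "\<rho> < 1" using dilation_radius(1,2)[of n] by (auto simp: \<rho>_def)
    have Y: "(AVG \<xi>. norm (f (boundary \<xi>) - f (of_real \<rho> * boundary \<xi>)) powr q) \<le> Z + (e + e)" if f: "disc_test p f" for f
    proof -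
      have fm [measurable]: "f \<in> borel_measurable borel" using f by (simp add: disc_test_def)
      obtain R where R: "1 < R" "(\<lambda>z. f z - f (of_real \<rho> * z)) holomorphic_on ball 0 R"
        by (rule disc_test_dilation[OF f p(1) \<rho>])
      define g where "g = (\<lambda>z. f z - f (of_real \<rho> * z))"
      have gm [measurable]: "g \<in> borel_measurable borel" unfolding g_def by measurable
      have I: "integrable circle_measure (\<lambda>\<xi>. norm (g (boundary \<xi>)) powr q)"
        by (rule boundary_limit(1)[OF gm R(2)[folded g_def] R(1) p(2)])
      have IE: "integrable circle_measure (\<lambda>\<xi>. indicator E \<xi> * norm (g (boundary \<xi>)) powr q)"
        "integrable circle_measure (\<lambda>\<xi>. indicator (- E) \<xi> * norm (g (boundary \<xi>)) powr q)"
        using integrable_mult_indicator[OF _ I, of E] integrable_mult_indicator[OF _ I, of "- E"] by auto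
      have "(AVG \<xi>. norm (g (boundary \<xi>)) powr q) =
         (AVG \<xi>. indicator E \<xi> * norm (g (boundary \<xi>)) powr q + indicator (- E) \<xi> * norm (g (boundary \<xi>)) powr q)"
        by (intro Bochner_Integration.integral_cong) (auto split: split_indicator)
      also have "\<dots> = (AVG \<xi>. indicator E \<xi> * norm (g (boundary \<xi>)) powr q) + (AVG \<xi>. indicator (- E) \<xi> * norm (g (boundary \<xi>)) powr q)"
        by (rule Bochner_Integration.integral_add[OF IE])
      also have "(AVG \<xi>. indicator E \<xi> * norm (g (boundary \<xi>)) powr q) = (AVG z. F z * norm (g z) powr q)"
        by (rule integral_contact) measurable
      also have "\<dots> \<le> Z + e" using n(1)[OF f] by (simp add: g_def \<rho>_def)
      also have "(AVG \<xi>. indicator (- E) \<xi> * norm (g (boundary \<xi>)) powr q) \<le> e" using n(2)[OF f] by (simp add: g_def \<rho>_def)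
      finally show ?thesis by (simp add: g_def)
    qed
    have "essential_norm p q (composition_operator \<phi>) \<le> operator_norm p q (\<lambda>f z. composition_operator \<phi> f z - dilated_composition \<phi> \<rho> f z)"
      unfolding essential_norm_def
      by (rule cINF_lower[OF bdd]) (use compact_dilated_composition[OF p(1) q(1) \<rho>] in simp)
    also have "\<dots> \<le> (Z + (e + e)) powr (1 / q)"
      unfolding operator_norm_def
    proof (rule cSUP_least)
      show "{f \<in> hardy_space p. hardy_norm p f \<le> 1} \<noteq> {}" using hardy_space_0[of p] p by auto
      fix u assume "u \<in> {f \<in> hardy_space p. hardy_norm p f \<le> 1}"
      then show "hardy_norm q (\<lambda>z. composition_operator \<phi> u z - dilated_composition \<phi> \<rho> u z) \<le> (Z + (e + e)) powr (1 / q)"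
        using Z e by (intro dilated_difference_norm_le[OF q(1) p(3) \<rho> _ Y]) auto
    qed
    finally show ?thesis .
  qed
  have "(\<lambda>n. (Z + (1 / real (Suc n) + 1 / real (Suc n))) powr (1 / q)) \<longlonglongrightarrow> (Z + (0 + 0)) powr (1 / q)"
  proof (intro tendsto_powr' tendsto_add tendsto_const LIMSEQ_Suc[OF lim_1_over_n])
    show "Z + (0 + 0) \<noteq> 0 \<or> (0 < 1 / q \<and> (\<forall>\<^sub>F n in sequentially. 0 \<le> Z + (1 / real (Suc n) + 1 / real (Suc n))))"
      using p Z by (intro disjI2) auto
  qed
  moreover have "essential_norm p q (composition_operator \<phi>) \<le> (Z + (1 / real (Suc n) + 1 / real (Suc n))) powr (1 / q)" for n
    by (rule main) simp
  ultimately show ?thesis unfolding add_0_right by (intro LIMSEQ_le_const[of _ "Z powr (1 / q)"]) blast+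
qed

text \<open>\<open>s\<close> is the exponent conjugate to \<open>p / q\<close>, and
  \<open>(|v|^q)^(p / q) = |v|^p\<close>; this is where the exponent of the theorem comes
  from.\<close>

lemma Hoelder_contact:
  assumes q: "1 \<le> q" "q < p" and s: "s = p / (p - q)"
    and [measurable]: "v \<in> borel_measurable borel" and v: "integrable circle_measure (\<lambda>z. norm (v z :: complex) powr p)" "(AVG z. norm (v z) powr p) \<le> c powr p" "0 \<le> c"
  shows "integrable circle_measure (\<lambda>z. F z * norm (v z) powr q)"
    and "(AVG z. F z * norm (v z) powr q) \<le> circle_Lp_norm s F * c powr q"
proof -
  have s1: "1 < s" "1 < p / q" "1 / s + 1 / (p / q) = 1" using q by (auto simp: s field_simps)
  have eq: "(norm (v z) powr q) powr (p / q) = norm (v z) powr p" for z using q by (simp add: powr_powr)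
  have sF: "integrable circle_measure (\<lambda>z. F z powr s)" using density_in_circle_Lp(1)[of s] s1 by simp
  note H = Hoelder_inequality[OF s1, of F circle_measure "\<lambda>z. norm (v z) powr q"]
  show "integrable circle_measure (\<lambda>z. F z * norm (v z) powr q)"
    by (rule H(1)) (use sF v eq density_nonneg in auto)
  have "(AVG z. F z * norm (v z) powr q) \<le> (AVG z. F z powr s) powr (1 / s) * (AVG z. (norm (v z) powr q) powr (p / q)) powr (1 / (p / q))"
    by (rule H(2)) (use sF v eq density_nonneg in auto)
  also have "\<dots> \<le> circle_Lp_norm s F * (c powr p) powr (1 / (p / q))"
    unfolding eq circle_Lp_norm_def using v q s1 by (intro mult_mono powr_mono2) (auto simp: density_nonneg)
  also have "(c powr p) powr (1 / (p / q)) = c powr q" using q by (simp add: powr_powr)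
  finally show "(AVG z. F z * norm (v z) powr q) \<le> circle_Lp_norm s F * c powr q" .
qed

lemma disc_test_integrable:
  assumes "disc_test p f" "0 < a"
  shows "integrable circle_measure (\<lambda>z. norm (f z) powr a)"
proof -
  obtain R where fm [measurable]: "f \<in> borel_measurable borel" and R: "1 < R" "f holomorphic_on ball 0 R"
    using assms unfolding disc_test_def by blast
  show ?thesis
    using assms(2) by (intro integrable_circle_continuous continuous_on_norm_powr holomorphic_continuous_on_sphere[OF R(2,1)]) auto
qed

lemma essential_norm_le_twice:
  assumes q: "1 \<le> q" "q < p" and s: "s = p / (p - q)"
  shows "essential_norm p q (composition_operator \<phi>) \<le> 2 * circle_Lp_norm s F powr (1 / q)"
proof -
  have p: "1 \<le> p" "0 < q" using q by auto
  have N: "0 \<le> circle_Lp_norm s F" by (simp add: circle_Lp_norm_def)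
  have "essential_norm p q (composition_operator \<phi>) \<le> (circle_Lp_norm s F * 2 powr q) powr (1 / q)"
  proof (rule essential_norm_le[OF q])
    fix e :: real assume e: "0 < e"
    show "eventually (\<lambda>n. \<forall>f. disc_test p f \<longrightarrow>
      (AVG z. F z * norm (f z - f (of_real (dilation_radius n) * z)) powr q) \<le> circle_Lp_norm s F * 2 powr q + e) sequentially"
    proof (intro always_eventually allI impI)
      fix n f assume f: "disc_test p f"
      have fm [measurable]: "f \<in> borel_measurable borel" using f by (simp add: disc_test_def)
      obtain R where R: "1 < R" "(\<lambda>z. f z - f (of_real (dilation_radius n) * z)) holomorphic_on ball 0 R"
        "(AVG z. norm (f z - f (of_real (dilation_radius n) * z)) powr p) \<le> 2 powr p"
        by (rule disc_test_dilation[OF f p(1) dilation_radius(1,2)])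
      have "integrable circle_measure (\<lambda>z. norm (f z - f (of_real (dilation_radius n) * z)) powr p)"
        using p by (intro integrable_circle_continuous continuous_on_norm_powr holomorphic_continuous_on_sphere[OF R(2,1)]) auto
      then have "(AVG z. F z * norm (f z - f (of_real (dilation_radius n) * z)) powr q) \<le> circle_Lp_norm s F * 2 powr q"
        using R(3) by (intro Hoelder_contact(2)[OF q s]) auto
      then show "(AVG z. F z * norm (f z - f (of_real (dilation_radius n) * z)) powr q) \<le> circle_Lp_norm s F * 2 powr q + e"
        using e by linarith
    qed
  qed (use N in simp)
  also have "\<dots> = 2 * circle_Lp_norm s F powr (1 / q)" using p N by (simp add: powr_mult powr_powr)
  finally show ?thesis .
qed

end

section \<open>The case \<open>q = 2\<close>\<close>

context disc_self_map
begin

text \<open>The square root of the density: \<open>F * |g|^2 = |amp * g|^2\<close> almost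
  everywhere, so a weighted integral becomes an unweighted L^2 norm.\<close>

definition amp :: "complex \<Rightarrow> real" where "amp z = sqrt (truncated_density z)"
definition amp_bound :: real where "amp_bound = sqrt (subordination_const + 1)"

text \<open>\<open>oscillation r \<xi>\<close> is the mean of \<open>(amp - amp \<xi>)\<^sup>2\<close> with respect to the Poisson kernel at \<open>r\<xi>\<close>.\<close>

definition oscillation :: "real \<Rightarrow> complex \<Rightarrow> real" where
  "oscillation r \<xi> = (amp \<xi>)\<^sup>2 - 2 * amp \<xi> * poisson_operator r amp \<xi> + poisson_operator r (\<lambda>z. (amp z)\<^sup>2) \<xi>"

lemma amp: "0 \<le> amp z" "amp z \<le> amp_bound" "(amp z)\<^sup>2 \<le> amp_bound\<^sup>2" "AE z in circle_measure. F z = (amp z)\<^sup>2"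
  and amp_measurable [measurable]: "amp \<in> borel_measurable borel"
proof -
  show 0: "0 \<le> amp z" using truncated_density(1)[of z] by (simp add: amp_def)
  show 1: "amp z \<le> amp_bound" using truncated_density(2)[of z] by (simp add: amp_def amp_bound_def)
  show "(amp z)\<^sup>2 \<le> amp_bound\<^sup>2" using 0 1 by (intro power_mono)
  show "AE z in circle_measure. F z = (amp z)\<^sup>2" using truncated_density(3) by eventually_elim (simp add: amp_def truncated_density(1))
  show "amp \<in> borel_measurable borel" unfolding amp_def[abs_def] by measurable
qed

lemma amp_bound_nonneg: "0 \<le> amp_bound"
  using amp(1)[of 0] amp(2)[of 0] by linarith

lemma integrable_amp: "integrable circle_measure amp" "integrable circle_measure (\<lambda>z. (amp z)\<^sup>2)"
proof -
  show "integrable circle_measure amp"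
    by (rule integrable_circle_bounded[where B = amp_bound]) (use amp(1,2) in auto)
  show "integrable circle_measure (\<lambda>z. (amp z)\<^sup>2)"
    by (rule integrable_circle_bounded[where B = "amp_bound\<^sup>2"]) (use amp(3) in auto)
qed

lemma oscillation_measurable [measurable]: "oscillation r \<in> borel_measurable borel"
proof -
  have [measurable]: "poisson_operator r amp \<in> borel_measurable borel" "poisson_operator r (\<lambda>z. (amp z)\<^sup>2) \<in> borel_measurable borel"
    using integrable_amp by (auto intro: borel_measurable_poisson_operator)
  show ?thesis unfolding oscillation_def[abs_def] by measurable
qed

lemma poisson_amp:
  assumes r: "0 \<le> r" "r < 1" "norm \<xi> = 1"
  shows "0 \<le> poisson_operator r amp \<xi>" "poisson_operator r amp \<xi> \<le> amp_bound"
    and "poisson_operator r (\<lambda>z. (amp z)\<^sup>2) \<xi> \<le> amp_bound\<^sup>2"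
    and "(poisson_operator r amp \<xi>)\<^sup>2 \<le> poisson_operator r (\<lambda>z. (amp z)\<^sup>2) \<xi>"
proof -
  have c: "poisson_operator r (\<lambda>_. c) \<xi> = c" for c :: real
    using poisson_operator_one[OF r] by (simp add: poisson_operator_def)
  show "0 \<le> poisson_operator r amp \<xi>"
    using poisson_operator_mono[of "\<lambda>_. 0" amp r \<xi>] integrable_amp(1) amp(1) r c[of 0] by simp
  show "poisson_operator r amp \<xi> \<le> amp_bound"
    using poisson_operator_mono[of amp "\<lambda>_. amp_bound" r \<xi>] integrable_amp(1) amp(2) r c by simp
  show "poisson_operator r (\<lambda>z. (amp z)\<^sup>2) \<xi> \<le> amp_bound\<^sup>2"
    using poisson_operator_mono[of "\<lambda>z. (amp z)\<^sup>2" "\<lambda>_. amp_bound\<^sup>2" r \<xi>] integrable_amp(2) amp(3) r c by simp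
  show "(poisson_operator r amp \<xi>)\<^sup>2 \<le> poisson_operator r (\<lambda>z. (amp z)\<^sup>2) \<xi>"
    using poisson_operator_powr_le[of 2 amp r \<xi>] integrable_amp(2) r by (simp add: abs_of_nonneg amp(1))
qed

text \<open>\<open>oscillation r \<xi>\<close> is the squared distance of \<open>amp \<xi>\<close>
  from the Poisson mean of \<open>amp\<close>, plus the variance of \<open>amp\<close> under the
  kernel.\<close>

lemma oscillation_bounds:
  assumes r: "0 \<le> r" "r < 1" "norm \<xi> = 1"
  shows "0 \<le> oscillation r \<xi>" "oscillation r \<xi> \<le> 2 * amp_bound\<^sup>2"
proof -
  have "oscillation r \<xi> = (amp \<xi> - poisson_operator r amp \<xi>)\<^sup>2 + (poisson_operator r (\<lambda>z. (amp z)\<^sup>2) \<xi> - (poisson_operator r amp \<xi>)\<^sup>2)"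
    by (simp add: oscillation_def power2_eq_square algebra_simps)
  then show "0 \<le> oscillation r \<xi>" using poisson_amp(4)[OF r] by simp
  have "0 \<le> amp \<xi> * poisson_operator r amp \<xi>" by (intro mult_nonneg_nonneg amp poisson_amp r)
  then show "oscillation r \<xi> \<le> 2 * amp_bound\<^sup>2"
    using poisson_amp(3)[OF r] amp(3)[of \<xi>] unfolding oscillation_def by linarith
qed

text \<open>Poisson operators preserve integrals, so the integral of the oscillation is twice that
  of \<open>amp\<close> times the difference of \<open>amp\<close> and its Poisson mean.\<close>

lemma integral_oscillation_le:
  assumes r: "0 \<le> r" "r < 1"
  shows "(AVG \<xi>. oscillation r \<xi>) \<le> 2 * amp_bound * (AVG \<xi>. \<bar>amp \<xi> - poisson_operator r amp \<xi>\<bar>)"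
proof -
  have [measurable]: "poisson_operator r amp \<in> borel_measurable borel"
    using integrable_amp by (auto intro: borel_measurable_poisson_operator)
  have PI: "integrable circle_measure (poisson_operator r amp)" "integrable circle_measure (poisson_operator r (\<lambda>z. (amp z)\<^sup>2))"
    using integrable_amp r by (auto intro: integrable_poisson_operator)
  have I: "integrable circle_measure (\<lambda>\<xi>. amp \<xi> * poisson_operator r amp \<xi>)"
  proof (rule integrable_circle_bounded[where B = "amp_bound * amp_bound"])
    fix z :: complex assume "norm z = 1"
    then show "norm (amp z * poisson_operator r amp z) \<le> amp_bound * amp_bound"
      using amp(1,2)[of z] poisson_amp(1,2)[OF r] by (auto simp: abs_mult intro!: mult_mono)
  qed measurable
  have "(AVG \<xi>. oscillation r \<xi>) = (AVG \<xi>. (amp \<xi>)\<^sup>2) - 2 * (AVG \<xi>. amp \<xi> * poisson_operator r amp \<xi>)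
      + (AVG \<xi>. poisson_operator r (\<lambda>z. (amp z)\<^sup>2) \<xi>)"
    unfolding oscillation_def mult.assoc using integrable_amp(2) I PI(2) by simp
  also have "(AVG \<xi>. poisson_operator r (\<lambda>z. (amp z)\<^sup>2) \<xi>) = (AVG \<xi>. (amp \<xi>)\<^sup>2)"
    by (rule integral_poisson_operator[OF integrable_amp(2) r])
  also have "(AVG \<xi>. (amp \<xi>)\<^sup>2) - 2 * (AVG \<xi>. amp \<xi> * poisson_operator r amp \<xi>) + (AVG \<xi>. (amp \<xi>)\<^sup>2)
     = 2 * (AVG \<xi>. (amp \<xi>)\<^sup>2 - amp \<xi> * poisson_operator r amp \<xi>)"
    using integrable_amp(2) I by simp
  also have "(AVG \<xi>. (amp \<xi>)\<^sup>2 - amp \<xi> * poisson_operator r amp \<xi>) \<le> (AVG \<xi>. amp_bound * \<bar>amp \<xi> - poisson_operator r amp \<xi>\<bar>)"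
  proof (rule integral_mono)
    fix \<xi>
    have "(amp \<xi>)\<^sup>2 - amp \<xi> * poisson_operator r amp \<xi> = amp \<xi> * (amp \<xi> - poisson_operator r amp \<xi>)"
      by (simp add: power2_eq_square right_diff_distrib)
    also have "\<dots> \<le> amp \<xi> * \<bar>amp \<xi> - poisson_operator r amp \<xi>\<bar>" by (intro mult_left_mono amp(1)) simp
    also have "\<dots> \<le> amp_bound * \<bar>amp \<xi> - poisson_operator r amp \<xi>\<bar>" by (intro mult_right_mono amp(2)) simp
    finally show "(amp \<xi>)\<^sup>2 - amp \<xi> * poisson_operator r amp \<xi> \<le> amp_bound * \<bar>amp \<xi> - poisson_operator r amp \<xi>\<bar>" .
  qed (use integrable_amp I PI in auto)
  finally show ?thesis by simp
qed

text \<open>At \<open>\<xi>\<close> the commutator is the Poisson mean of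
  \<open>(amp z - amp \<xi>) * f z\<close>. Jensen's inequality bounds its square by the mean of the
  squares, in which \<open>|f|^2\<close> still stands under the kernel; self-adjointness frees it
  after integration.\<close>

lemma commutator_le:
  fixes f :: "complex \<Rightarrow> complex"
  assumes f [measurable]: "f \<in> borel_measurable borel" and fB: "\<And>z. norm z = 1 \<Longrightarrow> norm (f z) \<le> B" and r: "0 \<le> r" "r < 1"
  shows "(AVG \<xi>. (norm (poisson_operator r (\<lambda>z. amp z *\<^sub>R f z) \<xi> - amp \<xi> *\<^sub>R poisson_operator r f \<xi>))\<^sup>2)
      \<le> (AVG \<xi>. oscillation r \<xi> * (norm (f \<xi>))\<^sup>2)"
proof -
  define m where "m = (\<lambda>z. (norm (f z))\<^sup>2)"
  have [measurable]: "m \<in> borel_measurable borel" unfolding m_def by measurable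
  have m0: "0 \<le> m z" for z by (simp add: m_def)
  have mB: "m z \<le> B\<^sup>2" if "norm z = 1" for z unfolding m_def using fB[OF that] by (intro power_mono) auto
  have mI: "integrable circle_measure m"
    by (rule integrable_circle_bounded[where B = "B\<^sup>2"]) (use mB m0 in auto)
  have amI: "integrable circle_measure (\<lambda>z. amp z * m z)"
  proof (rule integrable_circle_bounded[where B = "amp_bound * B\<^sup>2"])
    fix z :: complex assume "norm z = 1"
    then show "norm (amp z * m z) \<le> amp_bound * B\<^sup>2"
      using amp(1,2)[of z] mB[of z] m0[of z] by (auto simp: abs_mult intro!: mult_mono)
  qed measurable
  have a2mI: "integrable circle_measure (\<lambda>z. (amp z)\<^sup>2 * m z)"
  proof (rule integrable_circle_bounded[where B = "amp_bound\<^sup>2 * B\<^sup>2"])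
    fix z :: complex assume "norm z = 1"
    then show "norm ((amp z)\<^sup>2 * m z) \<le> amp_bound\<^sup>2 * B\<^sup>2"
      using amp(3)[of z] mB[of z] m0[of z] by (auto simp: abs_mult intro!: mult_mono)
  qed measurable
  have fI: "integrable circle_measure f" by (rule integrable_circle_bounded[OF f fB])
  have afI: "integrable circle_measure (\<lambda>z. amp z *\<^sub>R f z)"
  proof (rule integrable_circle_bounded[where B = "amp_bound * B"])
    fix z :: complex assume "norm z = 1"
    then show "norm (amp z *\<^sub>R f z) \<le> amp_bound * B"
      using amp(1,2)[of z] fB[of z] by (auto intro!: mult_mono order_trans[OF amp(1) amp(2)])
  qed measurable
  have [measurable]: "poisson_operator r f \<in> borel_measurable borel" "poisson_operator r (\<lambda>z. amp z *\<^sub>R f z) \<in> borel_measurable borel"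
    "poisson_operator r m \<in> borel_measurable borel" "poisson_operator r (\<lambda>z. amp z * m z) \<in> borel_measurable borel"
    "poisson_operator r amp \<in> borel_measurable borel" "poisson_operator r (\<lambda>z. (amp z)\<^sup>2) \<in> borel_measurable borel"
    by (rule borel_measurable_poisson_operator, rule fI afI mI amI integrable_amp)+
  let ?R = "\<lambda>\<xi>. poisson_operator r (\<lambda>z. (amp z)\<^sup>2 * m z) \<xi> - 2 * (amp \<xi> * poisson_operator r (\<lambda>z. amp z * m z) \<xi>) + (amp \<xi>)\<^sup>2 * poisson_operator r m \<xi>"
  have pw: "(norm (poisson_operator r (\<lambda>z. amp z *\<^sub>R f z) \<xi> - amp \<xi> *\<^sub>R poisson_operator r f \<xi>))\<^sup>2 \<le> ?R \<xi>" if \<xi>: "norm \<xi> = 1" for \<xi>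
  proof -
    define w where "w = of_real r * \<xi>"
    have w: "norm w < 1" using r \<xi> by (simp add: w_def norm_mult)
    note ip = integrable_poisson_mult[OF _ w]
    have v_eq: "poisson_operator r (\<lambda>z. amp z *\<^sub>R f z) \<xi> - amp \<xi> *\<^sub>R poisson_operator r f \<xi> = poisson_operator r (\<lambda>z. (amp z - amp \<xi>) *\<^sub>R f z) \<xi>"
    proof -
      have "poisson_operator r (\<lambda>z. (amp z - amp \<xi>) *\<^sub>R f z) \<xi> = (AVG z. poisson_kernel w z *\<^sub>R (amp z *\<^sub>R f z) - amp \<xi> *\<^sub>R (poisson_kernel w z *\<^sub>R f z))"
        unfolding poisson_operator_def w_def[symmetric]
        by (intro Bochner_Integration.integral_cong) (auto simp: algebra_simps)
      also have "\<dots> = (AVG z. poisson_kernel w z *\<^sub>R (amp z *\<^sub>R f z)) - amp \<xi> *\<^sub>R (AVG z. poisson_kernel w z *\<^sub>R f z)"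
      proof -
        have "integrable circle_measure (\<lambda>z. amp \<xi> *\<^sub>R (poisson_kernel w z *\<^sub>R f z))"
          by (intro integrable_scaleR_right ip fI)
        from Bochner_Integration.integral_diff[OF ip[OF afI] this] show ?thesis
          by (simp only: integral_scaleR_right)
      qed
      finally show ?thesis unfolding poisson_operator_def w_def[symmetric] by simp
    qed
    have sq: "(norm ((amp z - amp \<xi>) *\<^sub>R f z))\<^sup>2 = (amp z)\<^sup>2 * m z - 2 * (amp \<xi> * (amp z * m z)) + (amp \<xi>)\<^sup>2 * m z" for z
      unfolding m_def norm_scaleR power_mult_distrib power2_abs by (simp add: power2_diff algebra_simps)
    have sqI: "integrable circle_measure (\<lambda>z. (norm ((amp z - amp \<xi>) *\<^sub>R f z))\<^sup>2)"
      unfolding sq using a2mI amI mI by (intro Bochner_Integration.integrable_add Bochner_Integration.integrable_diff integrable_mult_right) auto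
    have "(norm (poisson_operator r (\<lambda>z. (amp z - amp \<xi>) *\<^sub>R f z) \<xi>))\<^sup>2 \<le> poisson_operator r (\<lambda>z. (norm ((amp z - amp \<xi>) *\<^sub>R f z))\<^sup>2) \<xi>"
      using poisson_operator_powr_le[of 2 "\<lambda>z. (amp z - amp \<xi>) *\<^sub>R f z" r \<xi>] sqI r \<xi> by (simp del: norm_scaleR)
    also have "\<dots> = (AVG z. poisson_kernel w z * ((amp z)\<^sup>2 * m z) - 2 * (amp \<xi> * (poisson_kernel w z * (amp z * m z))) + (amp \<xi>)\<^sup>2 * (poisson_kernel w z * m z))"
      unfolding sq poisson_operator_def w_def[symmetric] real_scaleR_def
      by (intro Bochner_Integration.integral_cong) (auto simp: algebra_simps)
    also have "\<dots> = ?R \<xi>"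
      using ip[OF a2mI] ip[OF amI] ip[OF mI] unfolding poisson_operator_def w_def[symmetric] by simp
    finally show ?thesis unfolding v_eq .
  qed
  have P1: "integrable circle_measure (poisson_operator r (\<lambda>z. (amp z)\<^sup>2 * m z))" by (rule integrable_poisson_operator[OF a2mI r])
  have P2: "integrable circle_measure (\<lambda>\<xi>. amp \<xi> * poisson_operator r (\<lambda>z. amp z * m z) \<xi>)"
  proof (rule Bochner_Integration.integrable_bound)
    show "integrable circle_measure (\<lambda>\<xi>. amp_bound * poisson_operator r (\<lambda>z. amp z * m z) \<xi>)"
      by (intro integrable_mult_right integrable_poisson_operator[OF amI r])
    show "AE \<xi> in circle_measure. norm (amp \<xi> * poisson_operator r (\<lambda>z. amp z * m z) \<xi>) \<le> norm (amp_bound * poisson_operator r (\<lambda>z. amp z * m z) \<xi>)"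
    proof (rule AE_I2)
      fix \<xi> show "norm (amp \<xi> * poisson_operator r (\<lambda>z. amp z * m z) \<xi>) \<le> norm (amp_bound * poisson_operator r (\<lambda>z. amp z * m z) \<xi>)"
        using amp(1,2)[of \<xi>] by (auto simp: abs_mult intro!: mult_right_mono)
    qed
  qed measurable
  have P3: "integrable circle_measure (\<lambda>\<xi>. (amp \<xi>)\<^sup>2 * poisson_operator r m \<xi>)"
  proof (rule Bochner_Integration.integrable_bound)
    show "integrable circle_measure (\<lambda>\<xi>. amp_bound\<^sup>2 * poisson_operator r m \<xi>)"
      by (intro integrable_mult_right integrable_poisson_operator[OF mI r])
    show "AE \<xi> in circle_measure. norm ((amp \<xi>)\<^sup>2 * poisson_operator r m \<xi>) \<le> norm (amp_bound\<^sup>2 * poisson_operator r m \<xi>)"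
    proof (rule AE_I2)
      fix \<xi> show "norm ((amp \<xi>)\<^sup>2 * poisson_operator r m \<xi>) \<le> norm (amp_bound\<^sup>2 * poisson_operator r m \<xi>)"
        using amp(3)[of \<xi>] by (auto simp: abs_mult intro!: mult_right_mono)
    qed
  qed measurable
  have RI: "integrable circle_measure ?R" using P1 P2 P3 by simp
  have "(AVG \<xi>. (norm (poisson_operator r (\<lambda>z. amp z *\<^sub>R f z) \<xi> - amp \<xi> *\<^sub>R poisson_operator r f \<xi>))\<^sup>2) \<le> (AVG \<xi>. ?R \<xi>)"
  proof (rule integral_mono_AE[OF _ RI])
    show "integrable circle_measure (\<lambda>\<xi>. (norm (poisson_operator r (\<lambda>z. amp z *\<^sub>R f z) \<xi> - amp \<xi> *\<^sub>R poisson_operator r f \<xi>))\<^sup>2)"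
      by (rule Bochner_Integration.integrable_bound[OF RI])
         (use AE_circle_measure pw in \<open>auto elim!: eventually_mono intro: order_trans[OF pw abs_ge_self]\<close>)
    show "AE \<xi> in circle_measure. (norm (poisson_operator r (\<lambda>z. amp z *\<^sub>R f z) \<xi> - amp \<xi> *\<^sub>R poisson_operator r f \<xi>))\<^sup>2 \<le> ?R \<xi>"
      using AE_circle_measure by eventually_elim (rule pw)
  qed
  also have "\<dots> = (AVG \<xi>. poisson_operator r (\<lambda>z. (amp z)\<^sup>2 * m z) \<xi>) - 2 * (AVG \<xi>. amp \<xi> * poisson_operator r (\<lambda>z. amp z * m z) \<xi>) + (AVG \<xi>. (amp \<xi>)\<^sup>2 * poisson_operator r m \<xi>)"
    using P1 P2 P3 by simp
  also have "(AVG \<xi>. poisson_operator r (\<lambda>z. (amp z)\<^sup>2 * m z) \<xi>) = (AVG \<xi>. (amp \<xi>)\<^sup>2 * m \<xi>)"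
    by (rule integral_poisson_operator[OF a2mI r])
  \<comment> \<open>Each Poisson operator is moved from the factor containing \<open>m\<close> to a
    power of \<open>amp\<close>; the coefficients of \<open>m\<close> then add up to
    \<open>oscillation r \<xi>\<close>.\<close>
  also have "(AVG \<xi>. amp \<xi> * poisson_operator r (\<lambda>z. amp z * m z) \<xi>) = (AVG \<xi>. poisson_operator r amp \<xi> * (amp \<xi> * m \<xi>))"
    by (rule poisson_operator_selfadjoint[OF integrable_amp(1) amI r])
  also have "(AVG \<xi>. (amp \<xi>)\<^sup>2 * poisson_operator r m \<xi>) = (AVG \<xi>. poisson_operator r (\<lambda>z. (amp z)\<^sup>2) \<xi> * m \<xi>)"
    by (rule poisson_operator_selfadjoint[OF integrable_amp(2) mI r])
  also have "(AVG \<xi>. (amp \<xi>)\<^sup>2 * m \<xi>) - 2 * (AVG \<xi>. poisson_operator r amp \<xi> * (amp \<xi> * m \<xi>)) + (AVG \<xi>. poisson_operator r (\<lambda>z. (amp z)\<^sup>2) \<xi> * m \<xi>)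
     = (AVG \<xi>. (amp \<xi>)\<^sup>2 * m \<xi> - 2 * (poisson_operator r amp \<xi> * (amp \<xi> * m \<xi>)) + poisson_operator r (\<lambda>z. (amp z)\<^sup>2) \<xi> * m \<xi>)"
  proof -
    have "integrable circle_measure (\<lambda>\<xi>. poisson_operator r amp \<xi> * (amp \<xi> * m \<xi>))"
    proof (rule integrable_circle_bounded[where B = "amp_bound * (amp_bound * B\<^sup>2)"])
      fix z :: complex assume z: "norm z = 1"
      show "norm (poisson_operator r amp z * (amp z * m z)) \<le> amp_bound * (amp_bound * B\<^sup>2)"
        using amp(1,2)[of z] poisson_amp(1,2)[OF r z] mB[OF z] m0[of z] amp_bound_nonneg by (auto simp: abs_mult intro!: mult_mono)
    qed measurable
    moreover have "integrable circle_measure (\<lambda>\<xi>. poisson_operator r (\<lambda>z. (amp z)\<^sup>2) \<xi> * m \<xi>)"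
    proof (rule integrable_circle_bounded[where B = "amp_bound\<^sup>2 * B\<^sup>2"])
      fix z :: complex assume z: "norm z = 1"
      have "0 \<le> poisson_operator r (\<lambda>z. (amp z)\<^sup>2) z" using poisson_amp(4)[OF r z] by (meson order_trans zero_le_power2)
      then show "norm (poisson_operator r (\<lambda>z. (amp z)\<^sup>2) z * m z) \<le> amp_bound\<^sup>2 * B\<^sup>2"
        using poisson_amp(3)[OF r z] mB[OF z] m0[of z] by (auto simp: abs_mult intro!: mult_mono)
    qed measurable
    ultimately show ?thesis using a2mI by simp
  qed
  also have "\<dots> = (AVG \<xi>. oscillation r \<xi> * (norm (f \<xi>))\<^sup>2)"
    unfolding oscillation_def m_def by (intro Bochner_Integration.integral_cong) (auto simp: algebra_simps)
  finally show ?thesis .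
qed

text \<open>The oscillations are uniformly bounded, so their L^s norms tend to 0 with their L^1
  norms.\<close>

lemma oscillation_powr_limit:
  assumes s: "1 < s"
  shows "(\<lambda>n. (AVG \<xi>. \<bar>oscillation (dilation_radius n) \<xi>\<bar> powr s) powr (1 / s)) \<longlonglongrightarrow> 0"
proof -
  define M where "M = (2 * amp_bound\<^sup>2) powr (s - 1)"
  have le: "(AVG \<xi>. \<bar>oscillation (dilation_radius n) \<xi>\<bar> powr s) \<le> M * (2 * amp_bound * (AVG \<xi>. \<bar>amp \<xi> - poisson_operator (dilation_radius n) amp \<xi>\<bar>))" for n
  proof -
    note r = less_imp_le[OF dilation_radius(1)[of n]] dilation_radius(2)[of n]
    let ?D = "oscillation (dilation_radius n)"
    have DI: "integrable circle_measure ?D"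
      by (rule integrable_circle_bounded[where B = "2 * amp_bound\<^sup>2"]) (use oscillation_bounds[OF r] in auto)
    have pw: "\<bar>?D \<xi>\<bar> powr s \<le> M * ?D \<xi>" if \<xi>: "norm \<xi> = 1" for \<xi>
    proof (cases "?D \<xi> = 0")
      case False
      note b = oscillation_bounds[OF r \<xi>]
      have "\<bar>?D \<xi>\<bar> powr s = ?D \<xi> powr (s - 1) * ?D \<xi> powr 1" by (subst powr_add[symmetric]) (simp add: b(1))
      also have "\<dots> \<le> M * ?D \<xi>" unfolding M_def using b s by (intro mult_mono powr_mono2) auto
      finally show ?thesis .
    qed simp
    have "(AVG \<xi>. \<bar>?D \<xi>\<bar> powr s) \<le> (AVG \<xi>. M * ?D \<xi>)"
    proof (rule integral_mono_AE)
      show "integrable circle_measure (\<lambda>\<xi>. \<bar>?D \<xi>\<bar> powr s)"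
        by (rule integrable_circle_bounded[where B = "(2 * amp_bound\<^sup>2) powr s"])
           (use oscillation_bounds[OF r] s in \<open>auto intro!: powr_mono2\<close>)
      show "AE \<xi> in circle_measure. \<bar>?D \<xi>\<bar> powr s \<le> M * ?D \<xi>"
        using AE_circle_measure by eventually_elim (rule pw)
    qed (use DI in simp)
    also have "\<dots> \<le> M * (2 * amp_bound * (AVG \<xi>. \<bar>amp \<xi> - poisson_operator (dilation_radius n) amp \<xi>\<bar>))"
      using integral_oscillation_le[OF r] by (simp add: M_def mult_left_mono)
    finally show ?thesis .
  qed
  have "(\<lambda>n. M * (2 * amp_bound * (AVG \<xi>. \<bar>amp \<xi> - poisson_operator (dilation_radius n) amp \<xi>\<bar>))) \<longlonglongrightarrow> M * (2 * amp_bound * 0)"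
    by (intro tendsto_intros poisson_operator_L1_limit integrable_amp)
  then have lim0: "(\<lambda>n. M * (2 * amp_bound * (AVG \<xi>. \<bar>amp \<xi> - poisson_operator (dilation_radius n) amp \<xi>\<bar>))) \<longlonglongrightarrow> 0" by simp
  have "(\<lambda>n. AVG \<xi>. \<bar>oscillation (dilation_radius n) \<xi>\<bar> powr s) \<longlonglongrightarrow> 0"
  proof (rule tendsto_sandwich[OF _ _ tendsto_const lim0])
    show "\<forall>\<^sub>F n in sequentially. 0 \<le> (AVG \<xi>. \<bar>oscillation (dilation_radius n) \<xi>\<bar> powr s)" by simp
  qed (intro always_eventually allI le)
  then have "(\<lambda>n. (AVG \<xi>. \<bar>oscillation (dilation_radius n) \<xi>\<bar> powr s) powr (1 / s)) \<longlonglongrightarrow> 0 powr (1 / s)"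
    using s by (intro tendsto_powr' tendsto_const) auto
  then show ?thesis by simp
qed

text \<open>\<open>oscillation\<close> does not depend on \<open>f\<close>, so Hoelder's inequality
  with the exponents \<open>s\<close> and \<open>p / 2\<close> makes the smallness uniform over all
  test functions.\<close>

lemma weighted_commutator_small:
  assumes p: "2 < p" and s: "s = p / (p - 2)" and f: "disc_test p f" and r: "0 \<le> r" "r < 1"
  shows "(AVG \<xi>. (norm (poisson_operator r (\<lambda>z. amp z *\<^sub>R f z) \<xi> - amp \<xi> *\<^sub>R poisson_operator r f \<xi>))\<^sup>2)
      \<le> (AVG \<xi>. \<bar>oscillation r \<xi>\<bar> powr s) powr (1 / s)"
proof -
  have s1: "1 < s" "1 < p / 2" "1 / s + 1 / (p / 2) = 1" using p by (auto simp: s field_simps)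
  obtain R where fm [measurable]: "f \<in> borel_measurable borel" and R: "1 < R" "f holomorphic_on ball 0 R"
    and le: "(AVG z. norm (f z) powr p) \<le> 1"
    using f unfolding disc_test_def by blast
  obtain B where B: "\<And>z. norm z = 1 \<Longrightarrow> norm (f z) \<le> B"
    using continuous_on_sphere_bounded[OF holomorphic_continuous_on_sphere[OF R(2,1)]] by blast
  have eq: "((norm (f z))\<^sup>2) powr (p / 2) = norm (f z) powr p" for z
  proof -
    have "((norm (f z))\<^sup>2) powr (p / 2) = (norm (f z) powr 2) powr (p / 2)" by simp
    also have "\<dots> = norm (f z) powr p" by (subst powr_powr) simp
    finally show ?thesis .
  qed
  have DI: "integrable circle_measure (\<lambda>\<xi>. \<bar>oscillation r \<xi>\<bar> powr s)"
    by (rule integrable_circle_bounded[where B = "(2 * amp_bound\<^sup>2) powr s"])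
       (use oscillation_bounds[OF r] s1 in \<open>auto intro!: powr_mono2\<close>)
  have fI: "integrable circle_measure (\<lambda>z. ((norm (f z))\<^sup>2) powr (p / 2))"
    unfolding eq by (rule disc_test_integrable[OF f]) (use p in simp)
  have "(AVG \<xi>. (norm (poisson_operator r (\<lambda>z. amp z *\<^sub>R f z) \<xi> - amp \<xi> *\<^sub>R poisson_operator r f \<xi>))\<^sup>2)
      \<le> (AVG \<xi>. oscillation r \<xi> * (norm (f \<xi>))\<^sup>2)"
    by (rule commutator_le[OF fm B r])
  also have "\<dots> = (AVG \<xi>. \<bar>oscillation r \<xi>\<bar> * (norm (f \<xi>))\<^sup>2)"
    by (rule circle_integral_cong) (use oscillation_bounds(1)[OF r] in auto)
  also have "\<dots> \<le> (AVG \<xi>. \<bar>oscillation r \<xi>\<bar> powr s) powr (1 / s) * (AVG z. ((norm (f z))\<^sup>2) powr (p / 2)) powr (1 / (p / 2))"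
    by (rule Hoelder_inequality(2)[OF s1]) (use DI fI in auto)
  also have "\<dots> \<le> (AVG \<xi>. \<bar>oscillation r \<xi>\<bar> powr s) powr (1 / s) * 1 powr (1 / (p / 2))"
    unfolding eq using le p by (intro mult_left_mono powr_mono2) auto
  finally show ?thesis by simp
qed

text \<open>With \<open>P\<close> the Poisson operator, \<open>amp * (f - P f)\<close> is the sum of
  \<open>amp * f - P (amp * f)\<close> and the commutator \<open>P (amp * f) - amp * P f\<close>. By
  \<open>poisson_operator_L2_gap\<close> the first term is no larger than \<open>amp * f\<close> in
  L^2, and Hoelder's inequality bounds \<open>amp * f\<close> itself; the commutator tends to
  0.\<close>

lemma essential_norm_le_once:
  assumes p: "2 < p" and s: "s = p / (p - 2)"
  shows "essential_norm p 2 (composition_operator \<phi>) \<le> circle_Lp_norm s F powr (1 / 2)"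
proof (rule essential_norm_le)
  have s1: "1 < s" using p by (simp add: s field_simps)
  define N where "N = circle_Lp_norm s F"
  have N: "0 \<le> N" by (simp add: N_def circle_Lp_norm_def)
  then show "0 \<le> circle_Lp_norm s F" by (simp add: N_def)
  fix e :: real assume e: "0 < e"
  \<comment> \<open>Chosen for \<open>(sqrt N + 2 * d)^2 \<le> N + e\<close>. The excess over
    \<open>N\<close> is \<open>(4 * sqrt N + 4 * d) * d\<close>, where \<open>d \<le> 1\<close>
    replaces the inner \<open>d\<close>.\<close>
  define d where "d = min 1 (e / (4 * sqrt N + 4))"
  have den: "0 < 4 * sqrt N + 4" using N by (simp add: add_nonneg_pos)
  have d: "0 < d" "d \<le> 1" "d * (4 * sqrt N + 4) \<le> e"
  proof -
    show "0 < d" "d \<le> 1" using e den by (auto simp: d_def)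
    have "d \<le> e / (4 * sqrt N + 4)" by (simp add: d_def)
    then show "d * (4 * sqrt N + 4) \<le> e" using den by (simp add: pos_le_divide_eq)
  qed
  have "eventually (\<lambda>n. (AVG \<xi>. \<bar>oscillation (dilation_radius n) \<xi>\<bar> powr s) powr (1 / s) < d\<^sup>2) sequentially"
    using oscillation_powr_limit[OF s1] by (rule order_tendstoD(2)) (use d in simp)
  then show "eventually (\<lambda>n. \<forall>f. disc_test p f \<longrightarrow>
      (AVG z. F z * norm (f z - f (of_real (dilation_radius n) * z)) powr 2) \<le> circle_Lp_norm s F + e) sequentially"
  proof eventually_elim
    case (elim n)
    define r where "r = dilation_radius n"
    have r: "0 \<le> r" "r < 1" using dilation_radius(1,2)[of n] by (auto simp: r_def)
    show ?case unfolding r_def[symmetric] N_def[symmetric]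
    proof (intro allI impI)
      fix f assume f: "disc_test p f"
      obtain R where fm [measurable]: "f \<in> borel_measurable borel" and R: "1 < R" "f holomorphic_on ball 0 R"
        and le: "(AVG z. norm (f z) powr p) \<le> 1"
        using f unfolding disc_test_def by blast
      define u where "u = (\<lambda>z. amp z *\<^sub>R f z)"
      have um [measurable]: "u \<in> borel_measurable borel" unfolding u_def by measurable
      have fi: "integrable circle_measure f"
        by (rule integrable_circle_continuous[OF fm holomorphic_continuous_on_sphere[OF R(2,1)]])
      have sF: "AE z in circle_measure. (norm (u z))\<^sup>2 = F z * norm (f z) powr 2"
        using amp(4) by eventually_elim (simp add: u_def power_mult_distrib)
      note H = Hoelder_contact[of 2 p s f 1, OF _ p s fm disc_test_integrable[OF f]]
      have HI: "integrable circle_measure (\<lambda>z. F z * norm (f z) powr 2)" by (rule H(1)) (use p le in auto)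
      have Hle: "(AVG z. F z * norm (f z) powr 2) \<le> N" using H(2) p le by (simp add: N_def)
      have uI: "integrable circle_measure (\<lambda>z. (norm (u z))\<^sup>2)"
        by (rule integrable_cong_AE_imp[OF HI]) (use sF in \<open>auto elim!: eventually_mono\<close>)
      have ule: "(AVG z. (norm (u z))\<^sup>2) \<le> N"
      proof -
        have "(AVG z. (norm (u z))\<^sup>2) = (AVG z. F z * norm (f z) powr 2)"
          by (rule integral_cong_AE) (use sF in auto)
        with Hle show ?thesis by simp
      qed
      have ui: "integrable circle_measure u" by (rule integrable_powr_imp_integrable[of 2, OF _ um]) (use uI in auto)
      define P where "P = poisson_operator r u"
      define Q where "Q = (poisson_operator r f)"
      have [measurable]: "P \<in> borel_measurable borel" "Q \<in> borel_measurable borel"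
        unfolding P_def Q_def by (rule borel_measurable_poisson_operator, rule ui fi)+
      have Q_eq: "Q z = f (of_real r * z)" if "norm z = 1" for z
        unfolding Q_def by (rule poisson_operator_holomorphic[OF fm R(2,1) r that])
      note gap = poisson_operator_L2_gap[OF um uI r, folded P_def]
      \<comment> \<open>\<open>N\<close> may be 0, and \<open>Minkowski_powr_bound\<close> wants
        positive bounds; hence \<open>sqrt N + d\<close>.\<close>
      have g1: "(AVG z. norm (u z - P z) powr 2) \<le> (sqrt N + d) powr 2"
      proof -
        have "0 \<le> (AVG z. (norm (P z))\<^sup>2)" by simp
        then have "(AVG z. (norm (u z - P z))\<^sup>2) \<le> N" using gap(3) ule by linarith
        also have "N = (sqrt N)\<^sup>2" using N by simp
        also have "\<dots> \<le> (sqrt N + d)\<^sup>2" using d N by (intro power_mono) auto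
        finally show ?thesis using d N by simp
      qed
      obtain B where B: "\<And>z. norm z = 1 \<Longrightarrow> norm (f z) \<le> B"
        using continuous_on_sphere_bounded[OF holomorphic_continuous_on_sphere[OF R(2,1)]] by blast
      have g2: "(AVG z. norm (P z - amp z *\<^sub>R Q z) powr 2) \<le> d powr 2"
        using weighted_commutator_small[OF p s f r] elim d unfolding P_def Q_def u_def r_def by simp
      have Bb: "integrable circle_measure (\<lambda>z. norm (P z - amp z *\<^sub>R Q z) powr 2)"
      proof -
        let ?c = "(1 + r) / (1 - r)"
        have "norm (P z - amp z *\<^sub>R Q z) \<le> ?c * (AVG z. norm (u z)) + amp_bound * (?c * (AVG z. norm (f z)))" if z: "norm z = 1" for z
        proof -
          have "norm (P z) \<le> ?c * (AVG z. norm (u z))" unfolding P_def by (rule poisson_operator_norm_le[OF ui r z])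
          moreover have "norm (amp z *\<^sub>R Q z) \<le> amp_bound * (?c * (AVG z. norm (f z)))"
            unfolding norm_scaleR Q_def using amp(1,2)[of z] by (intro mult_mono poisson_operator_norm_le[OF fi r z]) auto
          ultimately show ?thesis by (intro order_trans[OF norm_triangle_ineq4] add_mono)
        qed
        then obtain X where X: "\<And>z. norm z = 1 \<Longrightarrow> norm (P z - amp z *\<^sub>R Q z) \<le> X" by blast
        show ?thesis
        proof (rule integrable_circle_bounded[where B = "X powr 2"])
          fix z :: complex assume "norm z = 1"
          then have "norm (P z - amp z *\<^sub>R Q z) powr 2 \<le> X powr 2" by (intro powr_mono2 X) auto
          then show "norm (norm (P z - amp z *\<^sub>R Q z) powr 2) \<le> X powr 2"
            by (simp only: real_norm_def abs_of_nonneg[OF powr_ge_zero])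
        qed measurable
      qed
      have "(AVG z. norm ((u z - P z) + (P z - amp z *\<^sub>R Q z)) powr 2) \<le> ((sqrt N + d) + d) powr 2"
        by (rule Minkowski_powr_bound(2)[OF _ _ d(1) _ _ _ g1 Bb g2]) (use gap(1) d N in \<open>auto simp: add_nonneg_pos\<close>)
      also have "(AVG z. norm ((u z - P z) + (P z - amp z *\<^sub>R Q z)) powr 2) = (AVG z. F z * norm (f z - f (of_real r * z)) powr 2)"
      proof (rule integral_cong_AE)
        show "AE z in circle_measure. norm ((u z - P z) + (P z - amp z *\<^sub>R Q z)) powr 2 = F z * norm (f z - f (of_real r * z)) powr 2"
          using amp(4) AE_circle_measure
        proof eventually_elim
          case (elim z)
          have "(u z - P z) + (P z - amp z *\<^sub>R Q z) = amp z *\<^sub>R (f z - f (of_real r * z))"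
            using Q_eq[OF elim(2)] by (simp add: u_def scaleR_diff_right)
          then show ?case using elim(1) by (simp add: power_mult_distrib)
        qed
      qed measurable
      also have "((sqrt N + d) + d) powr 2 = (sqrt N + 2 * d)\<^sup>2" using d N by simp
      also have "\<dots> = N + (4 * sqrt N + 4 * d) * d" using N by (simp add: power2_eq_square algebra_simps)
      also have "(4 * sqrt N + 4 * d) * d \<le> (4 * sqrt N + 4) * d" using d by (intro mult_right_mono) auto
      also have "\<dots> \<le> e" using d(3) by (simp add: mult.commute)
      finally show "(AVG z. F z * norm (f z - f (of_real r * z)) powr 2) \<le> N + e" by simp
    qed
  qed
qed (use p in auto)

lemma essential_norm_ge:
  assumes q: "1 \<le> q" "q < p" and s: "s = p / (p - q)"
  shows "circle_Lp_norm s F powr (1 / q) \<le> essential_norm p q (composition_operator \<phi>)"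
  unfolding essential_norm_def
proof (rule cINF_greatest)
  have "compact_operator p q (dilated_composition \<phi> (1 / 2))"
    using q by (intro compact_dilated_composition) auto
  then show "{K. compact_operator p q K} \<noteq> {}" by blast
qed (use operator_norm_ge[OF q s] in simp)

end

section \<open>Independence of the values off the disc, and the theorem\<close>

lemma radial_tendsto_cong:
  fixes \<phi> \<psi> :: "complex \<Rightarrow> complex"
  assumes "\<And>z. norm z < 1 \<Longrightarrow> \<phi> z = \<psi> z" "norm \<xi> = 1"
  shows "((\<lambda>r. \<phi> (of_real r * \<xi>)) \<longlongrightarrow> l) (at_left 1) \<longleftrightarrow> ((\<lambda>r. \<psi> (of_real r * \<xi>)) \<longlongrightarrow> l) (at_left 1)"
proof (rule tendsto_cong)
  have "eventually (\<lambda>r::real. 0 < r \<and> r < 1) (at_left 1)" using eventually_at_left_real[of 0 1] by simp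
  then show "eventually (\<lambda>r. \<phi> (of_real r * \<xi>) = \<psi> (of_real r * \<xi>)) (at_left 1)"
    by eventually_elim (use assms in \<open>auto simp: norm_mult\<close>)
qed

text \<open>The first two conjuncts certify that the norms in the others have their intended
  meaning: a real supremum or infimum over an unbounded set, or the Bochner integral of a
  non-integrable function, would be a default value.\<close>

theorem theorem1p1:
  fixes p q s :: real and \<phi> :: "complex \<Rightarrow> complex"
  assumes "1 \<le> q" and "q < p" and "s = p / (p - q)"
    and "\<phi> holomorphic_on ball 0 1" and "\<phi> ` ball 0 1 \<subseteq> ball 0 1"
    and "measure circle_measure (contact_set \<phi>) > 0"
  shows "bounded_operator p q (composition_operator \<phi>) \<and>
    contact_density \<phi> \<in> circle_Lp s \<and>
    circle_Lp_norm s (contact_density \<phi>) powr (1 / q)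
      \<le> essential_norm p q (composition_operator \<phi>) \<and>
    essential_norm p q (composition_operator \<phi>)
      \<le> 2 * circle_Lp_norm s (contact_density \<phi>) powr (1 / q) \<and>
    (q = 2 \<longrightarrow> essential_norm p q (composition_operator \<phi>)
      = circle_Lp_norm s (contact_density \<phi>) powr (1 / 2))"
proof -
  \<comment> \<open>Off the disc \<open>\<phi>\<close> is arbitrary, possibly not measurable; all notions depend only on its values
    in the disc.\<close>
  define \<psi> where "\<psi> = disc_restriction \<phi>"
  have eq: "\<phi> z = \<psi> z" if "norm z < 1" for z using that by (simp add: \<psi>_def disc_restriction_def)
  have lim: "((\<lambda>r. \<phi> (of_real r * \<xi>)) \<longlongrightarrow> l) (at_left 1) \<longleftrightarrow> ((\<lambda>r. \<psi> (of_real r * \<xi>)) \<longlongrightarrow> l) (at_left 1)" if "norm \<xi> = 1" for \<xi> l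
    by (rule radial_tendsto_cong[OF eq that])
  \<comment> \<open>\<open>Lim\<close> is a definite description over the limit relation, so
    equivalent relations give equal values even where no limit exists.\<close>
  have rl: "radial_limit \<phi> \<xi> = radial_limit \<psi> \<xi>" if "norm \<xi> = 1" for \<xi>
    unfolding radial_limit_def Topological_Spaces.Lim_def lim[OF that] ..
  have E: "contact_set \<phi> = contact_set \<psi>"
    unfolding contact_set_def using lim rl by auto
  have "contact_pushforward \<phi> = contact_pushforward \<psi>"
    unfolding contact_pushforward_def E
    by (rule distr_cong) (auto simp: space_restrict_space contact_set_def rl)
  then have F: "contact_density \<phi> = contact_density \<psi>" by (simp add: contact_density_def fun_eq_iff)
  have C: "composition_operator \<phi> = composition_operator \<psi>"
    by (auto simp: composition_operator_def fun_eq_iff eq)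
  have hol: "\<psi> holomorphic_on ball 0 1"
    using assms(4) by (rule holomorphic_transform) (simp add: eq)
  interpret disc_self_map \<psi>
  proof
    show "\<psi> \<in> borel_measurable borel"
      by (rule borel_measurable_if_holomorphic[OF hol]) (simp add: \<psi>_def disc_restriction_def)
    show "\<psi> ` ball 0 1 \<subseteq> ball 0 1" using assms(5) eq by (auto simp: image_subset_iff)
    show "measure circle_measure (contact_set \<psi>) > 0" using assms(6) E by simp
  qed (rule hol)
  have s: "0 < s" using assms by simp
  have "bounded_operator p q (composition_operator \<psi>)"
    using assms borel hol self by (intro bounded_composition_operator) auto
  moreover have "q = 2 \<longrightarrow> essential_norm p q (composition_operator \<psi>) = circle_Lp_norm s (contact_density \<psi>) powr (1 / 2)"
    using essential_norm_le_once[of p s] essential_norm_ge[OF assms(1-3)] assms(2,3) by auto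
  ultimately show ?thesis
    using density_in_circle_Lp(2)[OF s] essential_norm_ge[OF assms(1-3)] essential_norm_le_twice[OF assms(1-3)]
    unfolding F C by blast
qed

end
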